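(* Let $\Sigma=\{1,\dots,\mathfrak r\}$ be a finite set, let $(P_n)_{n\ge1}$ be stochastic matrices on $\Sigma$ converging entrywise to a stochastic matrix $P$, let $\pi$ be a probability distribution on $\Sigma$, let $\mathbb P_\pi$ be the law of the nonhomogeneous Markov chain with initial distribution $\pi$ and transition matrices $(P_n)$, let $f:\Sigma\to\mathbb R^d$ ($d\ge1$) and $Z_n=\frac1n\sum_{i=1}^nf(X_i)$. Suppose $\mathbb P_\pi$ satisfies Condition SIE and Assumption A, and also either Assumption B or Assumption C (see context). Then, with the good rate function $\mathbb J=\mathbb J_{\mathcal U_0}$, for every Borel set $\Gamma\subset\mathbb R^d$, $$-\inf_{z\in\Gamma^o}\mathbb J(z)\le\liminf_{n\to\infty}\frac1n\log\mathbb P_\pi(Z_n\in\Gamma^o)\le\limsup_{n\to\infty}\frac1n\log\mathbb P_\pi(Z_n\in\overline\Gamma)\le-\inf_{z\in\overline\Gamma}\mathbb J(z).$$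
   Context: Conventions: $\pm\infty\cdot0=0$, $\log0=-\infty$, $\inf\varnothing=+\infty$. A good rate function on $\mathbb R^d$ is a lower semicontinuous function $\mathbb R^d\to[0,\infty]$ with compact level sets. Chain: $P=(p(i,j))$, $P_n=(p_n(i,j))$. Under $\mathbb P_\pi$, $X_0\sim\pi$ and $\mathbb P_\pi(X_{n+1}=j\mid X_0,\dots,X_{n-1},X_n=i)=p_{n+1}(i,j)$, $n\ge0$. Decomposition of $P$: let $C_1,\dots,C_{N+M}$ be the communicating classes of $P$ (states $x,y$ are in the same class iff $x=y$ or each is reachable from the other with positive $P$-probability), numbered so that $p(x,y)=0$ for $x\in C_i,y\in C_j,i>j$. Put $P(i)=(p(x,y))_{x,y\in C_i}$. Each $P(i)$ is either the $1\times1$ zero matrix (degenerate transient; the set of such $i$ is $\mathcal D$, $|\mathcal D|=N$) or irreducible; $\mathcal G$ is the set of $i$ with $P(i)$ irreducible (either a nondegenerate transient class or a closed, i.e. stochastic, class), $|\mathcal G|=M\ge1$, $\mathcal G=\{\zeta_1,\dots,\zeta_M\}$. Rate functions: for $i\in\mathcal G$, $\lambda\in\mathbb R^d$, $\rho(C_i,\lambda)$ is the Perron–Frobenius eigenvalue of $(p(x,y)e^{\langle\lambda,f(y)\rangle})_{x,y\in C_i}$ and $\mathbb I_i(x)=\sup_{\lambda\in\mathbb R^d}\{\langle\lambda,x\rangle-\log\rho(C_i,\lambda)\}$. Function $\mathbb J_U$: $\mathbb S_M$ is the set of permutations of $\{1,\dots,M\}$, $\Omega_M$ the set of probability vectors in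 $\mathbb R^M$, $D(M,\mathbf v,z)=\{\mathbf x\in(\mathbb R^d)^M:\sum_{i=1}^Mv_ix_i=z\}$. For $U=\{u(i,j)\}$ with entries in $[-\infty,0]$ for distinct $i,j\in\mathcal G$, $$C_{\mathbf v,U}(\sigma,\mathbf x)=-\sum_{i=1}^{M-1}\Big(\sum_{j=1}^iv_j\Big)u(\zeta_{\sigma(i)},\zeta_{\sigma(i+1)})+\sum_{i=1}^Mv_i\mathbb I_{\zeta_{\sigma(i)}}(x_i)$$ if $M\ge2$, $C_{\mathbf v,U}(\sigma,\mathbf x)=\mathbb I_{\zeta_1}(x_1)$ if $M=1$, and $\mathbb J_U(z)=\inf_{\mathbf v\in\Omega_M}\inf_{\mathbf x\in D(M,\mathbf v,z)}\min_{\sigma\in\mathbb S_M}C_{\mathbf v,U}(\sigma,\mathbf x)$. Costs: for distinct $1\le i,j\le N+M$, $t(n,(i,j))=\max_{x\in C_i,y\in C_j}p_n(x,y)$, $\upsilon(i,j)=\limsup_n\frac1n\log t(n,(i,j))$, $\tau(i,j)=\liminf_n\frac1n\log t(n,(i,j))$, and $\mathcal U_0(i,j)=\max_{0\le k\le N+M-2}\max_{L_k}\sum_{s=0}^k\upsilon(l_s,l_{s+1})$, where $L_k=\langle l_0,\dots,l_{k+1}\rangle$ ranges over tuples of distinct indices in $\{1,\dots,N+M\}$ with $l_0=i$, $l_{k+1}=j$. Condition SIE: let $n_0\ge1$ be the first index $m$ such that for all $i\in\mathcal G$ and $s,t\in C_i$ with $p(s,t)>0$ one has $p_n(s,t)>0$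 for all $n\ge m$. Condition SIE: there is $n_1\ge n_0-1$ with $\mathbb P_\pi(X_{n_1}\in C_i)>0$ for all $i\in\mathcal G$. Assumption A: $\upsilon(i,j)=\tau(i,j)$ for all distinct $1\le i,j\le N+M$. Assumption B: for all distinct $1\le i,j\le N+M$ there exist $a=a(i,j)\in C_i$ and a sequence $b_n=b_n(i,j)\in C_j$ with $\tau(i,j)=\lim_n\frac1n\log p_n(a,b_n)$. Assumption C: for every $i\in\mathcal G$ the matrix $P^*(i)=(p^*(s,t))_{s,t\in C_i}$ is primitive (some power is entrywise positive), where $p^*(s,t)=p(s,t)$ if $p(s,t)>0$; $p^*(s,t)=1$ if $p(s,t)=0$ and $\liminf_n\frac1n\log p_n(s,t)=0$; $p^*(s,t)=0$ otherwise. *)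

theory Defs
  imports "HOL-Probability.Probability" "HOL-Combinatorics.Permutations"
begin

text \<open>
  The state space is a finite type \<open>'s\<close>; a matrix on it is a function \<open>'s \<Rightarrow> 's \<Rightarrow> real\<close>.  The transition
  matrices form a sequence \<open>P\<close> whose entry \<open>P 0\<close> is never used, and \<open>p\<close> is the limit matrix.
  Euclidean space is \<open>real ^ 'd\<close>.  On \<open>ereal\<close> the library already has \<open>\<plusminus>\<infinity> * 0 = 0\<close> and
  \<open>Inf {} = \<infinity>\<close>.
\<close>

definition elog :: "real \<Rightarrow> ereal" where
  "elog x = (if x \<le> 0 then -\<infinity> else ereal (ln x))"

definition stochastic :: "('s::finite \<Rightarrow> 's \<Rightarrow> real) \<Rightarrow> bool" where
  "stochastic A \<longleftrightarrow> (\<forall>x y. 0 \<le> A x y) \<and> (\<forall>x. (\<Sum>y\<in>UNIV. A x y) = 1)"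

definition nonhomogeneous_chain ::
  "'w measure \<Rightarrow> (nat \<Rightarrow> 'w \<Rightarrow> 's::finite) \<Rightarrow> 's pmf \<Rightarrow> (nat \<Rightarrow> 's \<Rightarrow> 's \<Rightarrow> real) \<Rightarrow> bool" where
  "nonhomogeneous_chain M X \<pi> P \<longleftrightarrow>
     prob_space M \<and>
     (\<forall>n. X n \<in> measurable M (count_space UNIV)) \<and>
     (\<forall>x. \<P>(\<omega> in M. X 0 \<omega> = x) = pmf \<pi> x) \<and>
     (\<forall>n x j. \<P>(\<omega> in M. \<forall>k\<le>n. X k \<omega> = x k) > 0 \<longrightarrow>
        \<P>(\<omega> in M. X (Suc n) \<omega> = j \<bar> \<forall>k\<le>n. X k \<omega> = x k) = P (Suc n) (x n) j)"

definition empirical_mean :: "('s \<Rightarrow> real ^ 'd) \<Rightarrow> (nat \<Rightarrow> 'w \<Rightarrow> 's) \<Rightarrow> nat \<Rightarrow> 'w \<Rightarrow> real ^ 'd" where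
  "empirical_mean f X n \<omega> = (1 / real n) *\<^sub>R (\<Sum>i=1..n. f (X i \<omega>))"

definition lsc :: "('a::topological_space \<Rightarrow> ereal) \<Rightarrow> bool" where
  "lsc J \<longleftrightarrow> (\<forall>z. J z \<le> Liminf (at z) J)"

definition good_rate_function :: "(real ^ 'd \<Rightarrow> ereal) \<Rightarrow> bool" where
  "good_rate_function J \<longleftrightarrow>
     (\<forall>z. 0 \<le> J z) \<and> lsc J \<and> (\<forall>\<alpha>::real. compact {z. J z \<le> ereal \<alpha>})"


subsection \<open>Matrices indexed by a set of states\<close>

text \<open>Only the entries of \<open>A\<close> with both indices in \<open>S\<close> matter in the following notions.\<close>

primrec matrix_power :: "'s set \<Rightarrow> ('s \<Rightarrow> 's \<Rightarrow> real) \<Rightarrow> nat \<Rightarrow> 's \<Rightarrow> 's \<Rightarrow> real" where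
  "matrix_power S A 0 x y = (if x = y then 1 else 0)"
| "matrix_power S A (Suc n) x y = (\<Sum>z\<in>S. A x z * matrix_power S A n z y)"

definition irreducible_on :: "'s set \<Rightarrow> ('s \<Rightarrow> 's \<Rightarrow> real) \<Rightarrow> bool" where
  "irreducible_on S A \<longleftrightarrow> (\<forall>x\<in>S. \<forall>y\<in>S. \<exists>n\<ge>1. matrix_power S A n x y > 0)"

definition primitive_on :: "'s set \<Rightarrow> ('s \<Rightarrow> 's \<Rightarrow> real) \<Rightarrow> bool" where
  "primitive_on S A \<longleftrightarrow> (\<exists>n\<ge>1. \<forall>x\<in>S. \<forall>y\<in>S. matrix_power S A n x y > 0)"

definition eigenvalue_on :: "'s set \<Rightarrow> ('s \<Rightarrow> 's \<Rightarrow> real) \<Rightarrow> complex \<Rightarrow> bool" where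
  "eigenvalue_on S A z \<longleftrightarrow>
     (\<exists>v. (\<exists>x\<in>S. v x \<noteq> 0) \<and> (\<forall>x\<in>S. (\<Sum>y\<in>S. complex_of_real (A x y) * v y) = z * v x))"

text \<open>The real eigenvalue that dominates all complex eigenvalues in modulus; the Perron--Frobenius
  theorem says that it exists for an irreducible nonnegative matrix, and it is clearly unique.\<close>

definition PF_eigenvalue :: "'s set \<Rightarrow> ('s \<Rightarrow> 's \<Rightarrow> real) \<Rightarrow> real" where
  "PF_eigenvalue S A =
     (THE r. eigenvalue_on S A (complex_of_real r) \<and> (\<forall>z. eigenvalue_on S A z \<longrightarrow> cmod z \<le> r))"


subsection \<open>Decomposition of the limit matrix\<close>

definition reachable :: "('s::finite \<Rightarrow> 's \<Rightarrow> real) \<Rightarrow> 's \<Rightarrow> 's \<Rightarrow> bool" where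
  "reachable p x y \<longleftrightarrow> (\<exists>n\<ge>1. matrix_power UNIV p n x y > 0)"

definition communicating :: "('s::finite \<Rightarrow> 's \<Rightarrow> real) \<Rightarrow> ('s \<times> 's) set" where
  "communicating p = {(x, y). x = y \<or> (reachable p x y \<and> reachable p y x)}"

text \<open>\<open>C 1, \<dots>, C K\<close> lists the communicating classes, each exactly once, in such an order that
  one-step transitions never decrease the index.\<close>

definition class_numbering :: "('s::finite \<Rightarrow> 's \<Rightarrow> real) \<Rightarrow> nat \<Rightarrow> (nat \<Rightarrow> 's set) \<Rightarrow> bool" where
  "class_numbering p K C \<longleftrightarrow>
     bij_betw C {1..K} (UNIV // communicating p) \<and>
     (\<forall>i\<in>{1..K}. \<forall>j\<in>{1..K}. i > j \<longrightarrow> (\<forall>x\<in>C i. \<forall>y\<in>C j. p x y = 0))"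

definition irreducible_indices :: "('s \<Rightarrow> 's \<Rightarrow> real) \<Rightarrow> nat \<Rightarrow> (nat \<Rightarrow> 's set) \<Rightarrow> nat set" where
  "irreducible_indices p K C = {i \<in> {1..K}. irreducible_on (C i) p}"


subsection \<open>Rate functions\<close>

definition tilted_eigenvalue ::
  "('s \<Rightarrow> 's \<Rightarrow> real) \<Rightarrow> ('s \<Rightarrow> real ^ 'd) \<Rightarrow> 's set \<Rightarrow> real ^ 'd \<Rightarrow> real" where
  "tilted_eigenvalue p f S l = PF_eigenvalue S (\<lambda>x y. p x y * exp (l \<bullet> f y))"

definition class_rate ::
  "('s \<Rightarrow> 's \<Rightarrow> real) \<Rightarrow> ('s \<Rightarrow> real ^ 'd) \<Rightarrow> 's set \<Rightarrow> real ^ 'd \<Rightarrow> ereal" where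
  "class_rate p f S x = (SUP l. ereal (l \<bullet> x) - elog (tilted_eigenvalue p f S l))"

text \<open>Vectors in \<open>\<real>\<^sup>M\<close> and \<open>(\<real>\<^sup>d)\<^sup>M\<close> are functions on \<open>nat\<close> that are only looked at on \<open>{1..M}\<close>.\<close>

definition prob_vectors :: "nat \<Rightarrow> (nat \<Rightarrow> real) set" where
  "prob_vectors M = {v. (\<forall>i\<in>{1..M}. 0 \<le> v i) \<and> (\<Sum>i=1..M. v i) = 1}"

definition decompositions :: "nat \<Rightarrow> (nat \<Rightarrow> real) \<Rightarrow> real ^ 'd \<Rightarrow> (nat \<Rightarrow> real ^ 'd) set" where
  "decompositions M v z = {x. (\<Sum>i=1..M. v i *\<^sub>R x i) = z}"

text \<open>\<open>I i\<close> is the rate function of the class with index \<open>i\<close>; \<open>\<zeta> 1, \<dots>, \<zeta> M\<close> are the indices of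
  the irreducible classes.\<close>

definition path_cost ::
  "nat \<Rightarrow> (nat \<Rightarrow> nat) \<Rightarrow> (nat \<Rightarrow> real ^ 'd \<Rightarrow> ereal) \<Rightarrow> (nat \<Rightarrow> nat \<Rightarrow> ereal) \<Rightarrow> (nat \<Rightarrow> real) \<Rightarrow>
   (nat \<Rightarrow> nat) \<Rightarrow> (nat \<Rightarrow> real ^ 'd) \<Rightarrow> ereal" where
  "path_cost M \<zeta> I U v \<sigma> x =
     (if M \<ge> 2 then
        - (\<Sum>i=1..M-1. ereal (\<Sum>j=1..i. v j) * U (\<zeta> (\<sigma> i)) (\<zeta> (\<sigma> (i + 1))))
        + (\<Sum>i=1..M. ereal (v i) * I (\<zeta> (\<sigma> i)) (x i))
      else I (\<zeta> 1) (x 1))"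

definition J_fun ::
  "nat \<Rightarrow> (nat \<Rightarrow> nat) \<Rightarrow> (nat \<Rightarrow> real ^ 'd \<Rightarrow> ereal) \<Rightarrow> (nat \<Rightarrow> nat \<Rightarrow> ereal) \<Rightarrow> real ^ 'd \<Rightarrow> ereal" where
  "J_fun M \<zeta> I U z =
     (INF v\<in>prob_vectors M. INF x\<in>decompositions M v z.
        MIN \<sigma>\<in>{\<sigma>. \<sigma> permutes {1..M}}. path_cost M \<zeta> I U v \<sigma> x)"


subsection \<open>Transition costs\<close>

definition log_rate :: "(nat \<Rightarrow> real) \<Rightarrow> nat \<Rightarrow> ereal" where
  "log_rate a n = ereal (1 / real n) * elog (a n)"

definition max_transition ::
  "(nat \<Rightarrow> 's \<Rightarrow> 's \<Rightarrow> real) \<Rightarrow> (nat \<Rightarrow> 's set) \<Rightarrow> nat \<Rightarrow> nat \<Rightarrow> nat \<Rightarrow> real" where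
  "max_transition P C i j n = Max {P n x y | x y. x \<in> C i \<and> y \<in> C j}"

definition upper_cost ::
  "(nat \<Rightarrow> 's \<Rightarrow> 's \<Rightarrow> real) \<Rightarrow> (nat \<Rightarrow> 's set) \<Rightarrow> nat \<Rightarrow> nat \<Rightarrow> ereal" where
  "upper_cost P C i j = limsup (log_rate (max_transition P C i j))"

definition lower_cost ::
  "(nat \<Rightarrow> 's \<Rightarrow> 's \<Rightarrow> real) \<Rightarrow> (nat \<Rightarrow> 's set) \<Rightarrow> nat \<Rightarrow> nat \<Rightarrow> ereal" where
  "lower_cost P C i j = liminf (log_rate (max_transition P C i j))"

definition index_tuples :: "nat \<Rightarrow> nat \<Rightarrow> nat \<Rightarrow> nat \<Rightarrow> nat list set" where
  "index_tuples K k i j =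
     {l. length l = k + 2 \<and> distinct l \<and> set l \<subseteq> {1..K} \<and> l ! 0 = i \<and> l ! (k + 1) = j}"

text \<open>Only used for distinct \<open>i\<close> and \<open>j\<close> in \<open>{1..K}\<close>; then \<open>K \<ge> 2\<close> and all maxima are over nonempty
  finite sets.\<close>

definition U0 ::
  "nat \<Rightarrow> (nat \<Rightarrow> 's \<Rightarrow> 's \<Rightarrow> real) \<Rightarrow> (nat \<Rightarrow> 's set) \<Rightarrow> nat \<Rightarrow> nat \<Rightarrow> ereal" where
  "U0 K P C i j =
     (MAX k\<in>{0..K - 2}. MAX l\<in>index_tuples K k i j. \<Sum>s=0..k. upper_cost P C (l ! s) (l ! (s + 1)))"


subsection \<open>Conditions on the chain\<close>

text \<open>\<open>G\<close> stands for the set of indices of irreducible classes.\<close>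

definition first_positive_index ::
  "('s \<Rightarrow> 's \<Rightarrow> real) \<Rightarrow> (nat \<Rightarrow> 's \<Rightarrow> 's \<Rightarrow> real) \<Rightarrow> (nat \<Rightarrow> 's set) \<Rightarrow> nat set \<Rightarrow> nat" where
  "first_positive_index p P C G =
     (LEAST m. m \<ge> 1 \<and>
        (\<forall>i\<in>G. \<forall>s\<in>C i. \<forall>t\<in>C i. p s t > 0 \<longrightarrow> (\<forall>n\<ge>m. P n s t > 0)))"

definition condition_SIE ::
  "'w measure \<Rightarrow> (nat \<Rightarrow> 'w \<Rightarrow> 's) \<Rightarrow> ('s \<Rightarrow> 's \<Rightarrow> real) \<Rightarrow> (nat \<Rightarrow> 's \<Rightarrow> 's \<Rightarrow> real) \<Rightarrow>
   (nat \<Rightarrow> 's set) \<Rightarrow> nat set \<Rightarrow> bool" where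
  "condition_SIE M X p P C G \<longleftrightarrow>
     (\<exists>n\<ge>first_positive_index p P C G - 1. \<forall>i\<in>G. \<P>(\<omega> in M. X n \<omega> \<in> C i) > 0)"

definition assumption_A :: "nat \<Rightarrow> (nat \<Rightarrow> 's \<Rightarrow> 's \<Rightarrow> real) \<Rightarrow> (nat \<Rightarrow> 's set) \<Rightarrow> bool" where
  "assumption_A K P C \<longleftrightarrow>
     (\<forall>i\<in>{1..K}. \<forall>j\<in>{1..K}. i \<noteq> j \<longrightarrow> upper_cost P C i j = lower_cost P C i j)"

definition assumption_B :: "nat \<Rightarrow> (nat \<Rightarrow> 's \<Rightarrow> 's \<Rightarrow> real) \<Rightarrow> (nat \<Rightarrow> 's set) \<Rightarrow> bool" where
  "assumption_B K P C \<longleftrightarrow>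
     (\<forall>i\<in>{1..K}. \<forall>j\<in>{1..K}. i \<noteq> j \<longrightarrow>
        (\<exists>a\<in>C i. \<exists>b. (\<forall>n. b n \<in> C j) \<and>
           (log_rate (\<lambda>n. P n a (b n)) \<longlonglongrightarrow> lower_cost P C i j)))"

definition augmented_matrix ::
  "('s \<Rightarrow> 's \<Rightarrow> real) \<Rightarrow> (nat \<Rightarrow> 's \<Rightarrow> 's \<Rightarrow> real) \<Rightarrow> 's \<Rightarrow> 's \<Rightarrow> real" where
  "augmented_matrix p P s t =
     (if p s t > 0 then p s t
      else if liminf (log_rate (\<lambda>n. P n s t)) = 0 then 1
      else 0)"

definition assumption_C ::
  "('s \<Rightarrow> 's \<Rightarrow> real) \<Rightarrow> (nat \<Rightarrow> 's \<Rightarrow> 's \<Rightarrow> real) \<Rightarrow> (nat \<Rightarrow> 's set) \<Rightarrow> nat set \<Rightarrow> bool" where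
  "assumption_C p P C G \<longleftrightarrow> (\<forall>i\<in>G. primitive_on (C i) (augmented_matrix p P))"

end

theory Submission
  imports Defs
begin

text \<open>
  Upper bound.  A path of length \<open>n\<close> has a configuration: its occupation counts and the last visit time of
  every irreducible class.  There are only polynomially many configurations, so it suffices to bound
  the weight of one of them.  Exponential tilting accounts for the counts.  If the visited classes are
  ordered by last visit time, then at the last visit to a class the time spent in it and in the earlier
  ones has elapsed, and a Lyapunov function, built from the class eigenvectors and the costs \<open>U0\<close>, shows
  that going from there to the next class costs at least what \<open>J\<close> charges; returns to a class thus need
  not be counted.  The bound for the limit of the configurations along a subsequence is \<open>J\<close>.

  Lower bound.  Weights of loops at a state are supermultiplicative, so the pairs (mean of \<open>f\<close>, rate) of
  loops have a convex closure; separating a point from it shows, without differentiability of the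
  eigenvalue, that loops realise the rate function of a class.  Loops in the classes are then joined
  along routes that attain \<open>U0\<close>, which each of Assumptions B and C makes possible at bounded cost in time.
\<close>

text \<open>The obstacle is that \<open>P n\<close> may have positive entries where \<open>p\<close>
  vanishes, so the chain can move between classes in any direction, at a cost that depends on time,
  and can return to classes that it has left. At time m a step from class i to class j weighs about
  exp (m * ups i j), which does not grow with m; hence an excursion that begins at time S can be
  charged as if all its steps happened at time S, and the triangle inequality for \<open>U0\<close>
  bounds the charge. The lower bound is shaped by not knowing in which state of a class the chain
  sits: every connection has to start from an arbitrary state and to take a bounded number of steps.
  When the best departure state varies with time, as \<open>assumption_C\<close> permits,
  primitivity supplies paths of one common length, so that the time of the jump, and with it the
  state to aim for, is known in advance. The plan is carried out on a fraction \<kappa> < 1 of the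
  time; the slack absorbs the connections, and the remaining steps are left free.\<close>

section \<open>Weights of paths\<close>

text \<open>Paths start in \<open>x\<close> at time \<open>S\<close>, and \<open>A m\<close> governs the step that ends at time \<open>m\<close>.\<close>

primrec pathw :: "(nat \<Rightarrow> 's \<Rightarrow> 's \<Rightarrow> real) \<Rightarrow> nat \<Rightarrow> 's \<Rightarrow> 's list \<Rightarrow> real" where
  "pathw A S x [] = 1"
| "pathw A S x (y # ys) = A (Suc S) x y * pathw A (Suc S) y ys"

text \<open>The backward semigroup of the time-dependent kernel, applied to a terminal function
  \<open>\<phi>\<close>. The recursion removes the first step, so that a bound for one step, valid
  at every time, iterates by induction on \<open>k\<close> with \<open>S\<close> arbitrary.\<close>

primrec evol :: "(nat \<Rightarrow> 's::finite \<Rightarrow> 's \<Rightarrow> real) \<Rightarrow> nat \<Rightarrow> nat \<Rightarrow> ('s \<Rightarrow> real) \<Rightarrow> 's \<Rightarrow> real" where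
  "evol A 0 S \<phi> x = \<phi> x"
| "evol A (Suc k) S \<phi> x = (\<Sum>y\<in>UNIV. A (Suc S) x y * evol A k (Suc S) \<phi> y)"

primrec steps :: "('s \<Rightarrow> 's \<Rightarrow> bool) \<Rightarrow> 's \<Rightarrow> 's list \<Rightarrow> bool" where
  "steps R x [] = True"
| "steps R x (y # ys) = (R x y \<and> steps R y ys)"

lemma finite_lists_length [simp]: "finite {ys :: 's::finite list. length ys = k}"
  using finite_lists_length_eq[of "UNIV :: 's set" k] by simp

lemma finite_lists_length_conj [simp]: "finite {ys :: 's::finite list. length ys = k \<and> Q ys}"
  by (rule finite_subset[OF _ finite_lists_length[of k]]) auto

lemma sum_lists_Suc:
  fixes F :: "'s::finite list \<Rightarrow> real"
  shows "(\<Sum>ys | length ys = Suc k. F ys) = (\<Sum>y\<in>UNIV. \<Sum>ys | length ys = k. F (y # ys))"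
proof -
  have "{ys :: 's list. length ys = Suc k} = (\<lambda>(y, ys). y # ys) ` (UNIV \<times> {ys. length ys = k})"
    by (auto simp: length_Suc_conv image_iff)
  then have "(\<Sum>ys | length ys = Suc k. F ys)
      = (\<Sum>(y, ys)\<in>UNIV \<times> {ys. length ys = k}. F (y # ys))"
    by (simp add: sum.reindex inj_on_def case_prod_unfold)
  then show ?thesis by (simp add: sum.cartesian_product)
qed

lemma evol_eq_sum:
  "evol A k S \<phi> x = (\<Sum>ys | length ys = k. pathw A S x ys * \<phi> (last (x # ys)))"
  by (induction k arbitrary: S x) (simp_all add: sum_lists_Suc sum_distrib_left mult.assoc)

lemma evol_add: "evol A (k + l) S \<phi> x = evol A k S (evol A l (S + k) \<phi>) x"
  by (induction k arbitrary: S x) simp_all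

lemma evol_nonneg:
  assumes "\<And>m x y. m > S \<Longrightarrow> 0 \<le> A m x y" "\<And>y. 0 \<le> \<phi> y"
  shows "0 \<le> evol A k S \<phi> x"
  using assms by (induction k arbitrary: S x) (auto intro!: sum_nonneg mult_nonneg_nonneg)

lemma evol_mono:
  assumes "\<And>m x y. m > S \<Longrightarrow> 0 \<le> A m x y" "\<And>m x y. m > S \<Longrightarrow> A m x y \<le> A' m x y"
    "\<And>y. 0 \<le> \<phi> y" "\<And>y. \<phi> y \<le> \<phi>' y"
  shows "evol A k S \<phi> x \<le> evol A' k S \<phi>' x"
  using assms
proof (induction k arbitrary: S x)
  case (Suc k)
  have "0 \<le> evol A k (Suc S) \<phi> y" for y
    by (rule evol_nonneg) (use Suc.prems in auto)
  moreover have "evol A k (Suc S) \<phi> y \<le> evol A' k (Suc S) \<phi>' y" for y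
    by (rule Suc.IH) (use Suc.prems in auto)
  moreover have "0 \<le> A (Suc S) x y" "A (Suc S) x y \<le> A' (Suc S) x y" for y
    using Suc.prems by auto
  moreover have "0 \<le> A' (Suc S) x y" for y
    using Suc.prems order_trans by blast
  ultimately show ?case
    by (auto intro!: sum_mono mult_mono)
qed simp

text \<open>The terminal function matters only where the final step can land; for a kernel that
  vanishes outside a prescribed set, this confines \<open>\<phi>\<close> to that set. At least one
  step is required, since after zero steps \<open>\<phi>\<close> is evaluated at the start.\<close>

lemma evol_cong_last:
  assumes "\<And>x y. A (Suc (S + k)) x y \<noteq> 0 \<Longrightarrow> \<phi> y = \<phi>' y"
  shows "evol A (Suc k) S \<phi> x = evol A (Suc k) S \<phi>' x"
  using assms
proof (induction k arbitrary: S x)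
  case 0
  then have "A (Suc S) x y * \<phi> y = A (Suc S) x y * \<phi>' y" for y by (cases "A (Suc S) x y = 0") auto
  then show ?case by (simp only: evol.simps)
next
  case (Suc k)
  have "evol A (Suc k) (Suc S) \<phi> y = evol A (Suc k) (Suc S) \<phi>' y" for y
    by (rule Suc.IH) (use Suc.prems in simp)
  then show ?case unfolding evol.simps(2)[of A "Suc k"] by presburger
qed

lemma evol_scale: "evol A k S (\<lambda>y. c * \<phi> y) x = c * evol A k S \<phi> x"
  by (induction k arbitrary: S x) (simp_all add: sum_distrib_left mult_ac)

lemma pathw_append:
  "pathw A S x (ys @ zs) = pathw A S x ys * pathw A (S + length ys) (last (x # ys)) zs"
  by (induction ys arbitrary: S x) simp_all

lemma pathw_nonneg:
  assumes "\<And>m x y. m > S \<Longrightarrow> 0 \<le> A m x y"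
  shows "0 \<le> pathw A S x ys"
  using assms by (induction ys arbitrary: S x) auto

text \<open>Exponential change of measure: the density along a path depends only on the states
  visited after the start.\<close>

lemma pathw_tilt:
  "pathw (\<lambda>m x y. A m x y * exp (g y)) S x ys = pathw A S x ys * exp (sum_list (map g ys))"
  by (induction ys arbitrary: S x) (simp_all add: exp_add mult_ac)

text \<open>\<open>D m\<close> is the set allowed at time \<open>m\<close>; entry \<open>k\<close>
  of the list is the state at time \<open>S + Suc k\<close>, because the start is not part of the
  list.\<close>

lemma pathw_restrict:
  "pathw (\<lambda>m x y. if y \<in> D m then A m x y else 0) S x ys
     = (if \<forall>k<length ys. ys ! k \<in> D (S + Suc k) then pathw A S x ys else 0)"
proof (induction ys arbitrary: S x)
  case (Cons y ys)
  then show ?case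
    by (auto simp: All_less_Suc2)
qed simp

lemma evol_stochastic:
  assumes "\<And>n. n > S \<Longrightarrow> stochastic (A n)"
  shows "evol A k S (\<lambda>_. 1) x = 1"
  using assms by (induction k arbitrary: S x) (auto simp: stochastic_def)

lemma matrix_power_nonneg:
  assumes "\<forall>x y. 0 \<le> A x y"
  shows "0 \<le> matrix_power S A n x y"
  using assms by (induction n arbitrary: x) (auto intro!: sum_nonneg)

text \<open>Nonnegative summands cannot cancel, so a positive entry of a power amounts to a path of
  positive steps. Later arguments about irreducibility and primitivity concatenate such
  paths.\<close>

lemma matrix_power_pos_iff:
  fixes A :: "'s::finite \<Rightarrow> 's \<Rightarrow> real"
  assumes "\<forall>x y. 0 \<le> A x y"
  shows "matrix_power S A n x y > 0 \<longleftrightarrow>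
    (\<exists>zs. length zs = n \<and> set zs \<subseteq> S \<and> steps (\<lambda>x y. A x y > 0) x zs \<and> last (x # zs) = y)"
proof (induction n arbitrary: x)
  case (Suc n)
  have nn: "0 \<le> A x z * matrix_power S A n z y" for z
    using assms by (simp add: matrix_power_nonneg)
  have "matrix_power S A (Suc n) x y > 0 \<longleftrightarrow> (\<exists>z\<in>S. A x z * matrix_power S A n z y > 0)"
  proof
    assume pos: "matrix_power S A (Suc n) x y > 0"
    show "\<exists>z\<in>S. A x z * matrix_power S A n z y > 0"
    proof (rule ccontr)
      assume "\<not> ?thesis"
      then have "(\<Sum>z\<in>S. A x z * matrix_power S A n z y) \<le> 0"
        by (intro sum_nonpos) (meson not_less)
      with pos show False by simp
    qed
  next
    assume "\<exists>z\<in>S. A x z * matrix_power S A n z y > 0"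
    then obtain z where "z \<in> S" "A x z * matrix_power S A n z y > 0" by blast
    then show "matrix_power S A (Suc n) x y > 0"
      using nn sum_pos2[of S z "\<lambda>z. A x z * matrix_power S A n z y"] by simp
  qed
  also have "\<dots> \<longleftrightarrow> (\<exists>z\<in>S. A x z > 0 \<and> matrix_power S A n z y > 0)"
  proof (rule bex_cong[OF refl])
    fix z
    show "A x z * matrix_power S A n z y > 0 \<longleftrightarrow> A x z > 0 \<and> matrix_power S A n z y > 0"
      using assms matrix_power_nonneg[OF assms, of S n z y] by (simp add: zero_less_mult_iff)
  qed
  also have "\<dots> \<longleftrightarrow> (\<exists>zs. length zs = Suc n \<and> set zs \<subseteq> S \<and> steps (\<lambda>x y. A x y > 0) x zs \<and> last (x # zs) = y)"
    (is "_ \<longleftrightarrow> ?R")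
  proof
    assume "\<exists>z\<in>S. A x z > 0 \<and> matrix_power S A n z y > 0"
    then obtain z zs where "z \<in> S" "A x z > 0" "length zs = n \<and> set zs \<subseteq> S \<and> steps (\<lambda>x y. A x y > 0) z zs \<and> last (z # zs) = y"
      unfolding Suc.IH by blast
    then show ?R by (intro exI[of _ "z # zs"]) auto
  next
    assume ?R
    then obtain ws where ws: "length ws = Suc n" "set ws \<subseteq> S" "steps (\<lambda>x y. A x y > 0) x ws" "last (x # ws) = y"
      by blast
    then obtain z zs where "ws = z # zs" by (cases ws) auto
    with ws show "\<exists>z\<in>S. A x z > 0 \<and> matrix_power S A n z y > 0"
      unfolding Suc.IH by (intro bexI[of _ z] conjI exI[of _ zs]) auto
  qed
  finally show ?case .
qed simp

section \<open>The Perron--Frobenius eigenvalue\<close>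

lemma irreducible_on_path:
  fixes A :: "'s::finite \<Rightarrow> 's \<Rightarrow> real"
  assumes "irreducible_on C A" "\<forall>x y. 0 \<le> A x y" "x \<in> C" "y \<in> C"
  obtains zs where "zs \<noteq> []" "set zs \<subseteq> C" "steps (\<lambda>x y. A x y > 0) x zs" "last zs = y"
proof -
  obtain n where "n \<ge> 1" "matrix_power C A n x y > 0"
    using assms unfolding irreducible_on_def by blast
  then obtain zs where zs: "length zs = n" "set zs \<subseteq> C" "steps (\<lambda>x y. A x y > 0) x zs" "last (x # zs) = y"
    unfolding matrix_power_pos_iff[OF assms(2)] by blast
  have "zs \<noteq> []" using zs(1) \<open>n \<ge> 1\<close> by auto
  with zs(4) have "last zs = y" by simp
  show ?thesis by (rule that) fact+
qed

lemma steps_append: "steps R x (ys @ zs) \<longleftrightarrow> steps R x ys \<and> steps R (last (x # ys)) zs"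
  by (induction ys arbitrary: x) auto

lemma steps_mono: "steps R x ys \<Longrightarrow> (\<And>x y. R x y \<Longrightarrow> R' x y) \<Longrightarrow> steps R' x ys"
  by (induction ys arbitrary: x) auto

lemma irreducible_onI:
  fixes A :: "'s::finite \<Rightarrow> 's \<Rightarrow> real"
  assumes "\<forall>x y. 0 \<le> A x y"
    and "\<And>x y. x \<in> C \<Longrightarrow> y \<in> C \<Longrightarrow>
      \<exists>zs. zs \<noteq> [] \<and> set zs \<subseteq> C \<and> steps (\<lambda>x y. A x y > 0) x zs \<and> last zs = y"
  shows "irreducible_on C A"
  unfolding irreducible_on_def
proof (intro ballI)
  fix x y assume "x \<in> C" "y \<in> C"
  then obtain zs where "zs \<noteq> []" "set zs \<subseteq> C" "steps (\<lambda>x y. A x y > 0) x zs" "last zs = y"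
    using assms(2) by blast
  then show "\<exists>n\<ge>1. matrix_power C A n x y > 0"
    using matrix_power_pos_iff[OF assms(1), of C "length zs" x y]
    by (intro exI[of _ "length zs"]) (auto simp: Suc_le_eq)
qed

lemma irreducible_on_same_support:
  fixes A :: "'s::finite \<Rightarrow> 's \<Rightarrow> real"
  assumes "irreducible_on C A" "\<forall>x y. 0 \<le> A x y" "\<forall>x y. 0 \<le> B x y"
    and "\<forall>x y. A x y > 0 \<longleftrightarrow> B x y > 0"
  shows "irreducible_on C B"
proof (rule irreducible_onI[OF assms(3)])
  fix x y assume "x \<in> C" "y \<in> C"
  then obtain zs where zs: "zs \<noteq> []" "set zs \<subseteq> C" "steps (\<lambda>x y. A x y > 0) x zs" "last zs = y"
    by (rule irreducible_on_path[OF assms(1,2)])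
  have "steps (\<lambda>x y. B x y > 0) x zs"
    by (rule steps_mono[OF zs(3)]) (simp only: assms(4))
  with zs show "\<exists>zs. zs \<noteq> [] \<and> set zs \<subseteq> C \<and> steps (\<lambda>x y. B x y > 0) x zs \<and> last zs = y"
    by blast
qed

text \<open>Brouwer's theorem for the normalised map \<open>F\<close> on the simplex of probability
  vectors carried by \<open>C\<close>; the normaliser \<open>N\<close> at the fixed point is the
  eigenvalue. Irreducibility enters twice: it makes \<open>N\<close> positive on the simplex, and it
  spreads positivity from one component of the fixed point to all.\<close>

lemma PF_eigenvector_exists:
  fixes A :: "'s::finite \<Rightarrow> 's \<Rightarrow> real"
  assumes irr: "irreducible_on C A" and nn: "\<forall>x y. 0 \<le> A x y" and ne: "C \<noteq> {}"
  obtains r u where "r > 0" "\<And>x. x \<in> C \<Longrightarrow> u x > 0"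
    "\<And>x. x \<in> C \<Longrightarrow> (\<Sum>y\<in>C. A x y * u y) = r * u x"
proof -
  define \<Delta> where "\<Delta> = {v :: real^'s. (\<forall>x. 0 \<le> v $ x) \<and> (\<forall>x. x \<notin> C \<longrightarrow> v $ x = 0) \<and> (\<Sum>x\<in>UNIV. v $ x) = 1}"
  define T where "T v x = (if x \<in> C then \<Sum>y\<in>C. A x y * v $ y else 0)" for v :: "real^'s" and x
  define N where "N v = (\<Sum>x\<in>UNIV. T v x)" for v
  define F where "F v = (\<chi> x. T v x / N v)" for v
  have Tnn: "0 \<le> T v x" if "v \<in> \<Delta>" for v x
    using that nn by (auto simp: T_def \<Delta>_def intro!: sum_nonneg mult_nonneg_nonneg)
  have ex_pos: "\<exists>y. v $ y > 0" if "v \<in> \<Delta>" for v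
  proof (rule ccontr)
    assume "\<not> (\<exists>y. v $ y > 0)"
    then have "(\<Sum>x\<in>UNIV. v $ x) \<le> 0" by (auto intro!: sum_nonpos simp: not_less)
    then show False using that by (simp add: \<Delta>_def)
  qed
  have Npos: "N v > 0" if v: "v \<in> \<Delta>" for v
  proof -
    have "\<exists>y. v $ y > 0" by (rule ex_pos[OF v])
    then obtain y where y: "v $ y > 0" by blast
    then have "y \<in> C" using v by (force simp: \<Delta>_def)
    \<comment> \<open>Column \<open>y\<close> has a positive entry: take the last step of a path
      that leads from \<open>y\<close> back to \<open>y\<close>.\<close>
    have "\<exists>x\<in>C. A x y > 0"
    proof -
      obtain zs where zs: "zs \<noteq> []" "set zs \<subseteq> C" "steps (\<lambda>x y. A x y > 0) y zs" "last zs = y"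
        using irreducible_on_path[OF irr nn \<open>y \<in> C\<close> \<open>y \<in> C\<close>] by blast
      then obtain ws where "zs = ws @ [y]" by (metis append_butlast_last_id)
      with zs have "A (last (y # ws)) y > 0" "set ws \<subseteq> C" by (auto simp: steps_append)
      moreover have "last (y # ws) \<in> C"
        using \<open>set ws \<subseteq> C\<close> \<open>y \<in> C\<close> last_in_set[of "y # ws"] by auto
      ultimately show ?thesis by blast
    qed
    then obtain x where x: "x \<in> C" "A x y > 0" by blast
    have "0 < A x y * v $ y" using x y by simp
    also have "\<dots> \<le> T v x"
      using x \<open>y \<in> C\<close> v nn unfolding T_def
      by (auto simp: \<Delta>_def intro!: member_le_sum[of y C "\<lambda>y. A x y * v $ y"])
    finally have "0 < T v x" .
    then show ?thesis
      unfolding N_def using Tnn[OF v] by (intro sum_pos2[of _ x]) auto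
  qed
  have bdd: "bounded \<Delta>"
  proof (rule boundedI)
    fix v assume v: "v \<in> \<Delta>"
    have "norm v \<le> (\<Sum>i\<in>UNIV. \<bar>v $ i\<bar>)" by (rule norm_le_l1_cart)
    also have "\<dots> = 1" using v by (simp add: \<Delta>_def)
    finally show "norm v \<le> 1" .
  qed
  have clo: "closed \<Delta>"
    unfolding \<Delta>_def
    by (intro closed_Collect_conj closed_Collect_all closed_Collect_imp closed_Collect_le closed_Collect_eq)
       (auto intro!: continuous_intros)
  have conv: "convex \<Delta>"
    unfolding convex_def \<Delta>_def
    by (auto simp: sum.distrib sum_distrib_left[symmetric])
  have "\<Delta> \<noteq> {}"
  proof -
    obtain c where "c \<in> C" using ne by blast
    then have "axis c 1 \<in> \<Delta>" by (auto simp: \<Delta>_def axis_def)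
    then show ?thesis by blast
  qed
  have cT: "continuous_on \<Delta> (\<lambda>v. T v x)" for x
    by (cases "x \<in> C") (auto simp: T_def intro!: continuous_intros)
  have cont: "continuous_on \<Delta> F"
    unfolding F_def
  proof (intro continuous_on_vec_lambda continuous_on_divide cT ballI)
    show "continuous_on \<Delta> N" unfolding N_def by (intro continuous_on_sum cT)
    show "N v \<noteq> 0" if "v \<in> \<Delta>" for v using Npos[OF that] by simp
  qed
  have im: "F \<in> \<Delta> \<rightarrow> \<Delta>"
  proof
    fix v assume v: "v \<in> \<Delta>"
    have "(\<Sum>x\<in>UNIV. T v x / N v) = 1"
      using Npos[OF v] by (simp add: sum_divide_distrib[symmetric] N_def[symmetric])
    then show "F v \<in> \<Delta>"
      using Npos[OF v] Tnn[OF v] by (auto simp: F_def \<Delta>_def T_def)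
  qed
  obtain v where v: "v \<in> \<Delta>" and "F v = v"
    using brouwer[of \<Delta> F] bdd clo conv \<open>\<Delta> \<noteq> {}\<close> cont im by (metis compact_eq_bounded_closed)
  then have eig: "T v x = N v * v $ x" for x
    using Npos[OF v] by (auto simp: F_def vec_eq_iff field_simps)
  have vnn: "0 \<le> v $ x" for x using v by (simp add: \<Delta>_def)
  have "\<exists>y. v $ y > 0" by (rule ex_pos[OF v])
  then obtain y where y: "v $ y > 0" by blast
  then have yC: "y \<in> C" using v by (force simp: \<Delta>_def)
  \<comment> \<open>Positivity travels backwards along a path: a step from \<open>x\<close> to
    \<open>z\<close> gives the image of \<open>v\<close> at least \<open>A x z * v $ z\<close> in
    component \<open>x\<close>.\<close>
  have path: "v $ x > 0" if "steps (\<lambda>x y. A x y > 0) x zs" "set zs \<subseteq> C" "x \<in> C" "last (x # zs) = y" for x zs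
    using that
  proof (induction zs arbitrary: x)
    case Nil then show ?case using y by simp
  next
    case (Cons z zs)
    then have "v $ z > 0" by simp
    with Cons.prems have "0 < A x z * v $ z" by simp
    also have "\<dots> \<le> T v x"
      using Cons.prems vnn nn unfolding T_def
      by (auto intro!: member_le_sum[of z C "\<lambda>y. A x y * v $ y"])
    finally show ?case using eig[of x] Npos[OF v] by (simp add: zero_less_mult_iff)
  qed
  show ?thesis
  proof (rule that[of "N v" "\<lambda>x. v $ x"])
    show "N v > 0" using Npos[OF v] .
    show "v $ x > 0" if x: "x \<in> C" for x
    proof -
      obtain zs where "zs \<noteq> []" "set zs \<subseteq> C" "steps (\<lambda>x y. A x y > 0) x zs" "last zs = y"
        using irreducible_on_path[OF irr nn x yC] by blast
      then show ?thesis using path[of x zs] x by auto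
    qed
    show "(\<Sum>y\<in>C. A x y * v $ y) = N v * v $ x" if "x \<in> C" for x
      using eig[of x] that by (simp add: T_def)
  qed
qed

text \<open>The positive vector \<open>u\<close> serves as a measuring rod: for an eigenvector
  \<open>w\<close> of \<open>z\<close>, the least \<open>c\<close> with
  \<open>cmod (w x) \<le> c * u x\<close> on \<open>C\<close> is attained at some state, and there
  the eigenvalue equation of \<open>w\<close> is compared with that of \<open>u\<close>.\<close>

lemma PF_eigenvalue_eqI:
  fixes A :: "'s::finite \<Rightarrow> 's \<Rightarrow> real"
  assumes nn: "\<forall>x y. 0 \<le> A x y" and ne: "C \<noteq> {}" and r: "r > 0" and u: "\<And>x. x \<in> C \<Longrightarrow> u x > 0"
    and eig: "\<And>x. x \<in> C \<Longrightarrow> (\<Sum>y\<in>C. A x y * u y) = r * u x"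
  shows "PF_eigenvalue C A = r"
proof -
  have ev: "eigenvalue_on C A (complex_of_real r)"
    unfolding eigenvalue_on_def
  proof (intro exI[of _ "\<lambda>x. complex_of_real (u x)"] conjI ballI)
    show "\<exists>x\<in>C. complex_of_real (u x) \<noteq> 0" using ne u by fastforce
    show "(\<Sum>y\<in>C. complex_of_real (A x y) * complex_of_real (u y)) = complex_of_real r * complex_of_real (u x)"
      if "x \<in> C" for x
      using eig[OF that] by (metis (no_types, lifting) of_real_mult of_real_sum sum.cong)
  qed
  have dom: "cmod z \<le> r" if z: "eigenvalue_on C A z" for z
  proof -
    obtain w where w: "\<exists>x\<in>C. w x \<noteq> 0" "\<forall>x\<in>C. (\<Sum>y\<in>C. complex_of_real (A x y) * w y) = z * w x"
      using z unfolding eigenvalue_on_def by blast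
    define c where "c = Max ((\<lambda>x. cmod (w x) / u x) ` C)"
    have fin: "finite C" by simp
    have cge: "cmod (w x) \<le> c * u x" if "x \<in> C" for x
    proof -
      have "cmod (w x) / u x \<le> c" unfolding c_def using that fin by (intro Max_ge) auto
      then show ?thesis using u[OF that] by (simp add: field_simps)
    qed
    have "c \<in> (\<lambda>x. cmod (w x) / u x) ` C" unfolding c_def using ne fin by (intro Max_in) auto
    then obtain x where x: "x \<in> C" "c = cmod (w x) / u x" by blast
    have cpos: "c > 0"
    proof -
      obtain y where y: "y \<in> C" "w y \<noteq> 0" using w by blast
      then have "0 < c * u y" using cge[of y] by (metis less_le_trans zero_less_norm_iff)
      then show ?thesis using u[OF y(1)] by (simp add: zero_less_mult_iff)
    qed
    have "cmod z * (c * u x) = cmod (z * w x)" using x u[of x] by (simp add: norm_mult)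
    also have "\<dots> = cmod (\<Sum>y\<in>C. complex_of_real (A x y) * w y)" using w x by simp
    also have "\<dots> \<le> (\<Sum>y\<in>C. A x y * cmod (w y))"
      by (rule order_trans[OF norm_sum]) (simp add: norm_mult nn)
    also have "\<dots> \<le> (\<Sum>y\<in>C. A x y * (c * u y))"
      using cge nn by (intro sum_mono mult_left_mono) auto
    also have "\<dots> = c * (\<Sum>y\<in>C. A x y * u y)" by (simp add: sum_distrib_left mult_ac)
    also have "\<dots> = r * (c * u x)" using eig[OF x(1)] by simp
    finally show ?thesis using cpos u[OF x(1)] by simp
  qed
  show ?thesis
    unfolding PF_eigenvalue_def
  proof (rule the_equality)
    show "eigenvalue_on C A (complex_of_real r) \<and> (\<forall>z. eigenvalue_on C A z \<longrightarrow> cmod z \<le> r)"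
      using ev dom by blast
    fix r' assume r': "eigenvalue_on C A (complex_of_real r') \<and> (\<forall>z. eigenvalue_on C A z \<longrightarrow> cmod z \<le> r')"
    then have "cmod (complex_of_real r) \<le> r'" "cmod (complex_of_real r') \<le> r" using ev dom by blast+
    then show "r' = r" using r by auto
  qed
qed

lemma PF_eigenvector:
  fixes A :: "'s::finite \<Rightarrow> 's \<Rightarrow> real"
  assumes "irreducible_on C A" "\<forall>x y. 0 \<le> A x y" "C \<noteq> {}"
  obtains u where "PF_eigenvalue C A > 0" "\<And>x. x \<in> C \<Longrightarrow> u x > 0"
    "\<And>x. x \<in> C \<Longrightarrow> (\<Sum>y\<in>C. A x y * u y) = PF_eigenvalue C A * u x"
proof (rule PF_eigenvector_exists[OF assms])
  fix r u assume ru: "r > 0" "\<And>x. x \<in> C \<Longrightarrow> u x > 0"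
    "\<And>x. x \<in> C \<Longrightarrow> (\<Sum>y\<in>C. A x y * u y) = r * u x"
  then have "PF_eigenvalue C A = r" by (intro PF_eigenvalue_eqI[OF assms(2,3)])
  with ru show thesis by (intro that[of u]) auto
qed

section \<open>Exponential rates\<close>

text \<open>Covers \<open>a n \<le> 0\<close>, where the rate is minus infinity, so that exponential
  inequalities can replace logarithms of quantities that may vanish. At \<open>n = 0\<close> it
  would fail in general, as \<open>1 / 0 = 0\<close> makes the rate 0.\<close>

lemma log_rate_le_iff:
  assumes "n \<ge> 1"
  shows "log_rate a n \<le> ereal b \<longleftrightarrow> a n \<le> exp (real n * b)"
proof (cases "a n \<le> 0")
  case True
  then have "log_rate a n = -\<infinity>" using assms by (simp add: log_rate_def elog_def)
  moreover have "a n \<le> exp (real n * b)" using True exp_gt_zero[of "real n * b"] by linarith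
  ultimately show ?thesis by simp
next
  case False
  then have "log_rate a n = ereal (ln (a n) / real n)" by (simp add: log_rate_def elog_def)
  moreover have "ln (a n) / real n \<le> b \<longleftrightarrow> ln (a n) \<le> real n * b"
    using assms by (simp add: field_simps)
  moreover have "ln (a n) \<le> real n * b \<longleftrightarrow> a n \<le> exp (real n * b)"
    using False by (metis exp_le_cancel_iff exp_ln not_le)
  ultimately show ?thesis by simp
qed

lemma log_rate_ge_iff:
  assumes "n \<ge> 1"
  shows "ereal b \<le> log_rate a n \<longleftrightarrow> exp (real n * b) \<le> a n"
proof (cases "a n \<le> 0")
  case True
  then have "log_rate a n = -\<infinity>" using assms by (simp add: log_rate_def elog_def)
  moreover have "\<not> exp (real n * b) \<le> a n" using True exp_gt_zero[of "real n * b"] by linarith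
  ultimately show ?thesis by simp
next
  case False
  then have "log_rate a n = ereal (ln (a n) / real n)" by (simp add: log_rate_def elog_def)
  moreover have "b \<le> ln (a n) / real n \<longleftrightarrow> real n * b \<le> ln (a n)"
    using assms by (simp add: field_simps)
  moreover have "real n * b \<le> ln (a n) \<longleftrightarrow> exp (real n * b) \<le> a n"
    using False by (metis exp_le_cancel_iff exp_ln not_le)
  ultimately show ?thesis by simp
qed

lemma eventually_le_exp_of_limsup:
  assumes "limsup (log_rate a) < ereal b"
  shows "\<forall>\<^sub>F n in sequentially. a n \<le> exp (real n * b)"
  using Limsup_lessD[OF assms] eventually_ge_at_top[of "1::nat"]
proof eventually_elim
  case (elim n)
  then show ?case using log_rate_le_iff[of n a b] by (simp add: less_imp_le)
qed

lemma eventually_ge_exp_of_liminf: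
  assumes "ereal b < liminf (log_rate a)"
  shows "\<forall>\<^sub>F n in sequentially. exp (real n * b) \<le> a n"
  using less_LiminfD[OF assms] eventually_ge_at_top[of "1::nat"]
proof eventually_elim
  case (elim n)
  then show ?case using log_rate_ge_iff[of n b a] by (simp add: less_imp_le)
qed

lemma limsup_log_rate_nonpos:
  assumes "\<And>n. n \<ge> 1 \<Longrightarrow> a n \<le> 1"
  shows "limsup (log_rate a) \<le> 0"
proof (rule Limsup_bounded)
  show "\<forall>\<^sub>F n in sequentially. log_rate a n \<le> 0"
    using eventually_ge_at_top[of "1::nat"]
  proof eventually_elim
    case (elim n)
    then show ?case using log_rate_le_iff[of n a 0] assms by (simp add: zero_ereal_def)
  qed
qed

lemma exp_mult_tendsto_0: "c < 0 \<Longrightarrow> (\<lambda>n. exp (real n * c)) \<longlonglongrightarrow> 0"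
  unfolding exp_of_nat_mult by (rule LIMSEQ_realpow_zero) auto

lemma log_rate_mono:
  assumes "a n \<le> b n"
  shows "log_rate a n \<le> log_rate b n"
proof -
  have "elog (a n) \<le> elog (b n)" using assms by (auto simp: elog_def)
  then show ?thesis unfolding log_rate_def by (intro ereal_mult_left_mono) auto
qed

section \<open>Communicating classes\<close>

lemma reachable_iff:
  fixes p :: "'s::finite \<Rightarrow> 's \<Rightarrow> real"
  assumes "\<forall>x y. 0 \<le> p x y"
  shows "reachable p x y \<longleftrightarrow> (\<exists>zs. zs \<noteq> [] \<and> steps (\<lambda>x y. p x y > 0) x zs \<and> last zs = y)"
proof
  assume "reachable p x y"
  then obtain n where n: "n \<ge> 1" "matrix_power UNIV p n x y > 0" unfolding reachable_def by blast
  from n(2) obtain zs where zs: "length zs = n" "steps (\<lambda>x y. p x y > 0) x zs" "last (x # zs) = y"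
    unfolding matrix_power_pos_iff[OF assms] by blast
  have "zs \<noteq> []" using zs(1) n by auto
  with zs show "\<exists>zs. zs \<noteq> [] \<and> steps (\<lambda>x y. p x y > 0) x zs \<and> last zs = y"
    by (intro exI[of _ zs]) simp
next
  assume "\<exists>zs. zs \<noteq> [] \<and> steps (\<lambda>x y. p x y > 0) x zs \<and> last zs = y"
  then obtain zs where zs: "zs \<noteq> []" "steps (\<lambda>x y. p x y > 0) x zs" "last zs = y" by blast
  have "matrix_power UNIV p (length zs) x y > 0"
    unfolding matrix_power_pos_iff[OF assms]
    using zs by (intro exI[of _ zs]) simp
  moreover have "length zs \<ge> 1" using zs(1) by (cases zs) auto
  ultimately show "reachable p x y" unfolding reachable_def by blast
qed

lemma reachable_trans:
  fixes p :: "'s::finite \<Rightarrow> 's \<Rightarrow> real"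
  assumes "\<forall>x y. 0 \<le> p x y" "reachable p x y" "reachable p y z"
  shows "reachable p x z"
proof -
  obtain us where us: "us \<noteq> []" "steps (\<lambda>x y. p x y > 0) x us" "last us = y"
    using assms(2) reachable_iff[OF assms(1)] by auto
  obtain vs where vs: "vs \<noteq> []" "steps (\<lambda>x y. p x y > 0) y vs" "last vs = z"
    using assms(3) reachable_iff[OF assms(1)] by auto
  have "steps (\<lambda>x y. p x y > 0) x (us @ vs)" using us vs by (simp add: steps_append)
  then show ?thesis
    unfolding reachable_iff[OF assms(1)] using us vs by (intro exI[of _ "us @ vs"]) simp
qed

lemma equiv_communicating:
  fixes p :: "'s::finite \<Rightarrow> 's \<Rightarrow> real"
  assumes "\<forall>x y. 0 \<le> p x y"
  shows "equiv UNIV (communicating p)"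
proof (rule equivI)
  show "refl (communicating p)" by (auto simp: communicating_def refl_on_def)
  show "sym (communicating p)" by (auto simp: communicating_def sym_def)
  show "trans (communicating p)"
    unfolding trans_def communicating_def using reachable_trans[OF assms] by blast
qed auto

locale converging_chain =
  fixes P :: "nat \<Rightarrow> 's::finite \<Rightarrow> 's \<Rightarrow> real" and p :: "'s \<Rightarrow> 's \<Rightarrow> real"
    and C :: "nat \<Rightarrow> 's set" and K :: nat
  assumes stochastic_P: "n \<ge> 1 \<Longrightarrow> stochastic (P n)"
    and stochastic_p: "stochastic p"
    and convergence: "(\<lambda>n. P n x y) \<longlonglongrightarrow> p x y"
    and classes: "class_numbering p K C"
begin

lemma P_nonneg: "n \<ge> 1 \<Longrightarrow> 0 \<le> P n x y"
  using stochastic_P by (auto simp: stochastic_def)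

lemma P_le_1: "n \<ge> 1 \<Longrightarrow> P n x y \<le> 1"
  using stochastic_P[of n] member_le_sum[of y UNIV "P n x"] by (auto simp: stochastic_def)

lemma p_nonneg: "0 \<le> p x y"
  using stochastic_p by (auto simp: stochastic_def)

lemma p_nonneg_all: "\<forall>x y. 0 \<le> p x y"
  using p_nonneg by blast

lemma p_le_1: "p x y \<le> 1"
  using stochastic_p member_le_sum[of y UNIV "p x"] by (auto simp: stochastic_def)

definition cls :: "'s \<Rightarrow> nat" where
  "cls x = (THE i. i \<in> {1..K} \<and> x \<in> C i)"

lemma class_bij: "bij_betw C {1..K} (UNIV // communicating p)"
  using classes unfolding class_numbering_def by (rule conjunct1)

lemma class_in_quotient: "i \<in> {1..K} \<Longrightarrow> C i \<in> UNIV // communicating p"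
  using class_bij by (rule bij_betw_apply)

lemma class_unique:
  assumes "i \<in> {1..K}" "j \<in> {1..K}" "x \<in> C i" "x \<in> C j"
  shows "i = j"
proof -
  have "C i = C j"
    using quotient_disj[OF equiv_communicating[OF p_nonneg_all] class_in_quotient[OF assms(1)]
        class_in_quotient[OF assms(2)]] assms(3,4) by blast
  then show ?thesis using inj_onD[OF bij_betw_imp_inj_on[OF class_bij] _ assms(1,2)] by simp
qed

lemma cls: "cls x \<in> {1..K}" "x \<in> C (cls x)"
proof -
  have "communicating p `` {x} \<in> UNIV // communicating p" by (auto intro: quotientI)
  then obtain i where i: "i \<in> {1..K}" "C i = communicating p `` {x}"
    using class_bij by (metis bij_betw_def imageE)
  have "x \<in> C i" using i equiv_class_self[OF equiv_communicating[OF p_nonneg_all]] by auto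
  then have "\<exists>!i. i \<in> {1..K} \<and> x \<in> C i" using i class_unique by blast
  then have "cls x \<in> {1..K} \<and> x \<in> C (cls x)" unfolding cls_def by (rule theI')
  then show "cls x \<in> {1..K}" "x \<in> C (cls x)" by auto
qed

lemma cls_eq: "i \<in> {1..K} \<Longrightarrow> x \<in> C i \<Longrightarrow> cls x = i"
  using class_unique cls by blast

lemma class_nonempty: "i \<in> {1..K} \<Longrightarrow> C i \<noteq> {}"
  by (rule in_quotient_imp_non_empty[OF equiv_communicating[OF p_nonneg_all] class_in_quotient])

lemma cls_mono: "p x y > 0 \<Longrightarrow> cls x \<le> cls y"
  using classes cls[of x] cls[of y] unfolding class_numbering_def
  by (metis less_irrefl not_le)

lemma same_class_communicating:
  assumes "i \<in> {1..K}" "x \<in> C i" "y \<in> C i"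
  shows "(x, y) \<in> communicating p"
proof -
  show ?thesis
    using quotient_eq_iff[OF equiv_communicating[OF p_nonneg_all] class_in_quotient[OF assms(1)]
        class_in_quotient[OF assms(1)] assms(2,3)] by simp
qed

text \<open>The class index does not decrease along positive steps, and it takes the same value at
  both ends.\<close>

lemma path_stays_in_class:
  assumes "i \<in> {1..K}" "x \<in> C i" "last zs \<in> C i" "steps (\<lambda>x y. p x y > 0) x zs" "zs \<noteq> []"
  shows "set zs \<subseteq> C i"
proof -
  have mono: "cls x \<le> cls z \<and> cls z \<le> cls (last (x # zs))"
    if "steps (\<lambda>x y. p x y > 0) x zs" "z \<in> set (x # zs)" for x z zs
    using that
  proof (induction zs arbitrary: x z)
    case (Cons w ws)
    have IH: "cls w \<le> cls v \<and> cls v \<le> cls (last (w # ws))" if "v \<in> set (w # ws)" for v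
      using Cons.IH[of w v] Cons.prems(1) that by simp
    have "cls x \<le> cls w" using Cons.prems(1) cls_mono by simp
    moreover have "cls w \<le> cls (last (w # ws))" using IH[of w] by simp
    moreover have "z = x \<or> z \<in> set (w # ws)" using Cons.prems(2) by simp
    ultimately show ?case using IH[of z] by auto
  qed simp
  show ?thesis
  proof
    fix z assume "z \<in> set zs"
    then have "cls x \<le> cls z" "cls z \<le> cls (last zs)" using mono[OF assms(4), of z] assms(5) by auto
    moreover have "cls x = i" "cls (last zs) = i" using assms cls_eq by auto
    ultimately have "cls z = i" by simp
    then show "z \<in> C i" using cls(2)[of z] by simp
  qed
qed

text \<open>A positive entry inside the class can be inserted between any two states: go to
  \<open>x\<close>, step to \<open>y\<close>, go on. The detour makes the path nonempty even from a
  state to itself, which settles classes with one state.\<close>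

lemma irreducible_or_zero:
  assumes i: "i \<in> {1..K}" and xy: "x \<in> C i" "y \<in> C i" "p x y > 0"
  shows "irreducible_on (C i) p"
proof (rule irreducible_onI[OF p_nonneg_all])
  fix u v assume uv: "u \<in> C i" "v \<in> C i"
  have path: "\<exists>zs. steps (\<lambda>x y. p x y > 0) a zs \<and> last (a # zs) = b" if "a \<in> C i" "b \<in> C i" for a b
  proof (cases "a = b")
    case True then show ?thesis by (intro exI[of _ "[]"]) simp
  next
    case False
    then have "reachable p a b" using same_class_communicating[OF i that] by (simp add: communicating_def)
    then obtain zs where "zs \<noteq> []" "steps (\<lambda>x y. p x y > 0) a zs" "last zs = b"
      unfolding reachable_iff[OF p_nonneg_all] by blast
    then show ?thesis by (intro exI[of _ zs]) simp
  qed
  obtain us where us: "steps (\<lambda>x y. p x y > 0) u us" "last (u # us) = x" using path[OF uv(1) xy(1)] by blast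
  obtain vs where vs: "steps (\<lambda>x y. p x y > 0) y vs" "last (y # vs) = v" using path[OF xy(2) uv(2)] by blast
  define zs where "zs = us @ y # vs"
  have zs: "zs \<noteq> []" "steps (\<lambda>x y. p x y > 0) u zs" "last zs = v"
    using us vs xy by (simp_all add: zs_def steps_append)
  moreover have "set zs \<subseteq> C i" using path_stays_in_class[OF i uv(1) _ zs(2,1)] zs(3) uv by simp
  ultimately show "\<exists>zs. zs \<noteq> [] \<and> set zs \<subseteq> C i \<and> steps (\<lambda>x y. p x y > 0) u zs \<and> last zs = v" by blast
qed

text \<open>Two different states of a class are joined by a path that stays inside it, and its first
  step would be a positive entry; so a class without positive entries is a single state.\<close>

lemma degenerate_class:
  assumes "i \<in> {1..K}" "i \<notin> irreducible_indices p K C" "x \<in> C i"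
  shows "C i = {x}" and "y \<in> C i \<Longrightarrow> p x y = 0"
proof -
  have z: "p a b = 0" if "a \<in> C i" "b \<in> C i" for a b
  proof -
    have "\<not> p a b > 0"
    proof
      assume "p a b > 0"
      then have "irreducible_on (C i) p" by (rule irreducible_or_zero[OF assms(1) that])
      with assms(1,2) show False unfolding irreducible_indices_def by blast
    qed
    then show ?thesis using p_nonneg[of a b] by linarith
  qed
  show "y \<in> C i \<Longrightarrow> p x y = 0" using z[of x y] assms(3) by simp
  have "b = x" if b: "b \<in> C i" for b
  proof (rule ccontr)
    assume "b \<noteq> x"
    then have "reachable p x b" using same_class_communicating[OF assms(1,3) b] by (simp add: communicating_def)
    then obtain zs where zs: "zs \<noteq> []" "steps (\<lambda>x y. p x y > 0) x zs" "last zs = b"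
      unfolding reachable_iff[OF p_nonneg_all] by blast
    then have "set zs \<subseteq> C i" using path_stays_in_class[OF assms(1,3) _ zs(2,1)] b by simp
    moreover obtain w ws where "zs = w # ws" using zs(1) by (cases zs) auto
    ultimately show False using zs(2) z[of x w] assms(3) by simp
  qed
  then show "C i = {x}" using assms(3) by blast
qed

section \<open>The upper estimate\<close>

abbreviation ups :: "nat \<Rightarrow> nat \<Rightarrow> ereal" where "ups \<equiv> upper_cost P C"

lemma finite_transitions: "finite {P n x y | x y. x \<in> C i \<and> y \<in> C j}"
proof -
  have "{P n x y | x y. x \<in> C i \<and> y \<in> C j} = (\<lambda>(x, y). P n x y) ` (C i \<times> C j)" by auto
  then show ?thesis by simp
qed

lemma P_le_max_transition:
  "x \<in> C i \<Longrightarrow> y \<in> C j \<Longrightarrow> P n x y \<le> max_transition P C i j n"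
  unfolding max_transition_def by (rule Max_ge[OF finite_transitions]) blast

lemma max_transition_attained:
  assumes "i \<in> {1..K}" "j \<in> {1..K}"
  obtains x y where "x \<in> C i" "y \<in> C j" "max_transition P C i j n = P n x y"
proof -
  obtain a b where "a \<in> C i" "b \<in> C j" using class_nonempty assms by (metis ex_in_conv)
  then have "{P n x y | x y. x \<in> C i \<and> y \<in> C j} \<noteq> {}" by blast
  then have "max_transition P C i j n \<in> {P n x y | x y. x \<in> C i \<and> y \<in> C j}"
    unfolding max_transition_def by (rule Max_in[OF finite_transitions])
  then show ?thesis using that by blast
qed

lemma ups_nonpos:
  assumes "i \<in> {1..K}" "j \<in> {1..K}"
  shows "ups i j \<le> 0"
  unfolding upper_cost_def
proof (rule limsup_log_rate_nonpos)
  fix n :: nat assume "n \<ge> 1"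
  then show "max_transition P C i j n \<le> 1"
    using max_transition_attained[OF assms, of n] P_le_1 by metis
qed

text \<open>The condition says that at time \<open>n \<ge> S\<close> a transition of cost \<open>exp (n * ups i j)\<close> from \<open>C i\<close> to \<open>C j\<close> does not
  let \<open>exp (S * d)\<close> grow.\<close>

definition potential :: "(nat \<Rightarrow> real) \<Rightarrow> bool" where
  "potential d \<longleftrightarrow> (\<forall>i\<in>{1..K}. \<forall>j\<in>{1..K}. i \<noteq> j \<longrightarrow>
     (ups i j = 0 \<longrightarrow> d j \<le> d i) \<and> (ups i j < 0 \<longrightarrow> ups i j < ereal (d i - d j)))"

lemma potentialD:
  assumes "potential d" "cls x \<noteq> cls y"
  shows "ups (cls x) (cls y) = 0 \<Longrightarrow> d (cls y) \<le> d (cls x)"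
    and "ups (cls x) (cls y) < 0 \<Longrightarrow> ups (cls x) (cls y) < ereal (d (cls x) - d (cls y))"
  using assms(1)[unfolded potential_def, rule_format, OF cls(1) cls(1) assms(2)] by auto

text \<open>A positive supersolution for the tilted limit matrix, class by class: on each class the
  tilted matrix has spectral radius at most 1. Transitions between classes are left to the Lyapunov
  function below.\<close>

definition admissible_tilt :: "('s \<Rightarrow> real) \<Rightarrow> bool" where
  "admissible_tilt g \<longleftrightarrow> (\<exists>u. (\<forall>x. u x > 0) \<and>
     (\<forall>x. (\<Sum>y\<in>C (cls x). p x y * exp (g y) * u y) \<le> u x))"

text \<open>The Lyapunov function is the class eigenvector, discounted by \<open>\<theta> ^ cls x\<close>: since \<open>p\<close> only leads
  to classes of larger index, this makes the transitions between classes negligible.\<close>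

lemma one_step_bound:
  assumes d: "potential d" and g: "admissible_tilt g" and eps: "eps > 0"
  obtains h C1 m0 where "\<And>x. h x > 0" "C1 \<ge> 1"
    "\<And>m s x. m \<ge> 1 \<Longrightarrow> 0 \<le> s \<Longrightarrow> s \<le> real m \<Longrightarrow>
       (\<Sum>y\<in>UNIV. P m x y * exp (g y) * (h y * exp (s * d (cls y))))
         \<le> (if m \<ge> m0 then exp eps else C1) * (h x * exp (s * d (cls x)))"
proof -
  obtain u where u: "\<And>x. u x > 0" "\<And>x. (\<Sum>y\<in>C (cls x). p x y * exp (g y) * u y) \<le> u x"
    using g unfolding admissible_tilt_def by blast
  \<comment> \<open>Each of at most \<open>CARD('s)\<close> transitions out of the class may
    contribute a share \<open>\<eta>\<close>, together \<open>eps / 2\<close>; the class itself gets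
    the other half.\<close>
  define \<eta> where "\<eta> = eps / (2 * real CARD('s))"
  have \<eta>: "\<eta> > 0" using eps by (simp add: \<eta>_def)
  define B where "B = (\<Sum>x\<in>UNIV. \<Sum>y\<in>UNIV. exp (g y) * u y / u x)"
  have Bge: "exp (g y) * u y / u x \<le> B" for x y
  proof -
    have "exp (g y) * u y / u x \<le> (\<Sum>y\<in>UNIV. exp (g y) * u y / u x)"
      using u by (intro member_le_sum) (auto simp: less_imp_le)
    also have "\<dots> \<le> B"
      unfolding B_def
      using u by (intro member_le_sum[of x UNIV "\<lambda>x. \<Sum>y\<in>UNIV. exp (g y) * u y / u x"])
        (auto intro!: sum_nonneg simp: less_imp_le)
    finally show ?thesis .
  qed
  have Bpos: "B > 0"
    by (rule less_le_trans[OF _ Bge[of undefined undefined]]) (use u[of undefined] in simp)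
  \<comment> \<open>\<open>B\<close> bounds the ratios of tilted weights, so one factor
    \<open>\<theta>\<close> brings every such ratio below \<open>\<eta>\<close>.\<close>
  define \<theta> where "\<theta> = min (1/2) (\<eta> / (2 * B))"
  have \<theta>: "0 < \<theta>" "\<theta> < 1" using \<eta> Bpos by (auto simp: \<theta>_def)
  have "\<theta> * B \<le> \<eta> / 2" using Bpos by (auto simp: \<theta>_def min_def field_simps)
  then have \<theta>B: "\<theta> * B < \<eta>" using \<eta> by simp
  have \<theta>': "\<theta> * (exp (g y) * u y) < \<eta> * u x" for x y
  proof -
    have "\<theta> * (exp (g y) * u y / u x) \<le> \<theta> * B" using Bge \<theta> by (intro mult_left_mono) auto
    then have "\<theta> * (exp (g y) * u y / u x) < \<eta>" using \<theta>B by simp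
    then show ?thesis using u[of x] by (simp add: field_simps)
  qed
  define h where "h x = \<theta> ^ cls x * u x" for x
  have h: "h x > 0" for x using \<theta> u by (simp add: h_def)
  have inclass: "\<forall>\<^sub>F m in sequentially. (\<Sum>y\<in>C (cls x). P m x y * exp (g y) * h y) < (1 + eps / 2) * h x" for x
  proof -
    have "(\<Sum>y\<in>C (cls x). p x y * exp (g y) * h y) = \<theta> ^ cls x * (\<Sum>y\<in>C (cls x). p x y * exp (g y) * u y)"
      unfolding sum_distrib_left
    proof (rule sum.cong[OF refl])
      fix y assume "y \<in> C (cls x)"
      then have "cls y = cls x" using cls cls_eq by blast
      then show "p x y * exp (g y) * h y = \<theta> ^ cls x * (p x y * exp (g y) * u y)" by (simp add: h_def)
    qed
    also have "\<dots> \<le> h x" using u(2)[of x] \<theta> by (simp add: h_def)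
    also have "\<dots> < (1 + eps / 2) * h x" using h[of x] eps by simp
    finally have lt: "(\<Sum>y\<in>C (cls x). p x y * exp (g y) * h y) < (1 + eps / 2) * h x" .
    have lim: "(\<lambda>m. \<Sum>y\<in>C (cls x). P m x y * exp (g y) * h y) \<longlonglongrightarrow> (\<Sum>y\<in>C (cls x). p x y * exp (g y) * h y)"
      by (intro tendsto_sum tendsto_mult convergence tendsto_const)
    show ?thesis by (rule order_tendstoD(2)[OF lim lt])
  qed
  \<comment> \<open>For cost 0 the potential does not rise; the weight is then small either because
    the class index, and with it the power of \<open>\<theta>\<close>, grows, or because the entry
    of \<open>P m\<close> tends to 0. For negative cost the entry decays faster than the potential
    factor can grow.\<close>
  have cross: "\<forall>\<^sub>F m in sequentially. \<forall>s. 0 \<le> s \<longrightarrow> s \<le> real m \<longrightarrow>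
      P m x y * exp (g y) * (h y * exp (s * d (cls y))) \<le> \<eta> * (h x * exp (s * d (cls x)))"
    if xy: "cls x \<noteq> cls y" for x y
  proof (cases "ups (cls x) (cls y) = 0")
    case True
    then have dd: "d (cls y) \<le> d (cls x)" using potentialD(1)[OF d xy] by simp
    have lt: "p x y * exp (g y) * h y < \<eta> * h x"
    proof (cases "p x y > 0")
      case True
      then have "Suc (cls x) \<le> cls y" using cls_mono[OF True] xy by simp
      then have "\<theta> ^ cls y \<le> \<theta> ^ Suc (cls x)" using \<theta> by (intro power_decreasing) auto
      then have "exp (g y) * h y \<le> exp (g y) * (\<theta> ^ Suc (cls x) * u y)"
        unfolding h_def using u(1)[of y] by (intro mult_left_mono mult_right_mono) auto
      also have "\<dots> = \<theta> ^ cls x * (\<theta> * (exp (g y) * u y))" by simp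
      also have "\<dots> < \<theta> ^ cls x * (\<eta> * u x)" using \<theta>' \<theta> by (intro mult_strict_left_mono) auto
      also have "\<dots> = \<eta> * h x" by (simp add: h_def)
      finally have "exp (g y) * h y < \<eta> * h x" .
      moreover have "p x y * (exp (g y) * h y) \<le> 1 * (exp (g y) * h y)"
        using p_le_1 h[of y] by (intro mult_right_mono) auto
      ultimately show ?thesis unfolding mult.assoc by linarith
    next
      case False
      then have "p x y = 0" using p_nonneg[of x y] by simp
      then show ?thesis using \<eta> h by simp
    qed
    have lim: "(\<lambda>m. P m x y * exp (g y) * h y) \<longlonglongrightarrow> p x y * exp (g y) * h y"
      by (intro tendsto_mult convergence tendsto_const)
    have "\<forall>\<^sub>F m in sequentially. P m x y * exp (g y) * h y < \<eta> * h x"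
      by (rule order_tendstoD(2)[OF lim lt])
    then show ?thesis
      using eventually_ge_at_top[of "1::nat"]
    proof eventually_elim
      case (elim m)
      show ?case
      proof (intro allI impI)
        fix s :: real assume s: "0 \<le> s"
        have "(P m x y * exp (g y) * h y) * exp (s * d (cls y)) \<le> (\<eta> * h x) * exp (s * d (cls x))"
        proof (rule mult_mono)
          show "exp (s * d (cls y)) \<le> exp (s * d (cls x))" using s dd by (simp add: mult_left_mono)
        qed (use elim \<eta> h[of x] in auto)
        then show "P m x y * exp (g y) * (h y * exp (s * d (cls y))) \<le> \<eta> * (h x * exp (s * d (cls x)))"
          by (simp add: mult_ac)
      qed
    qed
  next
    case False
    \<comment> \<open>\<open>real m * min 0 \<Delta>\<close> lies below \<open>s * \<Delta>\<close>
      for all \<open>s\<close> between 0 and \<open>m\<close>, so the minimum makes the estimate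
      uniform in \<open>s\<close>; the gap between \<open>b\<close> and the minimum absorbs the
      constants.\<close>
    define \<Delta> where "\<Delta> = d (cls x) - d (cls y)"
    have neg: "ups (cls x) (cls y) < 0" using False ups_nonpos[OF cls(1) cls(1), of x y] by simp
    then have "ups (cls x) (cls y) < ereal \<Delta>"
      unfolding \<Delta>_def by (rule potentialD(2)[OF d xy])
    with neg have "ups (cls x) (cls y) < ereal (min 0 \<Delta>)" by (simp add: zero_ereal_def min_def)
    then obtain b where b: "ups (cls x) (cls y) < ereal b" "ereal b < ereal (min 0 \<Delta>)"
      using ereal_dense2 by blast
    have ev1: "\<forall>\<^sub>F m in sequentially. max_transition P C (cls x) (cls y) m \<le> exp (real m * b)"
      using b(1) unfolding upper_cost_def by (rule eventually_le_exp_of_limsup)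
    have "b - min 0 \<Delta> < 0" using b(2) by simp
    then have "(\<lambda>m. exp (real m * (b - min 0 \<Delta>)) * (exp (g y) * h y)) \<longlonglongrightarrow> 0 * (exp (g y) * h y)"
      by (intro tendsto_mult tendsto_const exp_mult_tendsto_0)
    then have ev2: "\<forall>\<^sub>F m in sequentially. exp (real m * (b - min 0 \<Delta>)) * (exp (g y) * h y) < \<eta> * h x"
      using \<eta> h[of x] by (intro order_tendstoD(2)[of _ "0 * (exp (g y) * h y)"]) auto
    show ?thesis
      using ev1 ev2 eventually_ge_at_top[of "1::nat"]
    proof eventually_elim
      case (elim m)
      show ?case
      proof (intro allI impI)
        fix s :: real assume s: "0 \<le> s" "s \<le> real m"
        have "real m * min 0 \<Delta> \<le> s * \<Delta>"
        proof (cases "\<Delta> \<ge> 0")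
          case True then show ?thesis using s by simp
        next
          case False then show ?thesis using s by (simp add: mult_right_mono_neg)
        qed
        then have e: "exp (real m * b) \<le> exp (real m * (b - min 0 \<Delta>)) * exp (s * \<Delta>)"
          unfolding exp_add[symmetric] by (simp add: algebra_simps)
        have "P m x y * exp (g y) * (h y * exp (s * d (cls y)))
            \<le> exp (real m * b) * exp (g y) * (h y * exp (s * d (cls y)))"
          using elim P_le_max_transition[OF cls(2) cls(2), of m x y] h[of y]
          by (intro mult_right_mono) auto
        also have "\<dots> \<le> exp (real m * (b - min 0 \<Delta>)) * exp (s * \<Delta>) * exp (g y) * (h y * exp (s * d (cls y)))"
          using e h[of y] by (intro mult_right_mono) auto
        also have "\<dots> = (exp (real m * (b - min 0 \<Delta>)) * (exp (g y) * h y)) * exp (s * d (cls x))"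
          by (simp add: \<Delta>_def algebra_simps exp_add[symmetric])
        also have "\<dots> \<le> (\<eta> * h x) * exp (s * d (cls x))"
          using elim by (intro mult_right_mono) auto
        finally show "P m x y * exp (g y) * (h y * exp (s * d (cls y))) \<le> \<eta> * (h x * exp (s * d (cls x)))"
          by (simp add: mult_ac)
      qed
    qed
  qed
  have "\<forall>\<^sub>F m in sequentially. \<forall>x s. 0 \<le> s \<longrightarrow> s \<le> real m \<longrightarrow>
      (\<Sum>y\<in>UNIV. P m x y * exp (g y) * (h y * exp (s * d (cls y)))) \<le> exp eps * (h x * exp (s * d (cls x)))"
  proof -
    have c: "\<forall>\<^sub>F m in sequentially. \<forall>y. cls x \<noteq> cls y \<longrightarrow> (\<forall>s. 0 \<le> s \<longrightarrow> s \<le> real m \<longrightarrow>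
      P m x y * exp (g y) * (h y * exp (s * d (cls y))) \<le> \<eta> * (h x * exp (s * d (cls x))))" for x
      using cross[of x] by (intro eventually_all_finite) (auto intro: eventually_mono)
    have "\<forall>\<^sub>F m in sequentially. \<forall>s. 0 \<le> s \<longrightarrow> s \<le> real m \<longrightarrow>
      (\<Sum>y\<in>UNIV. P m x y * exp (g y) * (h y * exp (s * d (cls y)))) \<le> exp eps * (h x * exp (s * d (cls x)))" for x
      using c[of x] inclass[of x]
    proof eventually_elim
      case (elim m)
      show ?case
      proof (intro allI impI)
        fix s :: real assume s: "0 \<le> s" "s \<le> real m"
        let ?E = "h x * exp (s * d (cls x))"
        let ?t = "\<lambda>y. P m x y * exp (g y) * (h y * exp (s * d (cls y)))"
        have E: "?E > 0" using h by simp
        have "(\<Sum>y\<in>UNIV. ?t y) = (\<Sum>y\<in>C (cls x). ?t y) + (\<Sum>y\<in>- C (cls x). ?t y)"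
          using sum.Int_Diff[of UNIV ?t "C (cls x)"] by (simp add: Compl_eq_Diff_UNIV)
        also have "(\<Sum>y\<in>C (cls x). ?t y) = (\<Sum>y\<in>C (cls x). P m x y * exp (g y) * h y) * exp (s * d (cls x))"
          unfolding sum_distrib_right
        proof (rule sum.cong[OF refl])
          fix y assume "y \<in> C (cls x)"
          then have "cls y = cls x" using cls cls_eq by blast
          then show "?t y = P m x y * exp (g y) * h y * exp (s * d (cls x))" by simp
        qed
        also have "\<dots> \<le> (1 + eps / 2) * ?E"
          using elim(2) by (simp add: mult.assoc[symmetric])
        also have "(\<Sum>y\<in>- C (cls x). ?t y) \<le> (\<Sum>y\<in>- C (cls x). \<eta> * ?E)"
        proof (rule sum_mono)
          fix y assume "y \<in> - C (cls x)"
          then have "cls x \<noteq> cls y" using cls(2)[of y] by auto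
          then show "?t y \<le> \<eta> * ?E" using elim(1) s by blast
        qed
        also have "(\<Sum>y\<in>- C (cls x). \<eta> * ?E) \<le> (\<Sum>y\<in>(UNIV::'s set). \<eta> * ?E)"
          using \<eta> E by (intro sum_mono2) auto
        also have "\<dots> = eps / 2 * ?E" by (simp add: \<eta>_def)
        finally have "(\<Sum>y\<in>UNIV. ?t y) \<le> (1 + eps / 2) * ?E + eps / 2 * ?E" by simp
        also have "\<dots> = (1 + eps) * ?E" by (simp add: algebra_simps)
        also have "\<dots> \<le> exp eps * ?E"
          using E by (intro mult_right_mono exp_ge_add_one_self) auto
        finally show "(\<Sum>y\<in>UNIV. ?t y) \<le> exp eps * ?E" .
      qed
    qed
    then show ?thesis by (rule eventually_all_finite)
  qed
  then obtain m0 where m0: "\<And>m x s. m \<ge> m0 \<Longrightarrow> 0 \<le> s \<Longrightarrow> s \<le> real m \<Longrightarrow>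
      (\<Sum>y\<in>UNIV. P m x y * exp (g y) * (h y * exp (s * d (cls y)))) \<le> exp eps * (h x * exp (s * d (cls x)))"
    unfolding eventually_sequentially by blast
  \<comment> \<open>The finitely many times below \<open>m0\<close> get a crude constant; it exists
    because \<open>s \<le> m\<close> bounds the change of the potential factor by
    \<open>exp (real m0 * (2 * Dm))\<close>.\<close>
  define Dm where "Dm = (\<Sum>i\<in>{1..K}. \<bar>d i\<bar>)"
  have Dm: "\<bar>d (cls x)\<bar> \<le> Dm" for x
    unfolding Dm_def using cls(1) by (intro member_le_sum) auto
  have Dm0: "Dm \<ge> 0" unfolding Dm_def by (simp add: sum_nonneg)
  define B2 where "B2 = (\<Sum>x\<in>UNIV. \<Sum>y\<in>UNIV. exp (g y) * h y / h x)"
  have B2: "(\<Sum>y\<in>UNIV. exp (g y) * h y) \<le> B2 * h x" for x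
  proof -
    have "(\<Sum>y\<in>UNIV. exp (g y) * h y / h x) \<le> B2"
      unfolding B2_def using h
      by (intro member_le_sum[of x UNIV "\<lambda>x. \<Sum>y\<in>UNIV. exp (g y) * h y / h x"])
        (auto intro!: sum_nonneg simp: less_imp_le)
    then show ?thesis using h[of x] by (simp add: sum_divide_distrib[symmetric] field_simps)
  qed
  define C1 where "C1 = max 1 (B2 * exp (real m0 * (2 * Dm)))"
  show ?thesis
  proof (rule that[of h C1 m0])
    show "h x > 0" for x by (rule h)
    show "C1 \<ge> 1" by (simp add: C1_def)
    fix m :: nat and s :: real and x assume m: "m \<ge> 1" and s: "0 \<le> s" "s \<le> real m"
    show "(\<Sum>y\<in>UNIV. P m x y * exp (g y) * (h y * exp (s * d (cls y))))
         \<le> (if m \<ge> m0 then exp eps else C1) * (h x * exp (s * d (cls x)))"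
    proof (cases "m \<ge> m0")
      case True then show ?thesis using m0 s by simp
    next
      case False
      let ?e = "exp (real m0 * (2 * Dm)) * exp (s * d (cls x))"
      have "exp (s * d (cls y)) \<le> ?e" for y
      proof -
        have "s * (d (cls y) - d (cls x)) \<le> s * (2 * Dm)"
          using Dm[of x] Dm[of y] s by (intro mult_left_mono) auto
        also have "\<dots> \<le> real m0 * (2 * Dm)" using False s Dm0 by (intro mult_right_mono) auto
        finally show ?thesis unfolding exp_add[symmetric] by (simp add: algebra_simps)
      qed
      then have "P m x y * exp (g y) * (h y * exp (s * d (cls y))) \<le> 1 * exp (g y) * (h y * ?e)" for y
        using P_le_1[OF m] h[of y] P_nonneg[OF m]
        by (intro mult_mono mult_left_mono mult_nonneg_nonneg) (auto simp: less_imp_le)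
      then have "(\<Sum>y\<in>UNIV. P m x y * exp (g y) * (h y * exp (s * d (cls y)))) \<le> (\<Sum>y\<in>UNIV. 1 * exp (g y) * (h y * ?e))"
        by (intro sum_mono)
      also have "\<dots> = (\<Sum>y\<in>UNIV. exp (g y) * h y) * ?e" by (simp add: sum_distrib_right mult.assoc)
      also have "\<dots> \<le> (B2 * h x) * ?e" using B2 by (intro mult_right_mono) auto
      also have "\<dots> = (B2 * exp (real m0 * (2 * Dm))) * (h x * exp (s * d (cls x)))" by (simp add: mult_ac)
      also have "\<dots> \<le> C1 * (h x * exp (s * d (cls x)))"
        using h[of x] by (intro mult_right_mono) (auto simp: C1_def)
      finally show ?thesis using False by simp
    qed
  qed
qed

text \<open>The one-step estimate is iterated with \<open>s\<close> frozen at the starting time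
  \<open>S\<close>, which is allowed because \<open>S\<close> stays below the time of every step. At
  most \<open>m0\<close> steps cost the constant \<open>C1\<close>, the others cost
  \<open>exp eps\<close>; the function \<open>h\<close> is comparable with 1 because the state space
  is finite.\<close>

lemma evol_tilted_bound:
  assumes d: "potential d" and g: "admissible_tilt g" and eps: "eps > 0"
  obtains c where "c \<ge> 1"
    "\<And>k S x. evol (\<lambda>m x y. P m x y * exp (g y)) k S (\<lambda>y. exp (real S * d (cls y))) x
       \<le> c * exp (eps * real k) * exp (real S * d (cls x))"
proof -
  obtain h C1 m0 where h: "\<And>x. h x > 0" and C1: "C1 \<ge> 1"
    and step: "\<And>m s x. m \<ge> 1 \<Longrightarrow> 0 \<le> s \<Longrightarrow> s \<le> real m \<Longrightarrow>
       (\<Sum>y\<in>UNIV. P m x y * exp (g y) * (h y * exp (s * d (cls y))))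
         \<le> (if m \<ge> m0 then exp eps else C1) * (h x * exp (s * d (cls x)))"
    using one_step_bound[OF assms] by blast
  let ?A = "\<lambda>m x y. P m x y * exp (g y)"
  have iter: "evol ?A k S (\<lambda>y. h y * exp (s * d (cls y))) x
      \<le> C1 ^ (m0 - S) * exp (eps * real k) * (h x * exp (s * d (cls x)))"
    if "0 \<le> s" "s \<le> real S" for k S x s
    using that
  proof (induction k arbitrary: S x)
    case 0
    have "1 * (h x * exp (s * d (cls x))) \<le> C1 ^ (m0 - S) * (h x * exp (s * d (cls x)))"
      using C1 h[of x] by (intro mult_right_mono) auto
    then show ?case by simp
  next
    case (Suc k)
    let ?c = "C1 ^ (m0 - Suc S) * exp (eps * real k)"
    have c: "?c \<ge> 0" using C1 by simp
    have "evol ?A (Suc k) S (\<lambda>y. h y * exp (s * d (cls y))) x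
        \<le> (\<Sum>y\<in>UNIV. ?A (Suc S) x y * (?c * (h y * exp (s * d (cls y)))))"
      unfolding evol.simps using Suc P_nonneg by (intro sum_mono mult_left_mono) auto
    also have "\<dots> = ?c * (\<Sum>y\<in>UNIV. ?A (Suc S) x y * (h y * exp (s * d (cls y))))"
      by (simp add: sum_distrib_left mult_ac)
    also have "\<dots> \<le> ?c * ((if Suc S \<ge> m0 then exp eps else C1) * (h x * exp (s * d (cls x))))"
      using step[of "Suc S" s x] Suc.prems c by (intro mult_left_mono) auto
    also have "\<dots> = ?c * (if Suc S \<ge> m0 then exp eps else C1) * (h x * exp (s * d (cls x)))"
      by simp
    also have "\<dots> \<le> C1 ^ (m0 - S) * exp (eps * real (Suc k)) * (h x * exp (s * d (cls x)))"
    proof (rule mult_right_mono)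
      show "?c * (if Suc S \<ge> m0 then exp eps else C1) \<le> C1 ^ (m0 - S) * exp (eps * real (Suc k))"
      proof (cases "Suc S \<ge> m0")
        case True
        then have "?c * exp eps = 1 * exp (eps * real (Suc k))" by (simp add: exp_add[symmetric] algebra_simps)
        also have "\<dots> \<le> C1 ^ (m0 - S) * exp (eps * real (Suc k))" using C1 by (intro mult_right_mono) auto
        finally show ?thesis using True by simp
      next
        case False
        then have "m0 - S = Suc (m0 - Suc S)" by simp
        then have "?c * C1 = C1 ^ (m0 - S) * exp (eps * real k)" by simp
        also have "\<dots> \<le> C1 ^ (m0 - S) * exp (eps * real (Suc k))"
          using C1 eps by (intro mult_left_mono) auto
        finally show ?thesis using False by simp
      qed
      show "0 \<le> h x * exp (s * d (cls x))" using h[of x] by simp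
    qed
    finally show ?case .
  qed
  define a b where "a = Min (range h)" and "b = Max (range h)"
  have a: "a > 0" "\<And>x. a \<le> h x" and b: "\<And>x. h x \<le> b"
    unfolding a_def b_def using h by auto
  have b0: "b > 0" using h[of undefined] b[of undefined] by linarith
  have ab: "a \<le> b" using a(2) b order_trans by blast
  define c where "c = C1 ^ m0 * (b / a)"
  show ?thesis
  proof (rule that[of c])
    show "c \<ge> 1" unfolding c_def using C1 a ab mult_mono[of 1 "C1 ^ m0" 1 "b / a"] by simp
    fix k S x
    let ?E = "\<lambda>y. exp (real S * d (cls y))"
    have "a * evol ?A k S ?E x = evol ?A k S (\<lambda>y. a * ?E y) x" by (simp add: evol_scale)
    also have "\<dots> \<le> evol ?A k S (\<lambda>y. h y * ?E y) x"
      using a P_nonneg by (intro evol_mono) (auto simp: less_imp_le)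
    also have "\<dots> \<le> C1 ^ (m0 - S) * exp (eps * real k) * (h x * ?E x)" by (rule iter) auto
    also have "\<dots> \<le> C1 ^ m0 * exp (eps * real k) * (b * ?E x)"
      using C1 b b0 h[of x] by (intro mult_mono power_increasing) (auto simp: less_imp_le)
    also have "\<dots> = a * (c * exp (eps * real k) * ?E x)" using a by (simp add: c_def)
    finally show "evol ?A k S ?E x \<le> c * exp (eps * real k) * ?E x" using a by simp
  qed
qed

section \<open>Routes between classes and the potentials made from \<open>U0\<close>\<close>

fun route_cost :: "nat list \<Rightarrow> ereal" where
  "route_cost (i # j # l) = ups i j + route_cost (j # l)"
| "route_cost _ = 0"

definition route :: "nat \<Rightarrow> nat \<Rightarrow> nat list \<Rightarrow> bool" where
  "route i j l \<longleftrightarrow> length l \<ge> 2 \<and> distinct l \<and> set l \<subseteq> {1..K} \<and> hd l = i \<and> last l = j"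

lemma sum_eq_route_cost:
  "length l = k + 2 \<Longrightarrow> (\<Sum>s=0..k. ups (l ! s) (l ! (s + 1))) = route_cost l"
proof (induction k arbitrary: l)
  case 0
  then obtain x y where "l = [x, y]" by (auto simp: length_Suc_conv numeral_2_eq_2)
  then show ?case by simp
next
  case (Suc k)
  then obtain x y m where l: "l = x # y # m" by (auto simp: length_Suc_conv numeral_2_eq_2)
  have "(\<Sum>s=0..Suc k. ups (l ! s) (l ! (s + 1))) = ups x y + (\<Sum>s=0..k. ups ((y # m) ! s) ((y # m) ! (s + 1)))"
    unfolding sum.atLeast0_atMost_Suc_shift by (simp add: l)
  also have "\<dots> = ups x y + route_cost (y # m)" using Suc.prems l by (subst Suc.IH) auto
  finally show ?case using l by simp
qed

lemma index_tuples_iff: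
  "l \<in> index_tuples K k i j \<longleftrightarrow> length l = k + 2 \<and> route i j l"
proof -
  have "l ! 0 = hd l \<and> l ! (k + 1) = last l" if "length l = k + 2"
  proof -
    have "l \<noteq> []" using that by auto
    then show ?thesis using that by (simp add: hd_conv_nth last_conv_nth)
  qed
  then show ?thesis unfolding index_tuples_def route_def by auto
qed

lemma finite_index_tuples: "finite (index_tuples K k i j)"
  by (rule finite_subset[OF _ finite_lists_length_eq[of "{1..K}" "k + 2"]])
    (auto simp: index_tuples_def)

lemma U0_eq:
  "U0 K P C i j = (MAX k\<in>{0..K - 2}. MAX l\<in>index_tuples K k i j. route_cost l)"
proof -
  have "(\<Sum>s=0..k. ups (l ! s) (l ! (s + 1))) = route_cost l" if "l \<in> index_tuples K k i j" for k l
    using that by (intro sum_eq_route_cost) (simp add: index_tuples_def)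
  then show ?thesis unfolding U0_def by (simp cong: image_cong)
qed

lemma route_cost_le_U0:
  assumes "route i j l"
  shows "route_cost l \<le> U0 K P C i j"
proof -
  define k where "k = length l - 2"
  have "length l \<ge> 2" using assms by (simp add: route_def)
  then have "length l = k + 2" unfolding k_def by linarith
  then have l: "l \<in> index_tuples K k i j" using assms by (simp add: index_tuples_iff)
  have "length l \<le> K"
    using assms card_mono[of "{1..K}" "set l"] by (simp add: route_def distinct_card)
  then have k: "k \<in> {0..K - 2}" by (simp add: k_def)
  have "route_cost l \<le> (MAX l\<in>index_tuples K k i j. route_cost l)"
    using l finite_index_tuples by (intro Max_ge) auto
  also have "\<dots> \<le> U0 K P C i j"
    unfolding U0_eq using k by (intro Max_ge) auto
  finally show ?thesis .
qed

text \<open>\<open>Max\<close> says nothing about an empty set, so for the selected \<open>k\<close>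
  a route with exactly \<open>k\<close> intermediate classes has to be exhibited; any
  \<open>k\<close> of the \<open>K - 2\<close> remaining indices serve.\<close>

lemma U0_attained:
  assumes "i \<in> {1..K}" "j \<in> {1..K}" "i \<noteq> j"
  obtains l where "route i j l" "U0 K P C i j = route_cost l"
proof -
  have "U0 K P C i j \<in> (\<lambda>k. MAX l\<in>index_tuples K k i j. route_cost l) ` {0..K - 2}"
    unfolding U0_eq by (intro Max_in) auto
  then obtain k where k: "k \<le> K - 2" "U0 K P C i j = (MAX l\<in>index_tuples K k i j. route_cost l)" by auto
  have "card ({1..K} - {i, j}) = K - 2" using assms by (simp add: card_Diff_subset)
  then obtain S where S: "S \<subseteq> {1..K} - {i, j}" "card S = k" "finite S"
    using obtain_subset_with_card_n[of k "{1..K} - {i, j}"] k(1) by auto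
  obtain m where m: "set m = S" "distinct m" using finite_distinct_list[OF S(3)] by blast
  have "length m = k" using m S by (simp add: distinct_card[symmetric])
  moreover have "set m \<subseteq> {1..K}" "i \<notin> set m" "j \<notin> set m" using m S by auto
  ultimately have "i # m @ [j] \<in> index_tuples K k i j"
    using m assms unfolding index_tuples_iff route_def by simp
  then have "(MAX l\<in>index_tuples K k i j. route_cost l) \<in> route_cost ` index_tuples K k i j"
    using finite_index_tuples by (intro Max_in) auto
  then obtain l where "l \<in> index_tuples K k i j" "U0 K P C i j = route_cost l" using k(2) by auto
  then show ?thesis using that index_tuples_iff by blast
qed

lemma route_cost_nonpos: "set l \<subseteq> {1..K} \<Longrightarrow> route_cost l \<le> 0"
  using ups_nonpos by (induction l rule: route_cost.induct) (auto intro!: add_nonpos_nonpos)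

lemma route_cost_le_suffix: "set l \<subseteq> {1..K} \<Longrightarrow> l = a @ b \<Longrightarrow> route_cost l \<le> route_cost b"
proof (induction a arbitrary: l)
  case (Cons i a)
  then have "route_cost (a @ b) \<le> route_cost b" by simp
  moreover have "route_cost l \<le> route_cost (a @ b)"
  proof (cases "a @ b")
    case Nil then show ?thesis using Cons by simp
  next
    case (Cons j m)
    then have "ups i j \<le> 0" using Cons.prems ups_nonpos[of i j] by simp
    then show ?thesis using Cons Cons.prems add_mono[of "ups i j" 0 "route_cost (j # m)"] by simp
  qed
  ultimately show ?case by simp
qed simp

lemma U0_nonpos: "i \<in> {1..K} \<Longrightarrow> j \<in> {1..K} \<Longrightarrow> i \<noteq> j \<Longrightarrow> U0 K P C i j \<le> 0"
  by (metis U0_attained route_cost_nonpos route_def)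

lemma ups_le_U0:
  assumes "i \<in> {1..K}" "j \<in> {1..K}" "i \<noteq> j"
  shows "ups i j \<le> U0 K P C i j"
  using route_cost_le_U0[of i j "[i, j]"] assms by (simp add: route_def)

text \<open>An optimal route from \<open>j\<close> to \<open>t\<close> is prefixed with
  \<open>i\<close>. If \<open>i\<close> already occurs on it, only the part from \<open>i\<close> on
  is kept, which cannot lower \<open>route_cost\<close> because all summands are
  nonpositive.\<close>

lemma U0_triangle:
  assumes "i \<in> {1..K}" "j \<in> {1..K}" "t \<in> {1..K}" "i \<noteq> j" "j \<noteq> t" "i \<noteq> t"
  shows "ups i j + U0 K P C j t \<le> U0 K P C i t"
proof -
  obtain l where l: "route j t l" "U0 K P C j t = route_cost l" using U0_attained assms by blast
  then obtain l' where l': "l = j # l'" by (cases l) (auto simp: route_def)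
  show ?thesis
  proof (cases "i \<in> set l")
    case False
    then have "route i t (i # l)" using l assms by (auto simp: route_def)
    then show ?thesis using route_cost_le_U0 l' l by fastforce
  next
    case True
    then obtain a b where ab: "l = a @ i # b" by (metis split_list)
    have "b \<noteq> []" using ab l assms by (auto simp: route_def)
    then have "route i t (i # b)" using l ab by (cases b) (auto simp: route_def)
    then have "route_cost (i # b) \<le> U0 K P C i t" by (rule route_cost_le_U0)
    moreover have "route_cost l \<le> route_cost (i # b)"
      using l ab by (intro route_cost_le_suffix) (auto simp: route_def)
    moreover have "ups i j + route_cost l \<le> 0 + route_cost l"
      using ups_nonpos assms by (intro add_right_mono) auto
    ultimately show ?thesis using l by simp
  qed
qed

text \<open>Scaling by \<open>1 - \<delta>\<close> makes the inequalities of \<^const>\<open>potential\<close> strict; truncation at \<open>-B\<close> makes the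
  potential finite.\<close>

definition U0_potential :: "real \<Rightarrow> real \<Rightarrow> nat \<Rightarrow> nat \<Rightarrow> real" where
  "U0_potential \<delta> B t i =
     (if i = t then 0 else (1 - \<delta>) * real_of_ereal (max (U0 K P C i t) (ereal (- B))))"

lemma potential_U0:
  assumes \<delta>: "0 < \<delta>" "\<delta> < 1" and B: "B \<ge> 0" and t: "t \<in> {1..K}"
  shows "potential (U0_potential \<delta> B t)"
proof -
  define e where "e i = (if i = t then 0 else real_of_ereal (max (U0 K P C i t) (ereal (- B))))" for i
  have d: "U0_potential \<delta> B t i = (1 - \<delta>) * e i" for i by (simp add: U0_potential_def e_def)
  have e: "ereal (e i) = max (U0 K P C i t) (ereal (- B))" if "i \<in> {1..K}" "i \<noteq> t" for i
  proof -
    have "max (U0 K P C i t) (ereal (- B)) \<le> 0" using U0_nonpos[OF that(1) t that(2)] B by simp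
    moreover have "ereal (- B) \<le> max (U0 K P C i t) (ereal (- B))" by simp
    ultimately have "\<bar>max (U0 K P C i t) (ereal (- B))\<bar> \<noteq> \<infinity>"
      by (cases "max (U0 K P C i t) (ereal (- B))") auto
    then show ?thesis using that by (simp add: e_def ereal_real)
  qed
  have e0: "e i \<le> 0" if "i \<in> {1..K}" for i
  proof (cases "i = t")
    case False
    then have "ereal (e i) \<le> 0" using e[OF that] U0_nonpos[OF that t] B by simp
    then show ?thesis by (simp add: zero_ereal_def)
  qed (simp add: e_def)
  \<comment> \<open>Before scaling, the inequality of a potential is the triangle inequality for
    \<open>U0\<close>. Truncation at \<open>-B\<close> preserves it because
    \<open>ups i j \<le> 0\<close> and no value lies below \<open>-B\<close>.\<close>
  have tri: "ups i j + ereal (e j) \<le> ereal (e i)" if ij: "i \<in> {1..K}" "j \<in> {1..K}" "i \<noteq> j" for i j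
  proof -
    consider "i = t" | "i \<noteq> t" "j = t" | "i \<noteq> t" "j \<noteq> t" by blast
    then show ?thesis
    proof cases
      case 1
      have "ups i j + ereal (e j) \<le> 0 + 0"
        using ups_nonpos ij e0[OF ij(2)] by (intro add_mono) (auto simp: zero_ereal_def)
      then show ?thesis using 1 by (simp add: e_def zero_ereal_def)
    next
      case 2
      then have "ups i j \<le> ereal (e i)" using ups_le_U0[OF ij] e[of i] ij by (auto simp: max_def intro: order_trans)
      then show ?thesis using 2 by (simp add: e_def zero_ereal_def[symmetric])
    next
      case 3
      show ?thesis
      proof (cases "U0 K P C j t \<ge> ereal (- B)")
        case True
        then have "ups i j + ereal (e j) = ups i j + U0 K P C j t" using e[of j] ij 3 by (simp add: max_def)
        also have "\<dots> \<le> U0 K P C i t" using U0_triangle ij t 3 by blast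
        also have "\<dots> \<le> ereal (e i)" using e[of i] ij 3 by simp
        finally show ?thesis .
      next
        case False
        then have "U0 K P C j t \<le> ereal (- B)" by (meson linear)
        then have "ereal (e j) = ereal (- B)" using e[of j] ij 3 by (simp add: max.absorb2)
        then have "ups i j + ereal (e j) \<le> 0 + ereal (- B)" using ups_nonpos ij by (intro add_mono) auto
        also have "\<dots> \<le> ereal (e i)" using e[of i] ij 3 by simp
        finally show ?thesis .
      qed
    qed
  qed
  show ?thesis
    unfolding potential_def d
  proof (intro ballI impI conjI)
    fix i j assume ij: "i \<in> {1..K}" "j \<in> {1..K}" "i \<noteq> j"
    { assume "ups i j = 0"
      then have "e j \<le> e i" using tri[OF ij] by simp
      then show "(1 - \<delta>) * e j \<le> (1 - \<delta>) * e i" using \<delta> by simp }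
    { assume neg: "ups i j < 0"
      show "ups i j < ereal ((1 - \<delta>) * e i - (1 - \<delta>) * e j)"
      proof (cases "ups i j")
        case (real u)
        \<comment> \<open>From \<open>u \<le> x\<close> and \<open>u < 0\<close> scaling gives
          strictness: a negative \<open>x\<close> moves up to \<open>(1 - \<delta>) * x\<close>, and
          a nonnegative one stays above \<open>u\<close>.\<close>
        define x where "x = e i - e j"
        have u: "u < 0" "u \<le> x" using neg tri[OF ij] real by (auto simp: x_def)
        have "u < (1 - \<delta>) * x"
        proof (cases "x \<ge> 0")
          case True
          then have "0 \<le> (1 - \<delta>) * x" using \<delta> by simp
          then show ?thesis using u by linarith
        next
          case False
          then have "\<delta> * x < 0" using \<delta> by (simp add: mult_pos_neg)
          then show ?thesis using u by (simp add: algebra_simps)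
        qed
        then show ?thesis using real by (simp add: x_def right_diff_distrib)
      qed (use neg in auto) }
  qed
qed

lemma potential_zero: "potential (\<lambda>_. 0)"
  by (simp add: potential_def zero_ereal_def)

text \<open>The path is cut at the times \<open>L 1, ..., L M\<close>. On the segment after
  \<open>L i\<close> the potential \<open>d i\<close> is used, frozen at time \<open>L i\<close>: it
  starts from class \<open>c i\<close>, which produces the factor
  \<open>exp (real (L i) * d i (c i))\<close>, and it vanishes at \<open>c (i + 1)\<close>, where
  the segment ends, so that the next one starts afresh. Checkpoints at time 0 stand for classes
  never visited and contribute the factor 1.\<close>

lemma checkpoint_bound:
  fixes c :: "nat \<Rightarrow> nat" and d :: "nat \<Rightarrow> nat \<Rightarrow> real"
  assumes g: "admissible_tilt g" and eps: "eps > 0" and M: "M \<ge> 1"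
    and d: "\<And>i. i \<in> {1..<M} \<Longrightarrow> potential (d i)" "\<And>i. i \<in> {1..<M} \<Longrightarrow> d i (c (i + 1)) = 0"
    and c: "\<And>i. i \<in> {1..M} \<Longrightarrow> c i \<in> {1..K}"
  obtains b where "b > 0"
    "\<And>n L D x. (\<And>i. i \<in> {1..M} \<Longrightarrow> L i \<le> n) \<Longrightarrow>
       (\<And>i. i \<in> {1..<M} \<Longrightarrow> L i < L (i + 1) \<or> (L i = 0 \<and> L (i + 1) = 0)) \<Longrightarrow>
       (\<And>i. i \<in> {1..M} \<Longrightarrow> L i \<ge> 1 \<Longrightarrow> D (L i) \<subseteq> C (c i)) \<Longrightarrow>
       evol (\<lambda>m x y. if y \<in> D m then P m x y * exp (g y) else 0) n 0 (\<lambda>_. 1) x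
         \<le> b * exp (eps * real n) * exp (\<Sum>i=1..<M. real (L i) * d i (c i))"
proof -
  let ?A = "\<lambda>m x y. P m x y * exp (g y)"
  \<comment> \<open>The zero potential serves the segments before the first and after the last
    checkpoint.\<close>
  define d' where "d' i = (if i \<in> {1..<M} then d i else (\<lambda>_. 0))" for i
  define Q where "Q i b \<longleftrightarrow> b \<ge> 1 \<and> (\<forall>k S x. evol ?A k S (\<lambda>y. exp (real S * d' i (cls y))) x
       \<le> b * exp (eps * real k) * exp (real S * d' i (cls x)))" for i b
  have "\<exists>b. Q i b" for i
  proof -
    have "potential (d' i)" using d(1) potential_zero by (simp add: d'_def)
    then show ?thesis
    proof (rule evol_tilted_bound[OF _ g eps])
      fix b assume "b \<ge> 1" "\<And>k S x. evol ?A k S (\<lambda>y. exp (real S * d' i (cls y))) x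
       \<le> b * exp (eps * real k) * exp (real S * d' i (cls x))"
      then have "Q i b" by (simp add: Q_def)
      then show ?thesis by (rule exI)
    qed
  qed
  then have "\<exists>bs. \<forall>i. Q i (bs i)" by (intro choice allI)
  then obtain bs where "\<forall>i. Q i (bs i)" by (rule exE)
  then have bs: "\<And>i. bs i \<ge> 1" "\<And>i k S x. evol ?A k S (\<lambda>y. exp (real S * d' i (cls y))) x
       \<le> bs i * exp (eps * real k) * exp (real S * d' i (cls x))"
    by (simp_all add: Q_def)
  define b where "b = Max (bs ` {0..M})"
  have b: "bs i \<le> b" if "i \<le> M" for i unfolding b_def using that by (intro Max_ge) auto
  have b1: "b \<ge> 1" using b[of 0] bs(1)[of 0] by linarith
  have bound: "evol ?A k S (\<lambda>y. exp (real S * d' i (cls y))) x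
       \<le> b * exp (eps * real k) * exp (real S * d' i (cls x))" if "i \<le> M" for i k S x
  proof -
    have "bs i * exp (eps * real k) * exp (real S * d' i (cls x)) \<le> b * exp (eps * real k) * exp (real S * d' i (cls x))"
      using b[OF that] by (intro mult_right_mono) auto
    then show ?thesis using bs(2)[where k=k and S=S and i=i and x=x] by linarith
  qed
  show ?thesis
  proof (rule that[of "b ^ (M + 1)"])
    show "b ^ (M + 1) > 0" using b1 by simp
    fix n :: nat and L :: "nat \<Rightarrow> nat" and D :: "nat \<Rightarrow> 's set" and x
    assume Ln: "\<And>i. i \<in> {1..M} \<Longrightarrow> L i \<le> n"
      and Lmono: "\<And>i. i \<in> {1..<M} \<Longrightarrow> L i < L (i + 1) \<or> (L i = 0 \<and> L (i + 1) = 0)"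
      and D: "\<And>i. i \<in> {1..M} \<Longrightarrow> L i \<ge> 1 \<Longrightarrow> D (L i) \<subseteq> C (c i)"
    define B where "B = (\<lambda>m x y. if y \<in> D m then P m x y * exp (g y) else 0)"
    define F where "F m = evol B (n - m) m (\<lambda>_. 1)" for m
    define w where "w i = (\<Sum>j=i..<M. real (L j) * d j (c j))" for i
    have B0: "0 \<le> B m x y" if "m > S" for m S x y using that P_nonneg by (simp add: B_def)
    have BA: "B m x y \<le> ?A m x y" if "m > S" for m S x y using that P_nonneg by (simp add: B_def)
    have F0: "0 \<le> F m x" for m x unfolding F_def by (rule evol_nonneg) (use B0 in auto)
    \<comment> \<open>One segment: the step that ends at \<open>T\<close> must land in
      \<open>D T\<close>, so \<open>F T\<close> may be replaced by its restriction to that set,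
      where the assumed bound applies.\<close>
    have link: "F S x \<le> b * exp (eps * (real T - real S)) * exp (real S * d' i (cls x)) * v"
      if "S < T" "T \<le> n" "i \<le> M" and v: "v \<ge> 0" and Fv: "\<And>y. y \<in> D T \<Longrightarrow> F T y \<le> v * exp (real S * d' i (cls y))"
      for S T i v x
    proof -
      define k where "k = T - S - 1"
      have T: "T = S + Suc k" using that(1) by (simp add: k_def)
      have "n - S = Suc k + (n - T)" using that(2) T by linarith
      then have "F S x = evol B (Suc k + (n - T)) S (\<lambda>_. 1) x" unfolding F_def by (rule arg_cong)
      also have "\<dots> = evol B (Suc k) S (F T) x" unfolding evol_add F_def T by (rule refl)
      also have "\<dots> = evol B (Suc k) S (\<lambda>y. if y \<in> D T then F T y else 0) x"
        by (rule evol_cong_last) (use T in \<open>auto simp: B_def split: if_splits\<close>)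
      also have "\<dots> \<le> evol ?A (Suc k) S (\<lambda>y. v * exp (real S * d' i (cls y))) x"
        using B0 BA F0 Fv v by (intro evol_mono) auto
      also have "\<dots> \<le> v * (b * exp (eps * real (Suc k)) * exp (real S * d' i (cls x)))"
        unfolding evol_scale by (rule mult_left_mono[OF bound[OF that(3)] v])
      finally show ?thesis using T by (simp add: mult_ac)
    qed
    \<comment> \<open>Backward over the checkpoints, since \<open>F\<close> at one checkpoint is the
      terminal function of the segment before it. At time 0 the class is not prescribed, hence the
      condition \<open>L i \<ge> 1\<close>.\<close>
    have claim: "\<forall>x. (L i \<ge> 1 \<longrightarrow> cls x = c i) \<longrightarrow> F (L i) x \<le> b ^ (M + 1 - i) * exp (eps * (real n - real (L i))) * exp (w i)"
      if "1 \<le> i" "i \<le> M" for i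
      using that(2,1)
    proof (induction i rule: inc_induct)
      case base
      show ?case
      proof (intro allI impI)
        fix x
        have "F (L M) x \<le> evol ?A (n - L M) (L M) (\<lambda>_. 1) x"
          unfolding F_def using B0 BA by (intro evol_mono) auto
        also have "\<dots> \<le> b * exp (eps * real (n - L M))"
          using bound[of 0 "n - L M" "L M" x] by (simp add: d'_def)
        finally show "F (L M) x \<le> b ^ (M + 1 - M) * exp (eps * (real n - real (L M))) * exp (w M)"
          using Ln[of M] M by (simp add: w_def of_nat_diff)
      qed
    next
      case (step i)
      have i: "i \<in> {1..<M}" using step by simp
      have w: "w i = real (L i) * d i (c i) + w (Suc i)"
        unfolding w_def using step by (simp add: sum.atLeast_Suc_lessThan)
      have IH: "\<And>x. (L (Suc i) \<ge> 1 \<longrightarrow> cls x = c (Suc i)) \<Longrightarrow>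
          F (L (Suc i)) x \<le> b ^ (M - i) * exp (eps * (real n - real (L (Suc i)))) * exp (w (Suc i))"
        using step by simp
      have pow: "b ^ (M + 1 - i) = b * b ^ (M - i)" using step by (simp add: Suc_diff_le)
      show ?case
      proof (intro allI impI)
        fix x assume x: "L i \<ge> 1 \<longrightarrow> cls x = c i"
        let ?v = "b ^ (M - i) * exp (eps * (real n - real (L (Suc i)))) * exp (w (Suc i))"
        have v: "?v \<ge> 0" using b1 by simp
        show "F (L i) x \<le> b ^ (M + 1 - i) * exp (eps * (real n - real (L i))) * exp (w i)"
        proof (cases "L i < L (Suc i)")
          case False
          then have z: "L i = 0" "L (Suc i) = 0" using Lmono[OF i] by auto
          then have "F (L i) x \<le> 1 * ?v" using IH[of x] by simp
          also have "\<dots> \<le> b * ?v" using b1 v by (intro mult_right_mono) auto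
          finally show ?thesis using z w pow by (simp add: mult_ac)
        next
          case True
          have "F (L i) x \<le> b * exp (eps * (real (L (Suc i)) - real (L i))) * exp (real (L i) * d' i (cls x)) * ?v"
          proof (rule link[OF True _ _ v])
            show "L (Suc i) \<le> n" using Ln[of "Suc i"] step by simp
            show "i \<le> M" using step by simp
            fix y assume "y \<in> D (L (Suc i))"
            then have "cls y = c (Suc i)"
              using D[of "Suc i"] True step c[of "Suc i"] cls_eq by auto
            then show "F (L (Suc i)) y \<le> ?v * exp (real (L i) * d' i (cls y))"
              using IH[of y] d(2)[OF i] i by (simp add: d'_def)
          qed
          also have "real (L i) * d' i (cls x) = real (L i) * d i (c i)"
            using x i by (cases "L i = 0") (auto simp: d'_def)
          also have "b * exp (eps * (real (L (Suc i)) - real (L i))) * exp (real (L i) * d i (c i)) * ?v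
              = b ^ (M + 1 - i) * exp (eps * (real n - real (L i))) * exp (w i)"
            unfolding pow w exp_add by (simp add: exp_add[symmetric] algebra_simps)
          finally show ?thesis .
        qed
      qed
    qed
    let ?v = "b ^ M * exp (eps * (real n - real (L 1))) * exp (w 1)"
    have c1: "F (L 1) y \<le> ?v" if "L 1 \<ge> 1 \<longrightarrow> cls y = c 1" for y
      using claim[of 1] M that by simp
    have v: "?v \<ge> 0" using b1 by simp
    have "F 0 x \<le> b * exp (eps * real n) * (b ^ M * exp (w 1))"
    proof (cases "L 1 = 0")
      case True
      then have "F 0 x \<le> 1 * ?v" using c1[of x] by simp
      also have "\<dots> \<le> b * ?v" using b1 v by (intro mult_right_mono) auto
      finally show ?thesis using True by (simp add: mult_ac)
    next
      case False
      have "F 0 x \<le> b * exp (eps * (real (L 1) - real 0)) * exp (real 0 * d' 0 (cls x)) * ?v"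
      proof (rule link[OF _ _ _ v])
        fix y assume "y \<in> D (L 1)"
        then have "cls y = c 1" using D[of 1] False M c[of 1] cls_eq by auto
        then show "F (L 1) y \<le> ?v * exp (real 0 * d' 0 (cls y))" using c1 by simp
      qed (use False Ln[of 1] M in auto)
      also have "\<dots> = b * exp (eps * real n) * (b ^ M * exp (w 1))"
        by (simp add: exp_add[symmetric] algebra_simps)
      finally show ?thesis .
    qed
    then show "evol (\<lambda>m x y. if y \<in> D m then P m x y * exp (g y) else 0) n 0 (\<lambda>_. 1) x
         \<le> b ^ (M + 1) * exp (eps * real n) * exp (\<Sum>i=1..<M. real (L i) * d i (c i))"
      by (simp add: F_def B_def w_def mult_ac)
  qed
qed

end

section \<open>The rate function\<close>

text \<open>Allows a bound on a sum of suprema to be checked on real minorants chosen for all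
  summands at once; nonnegativity excludes sums of opposite infinities.\<close>

lemma ereal_sum_le_if_minorants_le:
  fixes c :: "'i \<Rightarrow> ereal"
  assumes fin: "finite A" and nn: "\<And>i. i \<in> A \<Longrightarrow> 0 \<le> c i"
    and le: "\<And>r. (\<And>i. i \<in> A \<Longrightarrow> ereal (r i) < c i) \<Longrightarrow> (\<Sum>i\<in>A. r i) \<le> \<alpha>"
  shows "(\<Sum>i\<in>A. c i) \<le> ereal \<alpha>"
proof -
  have fin': "c i \<noteq> \<infinity>" if i: "i \<in> A" for i
  proof
    assume ci: "c i = \<infinity>"
    \<comment> \<open>An infinite summand admits arbitrarily large minorants, and -1 is a minorant
      of every nonnegative summand; together they violate the bound.\<close>
    define r where "r j = (if j = i then \<alpha> + real (card A) + 1 else -1)" for j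
    have "ereal (r j) < c j" if "j \<in> A" for j
      using nn[OF that] ci by (cases "j = i") (auto simp: r_def intro: less_le_trans[of _ 0])
    then have "(\<Sum>j\<in>A. r j) \<le> \<alpha>" by (rule le)
    moreover have "(\<Sum>j\<in>A. r j) = r i + (\<Sum>j\<in>A - {i}. r j)" using fin i by (rule sum.remove)
    moreover have "(\<Sum>j\<in>A - {i}. r j) = - real (card (A - {i}))" by (simp add: r_def)
    moreover have "card (A - {i}) \<le> card A" using fin by (intro card_mono) auto
    ultimately show False by (simp add: r_def)
  qed
  define s where "s i = real_of_ereal (c i)" for i
  have s: "c i = ereal (s i)" if "i \<in> A" for i
    using nn[OF that] fin'[OF that] by (cases "c i") (auto simp: s_def)
  have "(\<Sum>i\<in>A. s i) \<le> \<alpha>"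
  proof (rule field_le_epsilon)
    fix e :: real assume e: "e > 0"
    define e' where "e' = e / (real (card A) + 1)"
    have e': "e' > 0" using e by (simp add: e'_def)
    have "(\<Sum>i\<in>A. s i - e') \<le> \<alpha>" by (rule le) (use s e' in simp)
    moreover have "real (card A) * e' \<le> e"
      using e by (simp add: e'_def field_simps)
    ultimately show "(\<Sum>i\<in>A. s i) \<le> \<alpha> + e" by (simp add: sum_subtractf)
  qed
  then show ?thesis using s by simp
qed

lemma member_le_sum_ereal:
  fixes h :: "'i \<Rightarrow> ereal"
  assumes "finite A" "i \<in> A" "\<And>j. j \<in> A \<Longrightarrow> 0 \<le> h j"
  shows "h i \<le> (\<Sum>j\<in>A. h j)"
proof -
  have "0 \<le> (\<Sum>j\<in>A - {i}. h j)" using assms(3) by (intro sum_nonneg) auto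
  then show ?thesis unfolding sum.remove[OF assms(1,2)] by (rule add_increasing2) simp
qed

text \<open>Negation does not distribute over sums that mix both infinities; nonpositive summands
  exclude this.\<close>

lemma uminus_sum_ereal_nonpos:
  fixes h :: "'i \<Rightarrow> ereal"
  assumes "finite A" "\<And>i. i \<in> A \<Longrightarrow> h i \<le> 0"
  shows "- (\<Sum>i\<in>A. h i) = (\<Sum>i\<in>A. - h i)"
  using assms
proof (induction A rule: finite_induct)
  case (insert a A)
  have "(\<Sum>i\<in>A. h i) \<le> 0" using insert by (intro sum_nonpos) auto
  moreover have "h a \<le> 0" using insert by simp
  ultimately have "- (h a + (\<Sum>i\<in>A. h i)) = - h a + - (\<Sum>i\<in>A. h i)"
    by (cases "h a"; cases "\<Sum>i\<in>A. h i") auto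
  then show ?case using insert by simp
qed simp

lemma common_convergent_subsequence:
  fixes a :: "'i \<Rightarrow> nat \<Rightarrow> 'a::heine_borel"
  assumes "finite A" "infinite (I :: nat set)" "\<And>i. i \<in> A \<Longrightarrow> bounded (range (a i))"
  obtains r l where "strict_mono r" "\<And>k. r k \<in> I" "\<And>i. i \<in> A \<Longrightarrow> (\<lambda>k. a i (r k)) \<longlonglongrightarrow> l i"
proof -
  have "\<exists>r l. strict_mono r \<and> (\<forall>k. r k \<in> I) \<and> (\<forall>i\<in>A. (\<lambda>k. a i (r k)) \<longlonglongrightarrow> l i)"
    using assms(1,3)
  proof (induction A rule: finite_induct)
    case empty
    show ?case
      using strict_mono_enumerate[OF assms(2)] enumerate_in_set[OF assms(2)] by auto
  next
    case (insert j A)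
    then obtain r l where r: "strict_mono r" "\<forall>k. r k \<in> I" "\<forall>i\<in>A. (\<lambda>k. a i (r k)) \<longlonglongrightarrow> l i" by auto
    have "bounded (range (\<lambda>k. a j (r k)))"
      by (rule bounded_subset[of "range (a j)"]) (use insert in auto)
    then obtain x s where s: "strict_mono s" "((\<lambda>k. a j (r k)) \<circ> s) \<longlonglongrightarrow> x"
      using bounded_imp_convergent_subsequence by blast
    have "(\<lambda>k. a i ((r \<circ> s) k)) \<longlonglongrightarrow> (l(j := x)) i" if "i \<in> insert j A" for i
    proof (cases "i = j")
      case True then show ?thesis using s by (simp add: o_def)
    next
      case False
      then have "(\<lambda>k. a i (r k)) \<longlonglongrightarrow> l i" using r that by simp
      from LIMSEQ_subseq_LIMSEQ[OF this s(1)] show ?thesis using False by (simp add: o_def)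
    qed
    moreover have "strict_mono (r \<circ> s)" using r s by (simp add: strict_mono_o)
    moreover have "\<forall>k. (r \<circ> s) k \<in> I" using r(2) by simp
    ultimately show ?case by blast
  qed
  then show ?thesis using that by blast
qed

lemma le_of_le_add_small:
  fixes a b c :: real
  assumes "\<And>\<delta>. 0 < \<delta> \<Longrightarrow> \<delta> < 1 \<Longrightarrow> a \<le> b + \<delta> * c"
  shows "a \<le> b"
proof (rule ccontr)
  assume ab: "\<not> a \<le> b"
  define \<delta> where "\<delta> = min (1/2) ((a - b) / (2 * (\<bar>c\<bar> + 1)))"
  have \<delta>: "0 < \<delta>" "\<delta> < 1" using ab by (auto simp: \<delta>_def)
  have "\<delta> * c \<le> \<delta> * (\<bar>c\<bar> + 1)" using \<delta> by (intro mult_left_mono) auto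
  also have "\<dots> \<le> (a - b) / (2 * (\<bar>c\<bar> + 1)) * (\<bar>c\<bar> + 1)" by (intro mult_right_mono) (auto simp: \<delta>_def)
  also have "\<dots> = (a - b) / 2" by (simp add: field_simps)
  finally show False using assms[OF \<delta>] ab by simp
qed

lemma real_le_if_all_multiples_le:
  fixes a b :: real
  assumes "\<And>t. t > 0 \<Longrightarrow> t * a \<le> b"
  shows "a \<le> 0"
proof (rule ccontr)
  assume "\<not> a \<le> 0"
  then have "a > 0" by simp
  then have "(\<bar>b\<bar> + 1) / a * a \<le> b" by (intro assms) auto
  then show False using \<open>a > 0\<close> by simp
qed

text \<open>What the analysis of \<open>J_fun\<close> uses of the chain: \<open>\<Lambda>\<close> is
  the logarithm of the tilted eigenvalue and \<open>R\<close> a bound for \<open>f\<close>. The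
  value at 0 is nonpositive since class matrices are substochastic, and this makes the rates
  nonnegative; growth at most \<open>R * norm l\<close> makes a rate infinite outside the ball of
  radius \<open>R\<close>.\<close>

locale rate_data =
  fixes M :: nat and \<zeta> :: "nat \<Rightarrow> nat" and I :: "nat \<Rightarrow> real ^ 'd \<Rightarrow> ereal" and U :: "nat \<Rightarrow> nat \<Rightarrow> ereal"
    and \<Lambda> :: "nat \<Rightarrow> real ^ 'd \<Rightarrow> real" and R :: real
  assumes M_pos: "M \<ge> 1"
    and I_eq: "i \<in> {1..M} \<Longrightarrow> I (\<zeta> i) x = (SUP l. ereal (l \<bullet> x - \<Lambda> (\<zeta> i) l))"
    and \<Lambda>_0: "i \<in> {1..M} \<Longrightarrow> \<Lambda> (\<zeta> i) 0 \<le> 0"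
    and \<Lambda>_le: "i \<in> {1..M} \<Longrightarrow> \<Lambda> (\<zeta> i) l \<le> R * norm l"
    and U_nonpos: "i \<in> {1..M} \<Longrightarrow> j \<in> {1..M} \<Longrightarrow> i \<noteq> j \<Longrightarrow> U (\<zeta> i) (\<zeta> j) \<le> 0"
begin

abbreviation "V v i \<equiv> (\<Sum>j=1..i. v j :: real)"

lemma I_nonneg: "i \<in> {1..M} \<Longrightarrow> 0 \<le> I (\<zeta> i) x"
  unfolding I_eq using \<Lambda>_0[of i] by (intro SUP_upper2[of 0]) (auto simp: zero_ereal_def)

lemma perm_in:
  assumes "\<sigma> permutes {1..M}"
  shows "i \<in> {1..M} \<Longrightarrow> \<sigma> i \<in> {1..M}" and "i \<in> {1..<M} \<Longrightarrow> U (\<zeta> (\<sigma> i)) (\<zeta> (\<sigma> (i + 1))) \<le> 0"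
proof -
  show *: "\<sigma> i \<in> {1..M}" if "i \<in> {1..M}" for i using permutes_in_image[OF assms] that by blast
  assume i: "i \<in> {1..<M}"
  have "\<sigma> i \<noteq> \<sigma> (i + 1)" using injD[OF permutes_inj[OF assms], of i "i + 1"] by auto
  then show "U (\<zeta> (\<sigma> i)) (\<zeta> (\<sigma> (i + 1))) \<le> 0" using * i by (intro U_nonpos) auto
qed

text \<open>Brings the cases \<open>M = 1\<close> and \<open>M \<ge> 2\<close> into one form and
  writes the cost as a sum of nonnegative terms, so that infinite values cannot cancel. For
  \<open>M = 1\<close> both the weight and the permutation are trivial.\<close>

lemma path_cost_eq:
  assumes \<sigma>: "\<sigma> permutes {1..M}" and v: "v \<in> prob_vectors M"
  shows "path_cost M \<zeta> I U v \<sigma> x =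
    (\<Sum>i=1..<M. ereal (V v i) * - U (\<zeta> (\<sigma> i)) (\<zeta> (\<sigma> (i + 1)))) + (\<Sum>i=1..M. ereal (v i) * I (\<zeta> (\<sigma> i)) (x i))"
proof (cases "M \<ge> 2")
  case True
  have V: "V v i \<ge> 0" if "i \<in> {1..<M}" for i using v that by (auto simp: prob_vectors_def intro!: sum_nonneg)
  have "{1..M - 1} = {1..<M}" using M_pos by auto
  moreover have "- (\<Sum>i=1..<M. ereal (V v i) * U (\<zeta> (\<sigma> i)) (\<zeta> (\<sigma> (i + 1))))
      = (\<Sum>i=1..<M. - (ereal (V v i) * U (\<zeta> (\<sigma> i)) (\<zeta> (\<sigma> (i + 1)))))"
  proof (rule uminus_sum_ereal_nonpos)
    fix i assume i: "i \<in> {1..<M}"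
    then show "ereal (V v i) * U (\<zeta> (\<sigma> i)) (\<zeta> (\<sigma> (i + 1))) \<le> 0"
      using V[OF i] perm_in(2)[OF \<sigma> i] by (simp add: mult_nonneg_nonpos ereal_mult_le_0_iff)
  qed simp
  ultimately show ?thesis using True by (simp add: path_cost_def)
next
  case False
  then have M: "M = 1" using M_pos by simp
  have "\<sigma> 1 = 1" using perm_in(1)[OF \<sigma>, of 1] M by simp
  moreover have "v 1 = 1" using v M by (simp add: prob_vectors_def)
  ultimately show ?thesis using M by (simp add: path_cost_def one_ereal_def[symmetric])
qed

text \<open>In the upper bound \<open>w i\<close> is the limiting last visit time, which exceeds the time \<open>V v i\<close> spent in the
  first \<open>i\<close> classes; for the closedness of the level sets the two are equal.\<close>

lemma J_fun_le:
  assumes \<sigma>: "\<sigma> permutes {1..M}" and v0: "\<And>i. i \<in> {1..M} \<Longrightarrow> 0 \<le> v i" and v1: "(\<Sum>i=1..M. v i) = 1"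
    and V: "\<And>i. i \<in> {1..<M} \<Longrightarrow> V v i \<le> w i"
    and bound: "\<And>l u. (\<And>i. i \<in> {1..<M} \<Longrightarrow> U (\<zeta> (\<sigma> i)) (\<zeta> (\<sigma> (i + 1))) \<le> ereal (u i) \<and> u i \<le> 0) \<Longrightarrow>
      - (\<Sum>i=1..<M. w i * u i) + (\<Sum>i=1..M. l i \<bullet> y i - v i * \<Lambda> (\<zeta> (\<sigma> i)) (l i)) \<le> \<alpha>"
  shows "J_fun M \<zeta> I U (\<Sum>i=1..M. y i) \<le> ereal \<alpha>"
proof -
  have \<sigma>in: "\<sigma> i \<in> {1..M}" if "i \<in> {1..M}" for i using perm_in(1)[OF \<sigma> that] .
  have V0: "0 \<le> V v i" if "i \<in> {1..<M}" for i using v0 that by (auto intro!: sum_nonneg)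
  \<comment> \<open>A class that takes no time carries no displacement: the bound holds for every
    slope, and with \<open>v i = 0\<close> a large multiple of \<open>y i\<close> as slope would
    violate it.\<close>
  have y0: "y i = 0" if i: "i \<in> {1..M}" and vi: "v i = 0" for i
  proof -
    have "t * (y i \<bullet> y i) \<le> \<alpha>" if "t > 0" for t
    proof -
      define l where "l j = (if j = i then t *\<^sub>R y i else 0)" for j
      have nn: "0 \<le> l j \<bullet> y j - v j * \<Lambda> (\<zeta> (\<sigma> j)) (l j)" if "j \<in> {1..M} - {i}" for j
        using that v0[of j] \<Lambda>_0[OF \<sigma>in, of j] by (simp add: l_def mult_nonneg_nonpos)
      have "t * (y i \<bullet> y i) = l i \<bullet> y i - v i * \<Lambda> (\<zeta> (\<sigma> i)) (l i)" using vi by (simp add: l_def)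
      also have "\<dots> \<le> (\<Sum>j=1..M. l j \<bullet> y j - v j * \<Lambda> (\<zeta> (\<sigma> j)) (l j))"
        using i nn by (intro member_le_sum) auto
      also have "\<dots> \<le> \<alpha>" using bound[of "\<lambda>_. 0" l] perm_in(2)[OF \<sigma>] by (simp add: zero_ereal_def)
      finally show ?thesis .
    qed
    then have "y i \<bullet> y i \<le> 0" by (rule real_le_if_all_multiples_le)
    then show ?thesis by (metis inner_eq_zero_iff inner_ge_zero order_antisym)
  qed
  define x where "x i = (1 / v i) *\<^sub>R y i" for i
  have x: "v i *\<^sub>R x i = y i" if "i \<in> {1..M}" for i using y0[OF that] by (simp add: x_def)
  have v: "v \<in> prob_vectors M" using v0 v1 by (simp add: prob_vectors_def)
  let ?cI = "\<lambda>i. ereal (v i) * I (\<zeta> (\<sigma> i)) (x i)"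
  let ?cU = "\<lambda>i. ereal (V v i) * - U (\<zeta> (\<sigma> i)) (\<zeta> (\<sigma> (i + 1)))"
  \<comment> \<open>For fixed \<open>u\<close> the suprema over the slopes are replaced by
    minorants, one slope for each class; the bound then holds for the whole sum at once.\<close>
  have sumI: "(\<Sum>i=1..M. ?cI i) \<le> ereal (\<alpha> + (\<Sum>i=1..<M. w i * u i))"
    if u: "\<And>i. i \<in> {1..<M} \<Longrightarrow> U (\<zeta> (\<sigma> i)) (\<zeta> (\<sigma> (i + 1))) \<le> ereal (u i) \<and> u i \<le> 0" for u
  proof (rule ereal_sum_le_if_minorants_le)
    show "0 \<le> ?cI i" if "i \<in> {1..M}" for i using v0[OF that] I_nonneg[OF \<sigma>in[OF that]] by simp
    fix r assume r: "\<And>i. i \<in> {1..M} \<Longrightarrow> ereal (r i) < ?cI i"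
    have "\<exists>l. r i \<le> l \<bullet> y i - v i * \<Lambda> (\<zeta> (\<sigma> i)) l" if i: "i \<in> {1..M}" for i
    proof (cases "v i = 0")
      case True
      then show ?thesis using r[OF i] by (intro exI[of _ 0]) (simp add: zero_ereal_def[symmetric])
    next
      case False
      then have vi: "v i > 0" using v0[OF i] by simp
      have "ereal (r i / v i) < I (\<zeta> (\<sigma> i)) (x i)"
      proof (rule ccontr)
        assume "\<not> ?thesis"
        then have "?cI i \<le> ereal (v i) * ereal (r i / v i)" using vi by (intro ereal_mult_left_mono) auto
        then show False using r[OF i] vi by simp
      qed
      then obtain l where "r i / v i < l \<bullet> x i - \<Lambda> (\<zeta> (\<sigma> i)) l"
        unfolding I_eq[OF \<sigma>in[OF i]] less_SUP_iff by auto
      then have "r i < v i * (l \<bullet> x i - \<Lambda> (\<zeta> (\<sigma> i)) l)" using vi by (simp add: field_simps)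
      also have "\<dots> = l \<bullet> y i - v i * \<Lambda> (\<zeta> (\<sigma> i)) l"
        unfolding x[OF i, symmetric] by (simp add: algebra_simps)
      finally show ?thesis by (intro exI[of _ l]) simp
    qed
    then obtain l where l: "\<And>i. i \<in> {1..M} \<Longrightarrow> r i \<le> l i \<bullet> y i - v i * \<Lambda> (\<zeta> (\<sigma> i)) (l i)" by metis
    have "(\<Sum>i=1..M. r i) \<le> (\<Sum>i=1..M. l i \<bullet> y i - v i * \<Lambda> (\<zeta> (\<sigma> i)) (l i))" using l by (intro sum_mono) auto
    also have "\<dots> \<le> \<alpha> + (\<Sum>i=1..<M. w i * u i)" using bound[of u l] u by simp
    finally show "(\<Sum>i=1..M. r i) \<le> \<alpha> + (\<Sum>i=1..<M. w i * u i)" .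
  qed simp
  have cI0: "0 \<le> (\<Sum>i=1..M. ?cI i)"
    using v0 I_nonneg[OF \<sigma>in] by (intro sum_nonneg) auto
  \<comment> \<open>The choice \<open>u = 0\<close> shows that the rate part is finite; only then
    can it be moved to the other side in the estimate of the jump part.\<close>
  have "(\<Sum>i=1..M. ?cI i) \<le> ereal (\<alpha> + (\<Sum>i=1..<M. w i * 0))"
    by (rule sumI) (use perm_in(2)[OF \<sigma>] in \<open>simp add: zero_ereal_def\<close>)
  then obtain e where e: "(\<Sum>i=1..M. ?cI i) = ereal e"
    using cI0 by (cases "\<Sum>i=1..M. ?cI i") auto
  have "(\<Sum>i=1..<M. ?cU i) \<le> ereal (\<alpha> - e)"
  proof (rule ereal_sum_le_if_minorants_le)
    have U': "0 \<le> - U (\<zeta> (\<sigma> i)) (\<zeta> (\<sigma> (i + 1)))" if "i \<in> {1..<M}" for i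
      using perm_in(2)[OF \<sigma> that] by (simp add: ereal_0_le_uminus_iff)
    show "0 \<le> ?cU i" if "i \<in> {1..<M}" for i
      using V0[OF that] U'[OF that] by (intro ereal_0_le_mult) auto
    fix r assume r: "\<And>i. i \<in> {1..<M} \<Longrightarrow> ereal (r i) < ?cU i"
    have "\<exists>u. (U (\<zeta> (\<sigma> i)) (\<zeta> (\<sigma> (i + 1))) \<le> ereal u \<and> u \<le> 0) \<and> r i \<le> w i * - u" if i: "i \<in> {1..<M}" for i
    proof (cases "r i \<le> 0")
      case True
      then show ?thesis using perm_in(2)[OF \<sigma> i] by (intro exI[of _ 0]) (simp add: zero_ereal_def)
    next
      case False
      \<comment> \<open>As 0 times infinity is 0, a positive minorant excludes the weight 0.\<close>
      have Vp: "V v i > 0"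
      proof (rule ccontr)
        assume "\<not> ?thesis"
        then have "V v i = 0" using V0[OF i] by linarith
        then show False using r[OF i] False by (simp add: zero_ereal_def[symmetric])
      qed
      have "ereal (r i / V v i) < - U (\<zeta> (\<sigma> i)) (\<zeta> (\<sigma> (i + 1)))"
      proof (rule ccontr)
        assume "\<not> ?thesis"
        then have "?cU i \<le> ereal (V v i) * ereal (r i / V v i)" using Vp by (intro ereal_mult_left_mono) auto
        then show False using r[OF i] Vp by simp
      qed
      then have "U (\<zeta> (\<sigma> i)) (\<zeta> (\<sigma> (i + 1))) \<le> ereal (- (r i / V v i))"
        by (metis ereal_less_uminus_reorder less_imp_le uminus_ereal.simps(1))
      moreover have "r i = V v i * (r i / V v i)" using Vp by simp
      \<comment> \<open>Here the larger weight \<open>w i\<close> may replace \<open>V v i\<close>,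
        since the minorant \<open>r i / V v i\<close> of the cost is positive.\<close>
      moreover have "V v i * (r i / V v i) \<le> w i * (r i / V v i)"
        using V[OF i] Vp False by (intro mult_right_mono) auto
      ultimately show ?thesis using Vp False by (intro exI[of _ "- (r i / V v i)"]) auto
    qed
    then obtain u where u: "\<And>i. i \<in> {1..<M} \<Longrightarrow> U (\<zeta> (\<sigma> i)) (\<zeta> (\<sigma> (i + 1))) \<le> ereal (u i) \<and> u i \<le> 0"
      "\<And>i. i \<in> {1..<M} \<Longrightarrow> r i \<le> w i * - u i" by metis
    have "(\<Sum>i=1..<M. r i) \<le> (\<Sum>i=1..<M. w i * - u i)" using u(2) by (intro sum_mono) auto
    also have "\<dots> = - (\<Sum>i=1..<M. w i * u i)" by (simp add: sum_negf)
    also have "\<dots> \<le> \<alpha> - e" using sumI[OF u(1)] e by simp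
    finally show "(\<Sum>i=1..<M. r i) \<le> \<alpha> - e" .
  qed simp
  then have "path_cost M \<zeta> I U v \<sigma> x \<le> ereal (\<alpha> - e) + ereal e"
    unfolding path_cost_eq[OF \<sigma> v] e by (intro add_right_mono)
  then have pc: "path_cost M \<zeta> I U v \<sigma> x \<le> ereal \<alpha>" by simp
  have "x \<in> decompositions M v (\<Sum>i=1..M. y i)" using x by (simp add: decompositions_def)
  then have "J_fun M \<zeta> I U (\<Sum>i=1..M. y i) \<le> (MIN \<sigma>\<in>{\<sigma>. \<sigma> permutes {1..M}}. path_cost M \<zeta> I U v \<sigma> x)"
    unfolding J_fun_def using v by (blast intro: INF_lower2)
  also have "\<dots> \<le> path_cost M \<zeta> I U v \<sigma> x"
    using \<sigma> finite_permutations[of "{1..M}"] by (intro Min_le) auto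
  finally show ?thesis using pc by simp
qed

lemma J_fun_lessE:
  assumes "J_fun M \<zeta> I U z < b"
  obtains v x \<sigma> where "v \<in> prob_vectors M" "\<sigma> permutes {1..M}" "(\<Sum>i=1..M. v i *\<^sub>R x i) = z"
    "path_cost M \<zeta> I U v \<sigma> x < b"
proof -
  obtain v x where v: "v \<in> prob_vectors M" and x: "x \<in> decompositions M v z"
    and m: "(MIN \<sigma>\<in>{\<sigma>. \<sigma> permutes {1..M}}. path_cost M \<zeta> I U v \<sigma> x) < b"
    using assms unfolding J_fun_def by (auto simp: INF_less_iff)
  have "(MIN \<sigma>\<in>{\<sigma>. \<sigma> permutes {1..M}}. path_cost M \<zeta> I U v \<sigma> x) \<in> (\<lambda>\<sigma>. path_cost M \<zeta> I U v \<sigma> x) ` {\<sigma>. \<sigma> permutes {1..M}}"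
    using finite_permutations[of "{1..M}"] by (intro Min_in) (auto intro: permutes_id)
  then show ?thesis using that v x m by (auto simp: decompositions_def)
qed

text \<open>The direction converse to \<open>J_fun_le\<close>: fixed \<open>u\<close> and
  \<open>l\<close> give a lower bound that is continuous in \<open>v\<close> and in the products
  \<open>v i *\<^sub>R x i\<close>, and so passes to limits, unlike the extended-valued cost
  itself.\<close>

lemma path_cost_lower_bound:
  assumes \<sigma>: "\<sigma> permutes {1..M}" and v: "v \<in> prob_vectors M" and cost: "path_cost M \<zeta> I U v \<sigma> x < ereal b"
    and u: "\<And>i. i \<in> {1..<M} \<Longrightarrow> U (\<zeta> (\<sigma> i)) (\<zeta> (\<sigma> (i + 1))) \<le> ereal (u i)"
  shows "- (\<Sum>i=1..<M. V v i * u i) + (\<Sum>i=1..M. l i \<bullet> (v i *\<^sub>R x i) - v i * \<Lambda> (\<zeta> (\<sigma> i)) (l i)) \<le> b"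
proof -
  have v0: "0 \<le> v i" if "i \<in> {1..M}" for i using v that by (simp add: prob_vectors_def)
  have V0: "0 \<le> V v i" if "i \<in> {1..<M}" for i using v0 that by (auto intro!: sum_nonneg)
  have "ereal (- (\<Sum>i=1..<M. V v i * u i)) = (\<Sum>i=1..<M. ereal (V v i) * ereal (- u i))"
    by (simp add: sum_negf)
  also have "\<dots> \<le> (\<Sum>i=1..<M. ereal (V v i) * - U (\<zeta> (\<sigma> i)) (\<zeta> (\<sigma> (i + 1))))"
  proof (intro sum_mono ereal_mult_left_mono)
    fix i assume i: "i \<in> {1..<M}"
    show "ereal (- u i) \<le> - U (\<zeta> (\<sigma> i)) (\<zeta> (\<sigma> (i + 1)))"
      using u[OF i] ereal_minus_le_minus[of "ereal (u i)"] by simp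
    show "0 \<le> ereal (V v i)" using V0[OF i] by simp
  qed
  finally have a: "ereal (- (\<Sum>i=1..<M. V v i * u i)) \<le> (\<Sum>i=1..<M. ereal (V v i) * - U (\<zeta> (\<sigma> i)) (\<zeta> (\<sigma> (i + 1))))" .
  have "ereal (\<Sum>i=1..M. l i \<bullet> (v i *\<^sub>R x i) - v i * \<Lambda> (\<zeta> (\<sigma> i)) (l i))
      = (\<Sum>i=1..M. ereal (v i) * ereal (l i \<bullet> x i - \<Lambda> (\<zeta> (\<sigma> i)) (l i)))"
    by (simp add: algebra_simps)
  also have "\<dots> \<le> (\<Sum>i=1..M. ereal (v i) * I (\<zeta> (\<sigma> i)) (x i))"
  proof (intro sum_mono ereal_mult_left_mono)
    fix i assume i: "i \<in> {1..M}"
    show "ereal (l i \<bullet> x i - \<Lambda> (\<zeta> (\<sigma> i)) (l i)) \<le> I (\<zeta> (\<sigma> i)) (x i)"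
      unfolding I_eq[OF perm_in(1)[OF \<sigma> i]] by (rule SUP_upper) simp
    show "0 \<le> ereal (v i)" using v0[OF i] by simp
  qed
  finally have "ereal (- (\<Sum>i=1..<M. V v i * u i)) + ereal (\<Sum>i=1..M. l i \<bullet> (v i *\<^sub>R x i) - v i * \<Lambda> (\<zeta> (\<sigma> i)) (l i))
     \<le> path_cost M \<zeta> I U v \<sigma> x"
    unfolding path_cost_eq[OF \<sigma> v] using a by (intro add_mono)
  also have "\<dots> < ereal b" by (rule cost)
  finally show ?thesis by simp
qed

lemma path_cost_nonneg:
  assumes \<sigma>: "\<sigma> permutes {1..M}" and v: "v \<in> prob_vectors M"
  shows "0 \<le> path_cost M \<zeta> I U v \<sigma> x"
proof (rule ccontr)
  assume "\<not> ?thesis"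
  then obtain b where b: "path_cost M \<zeta> I U v \<sigma> x < ereal b" "b < 0"
    by (metis ereal_dense2 ereal_less(2) less_ereal.simps(1) not_le zero_ereal_def)
  have "- (\<Sum>i=1..<M. V v i * 0) + (\<Sum>i=1..M. 0 \<bullet> (v i *\<^sub>R x i) - v i * \<Lambda> (\<zeta> (\<sigma> i)) 0) \<le> b"
    by (rule path_cost_lower_bound[OF \<sigma> v b(1)]) (use perm_in(2)[OF \<sigma>] in \<open>simp add: zero_ereal_def\<close>)
  moreover have "(\<Sum>i=1..M. v i * \<Lambda> (\<zeta> (\<sigma> i)) 0) \<le> 0"
    using v \<Lambda>_0[OF perm_in(1)[OF \<sigma>]] by (intro sum_nonpos mult_nonneg_nonpos) (auto simp: prob_vectors_def)
  ultimately show False using b(2) by (simp add: sum_negf)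
qed

lemma J_nonneg: "0 \<le> J_fun M \<zeta> I U z"
proof (rule ccontr)
  assume "\<not> ?thesis"
  then have "J_fun M \<zeta> I U z < 0" by simp
  then show False by (rule J_fun_lessE) (use path_cost_nonneg in \<open>auto simp: not_le[symmetric]\<close>)
qed

text \<open>Slopes \<open>t *\<^sub>R (v i *\<^sub>R x i)\<close> with \<open>t\<close> tending to
  infinity: the cost stays below \<open>b\<close>, so the coefficient of \<open>t\<close>, the
  squared norm minus \<open>v i * \<bar>R\<bar>\<close> times the norm, cannot be positive.\<close>

lemma norm_component_le:
  assumes \<sigma>: "\<sigma> permutes {1..M}" and v: "v \<in> prob_vectors M" and cost: "path_cost M \<zeta> I U v \<sigma> x < ereal b"
    and i: "i \<in> {1..M}"
  shows "norm (v i *\<^sub>R x i) \<le> v i * \<bar>R\<bar>"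
proof -
  have v0: "0 \<le> v i" if "i \<in> {1..M}" for i using v that by (simp add: prob_vectors_def)
  let ?y = "v i *\<^sub>R x i"
  have "t * (norm ?y * (norm ?y - v i * \<bar>R\<bar>)) \<le> b" if t: "t > 0" for t
  proof -
    define l where "l j = (if j = i then t *\<^sub>R ?y else 0)" for j
    have nn: "0 \<le> l j \<bullet> (v j *\<^sub>R x j) - v j * \<Lambda> (\<zeta> (\<sigma> j)) (l j)" if "j \<in> {1..M} - {i}" for j
      using that v0[of j] \<Lambda>_0[OF perm_in(1)[OF \<sigma>], of j] by (simp add: l_def mult_nonneg_nonpos)
    have "\<Lambda> (\<zeta> (\<sigma> i)) (l i) \<le> R * norm (l i)" by (rule \<Lambda>_le[OF perm_in(1)[OF \<sigma> i]])
    also have "\<dots> \<le> \<bar>R\<bar> * norm (l i)" by (intro mult_right_mono) auto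
    also have "norm (l i) = t * norm ?y"
    proof -
      have "l i = t *\<^sub>R ?y" by (simp add: l_def)
      then show ?thesis using t by (simp only: norm_scaleR[of t ?y] abs_of_pos)
    qed
    finally have "v i * \<Lambda> (\<zeta> (\<sigma> i)) (l i) \<le> v i * (\<bar>R\<bar> * (t * norm ?y))" using v0[OF i] by (intro mult_left_mono)
    moreover have "l i \<bullet> ?y = t * (norm ?y * norm ?y)"
    proof -
      have "l i = t *\<^sub>R ?y" by (simp add: l_def)
      then show ?thesis
        by (simp only: inner_scaleR_left[of t ?y] dot_square_norm power2_eq_square)
    qed
    ultimately have "t * (norm ?y * (norm ?y - v i * \<bar>R\<bar>)) \<le> l i \<bullet> ?y - v i * \<Lambda> (\<zeta> (\<sigma> i)) (l i)"
      by (simp only: algebra_simps)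
    also have "\<dots> \<le> (\<Sum>j=1..M. l j \<bullet> (v j *\<^sub>R x j) - v j * \<Lambda> (\<zeta> (\<sigma> j)) (l j))"
      using i nn by (intro member_le_sum[of i]) auto
    also have "\<dots> = - (\<Sum>i=1..<M. V v i * 0) + \<dots>" by simp
    also have "\<dots> \<le> b"
      by (rule path_cost_lower_bound[OF \<sigma> v cost]) (use perm_in(2)[OF \<sigma>] in \<open>simp add: zero_ereal_def\<close>)
    finally show ?thesis .
  qed
  then have "norm ?y * (norm ?y - v i * \<bar>R\<bar>) \<le> 0" by (rule real_le_if_all_multiples_le)
  then have "norm ?y \<le> 0 \<or> norm ?y - v i * \<bar>R\<bar> \<le> 0"
    unfolding mult_le_0_iff by linarith
  moreover have "0 \<le> v i * \<bar>R\<bar>" using v0[OF i] by simp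
  ultimately show ?thesis by linarith
qed

lemma J_level_bounded: "bounded {z. J_fun M \<zeta> I U z \<le> ereal \<alpha>}"
proof (rule boundedI)
  fix z assume "z \<in> {z. J_fun M \<zeta> I U z \<le> ereal \<alpha>}"
  then have "J_fun M \<zeta> I U z < ereal (\<alpha> + 1)" by (auto intro: le_less_trans)
  then obtain v x \<sigma> where h: "v \<in> prob_vectors M" "\<sigma> permutes {1..M}" "(\<Sum>i=1..M. v i *\<^sub>R x i) = z"
    "path_cost M \<zeta> I U v \<sigma> x < ereal (\<alpha> + 1)" by (rule J_fun_lessE)
  have "norm z \<le> (\<Sum>i=1..M. norm (v i *\<^sub>R x i))" unfolding h(3)[symmetric] by (rule norm_sum)
  also have "\<dots> \<le> (\<Sum>i=1..M. v i * \<bar>R\<bar>)" using norm_component_le[OF h(2,1,4)] by (intro sum_mono) auto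
  also have "\<dots> = \<bar>R\<bar>" using h(1) by (simp add: sum_distrib_right[symmetric] prob_vectors_def)
  finally show "norm z \<le> \<bar>R\<bar>" .
qed

text \<open>Near-minimisers \<open>(v, x, \<sigma>)\<close> are followed along a subsequence.
  Permutations are finite in number and \<open>v\<close> stays in a compact set, but
  \<open>x\<close> is uncontrolled where \<open>v\<close> vanishes; the products
  \<open>v i *\<^sub>R x i\<close> are bounded, and \<open>J_fun_le\<close> recovers a decomposition
  from their limits \<open>y\<close>.\<close>

lemma J_level_closed: "closed {z. J_fun M \<zeta> I U z \<le> ereal \<alpha>}"
  unfolding closed_sequential_limits
proof (intro allI impI, elim conjE)
  fix z and z0
  assume z: "\<forall>n. z n \<in> {z. J_fun M \<zeta> I U z \<le> ereal \<alpha>}" and lim: "z \<longlonglongrightarrow> z0"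
  define Q where "Q n t \<longleftrightarrow> (case t of (v, x, \<sigma>) \<Rightarrow> v \<in> prob_vectors M \<and> \<sigma> permutes {1..M} \<and>
    (\<Sum>i=1..M. v i *\<^sub>R x i) = z n \<and> path_cost M \<zeta> I U v \<sigma> x < ereal (\<alpha> + inverse (real (Suc n))))" for n t
  have "\<exists>t. Q n t" for n
  proof -
    have "J_fun M \<zeta> I U (z n) < ereal (\<alpha> + inverse (real (Suc n)))"
      using z by (auto intro: le_less_trans[of _ "ereal \<alpha>"])
    then obtain v x \<sigma> where "v \<in> prob_vectors M" "\<sigma> permutes {1..M}" "(\<Sum>i=1..M. v i *\<^sub>R x i) = z n"
      "path_cost M \<zeta> I U v \<sigma> x < ereal (\<alpha> + inverse (real (Suc n)))" by (rule J_fun_lessE)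
    then show ?thesis by (intro exI[of _ "(v, x, \<sigma>)"]) (simp add: Q_def)
  qed
  then obtain t where t: "\<And>n. Q n (t n)" by metis
  define v x \<sigma> where "v n = fst (t n)" and "x n = fst (snd (t n))" and "\<sigma> n = snd (snd (t n))" for n
  have h: "v n \<in> prob_vectors M" "\<sigma> n permutes {1..M}" "(\<Sum>i=1..M. v n i *\<^sub>R x n i) = z n"
    "path_cost M \<zeta> I U (v n) (\<sigma> n) (x n) < ereal (\<alpha> + inverse (real (Suc n)))" for n
    using t[of n] by (auto simp: Q_def v_def x_def \<sigma>_def split: prod.splits)
  have "finite (range \<sigma>)"
    by (rule finite_subset[OF _ finite_permutations[of "{1..M}"]]) (use h(2) in auto)
  then obtain m where inf: "infinite {n. \<sigma> n = \<sigma> m}"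
    using pigeonhole_infinite[of "UNIV :: nat set" \<sigma>] by auto
  define s where "s = \<sigma> m"
  have s: "s permutes {1..M}" using h(2) by (simp add: s_def)
  have v01: "0 \<le> v n i \<and> v n i \<le> 1" if "i \<in> {1..M}" for n i
  proof -
    have "v n i \<le> (\<Sum>i=1..M. v n i)" using h(1)[of n] that by (intro member_le_sum) (auto simp: prob_vectors_def)
    then show ?thesis using h(1)[of n] that by (simp add: prob_vectors_def)
  qed
  obtain r1 v' where r1: "strict_mono r1" "\<And>k. r1 k \<in> {n. \<sigma> n = \<sigma> m}"
    and v': "\<And>i. i \<in> {1..M} \<Longrightarrow> (\<lambda>k. v (r1 k) i) \<longlonglongrightarrow> v' i"
  proof (rule common_convergent_subsequence[of "{1..M}" "{n. \<sigma> n = \<sigma> m}" "\<lambda>i n. v n i"])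
    show "bounded (range (\<lambda>n. v n i))" if "i \<in> {1..M}" for i
      by (rule boundedI[of _ 1]) (use v01[OF that] in auto)
  qed (use inf in auto)
  obtain r2 y where r2: "strict_mono r2" "\<And>k. r2 k \<in> range r1"
    and y: "\<And>i. i \<in> {1..M} \<Longrightarrow> (\<lambda>k. v (r2 k) i *\<^sub>R x (r2 k) i) \<longlonglongrightarrow> y i"
  proof (rule common_convergent_subsequence[of "{1..M}" "range r1" "\<lambda>i n. v n i *\<^sub>R x n i"])
    show "infinite (range r1)" using r1(1) by (simp add: range_inj_infinite strict_mono_imp_inj_on)
    show "bounded (range (\<lambda>n. v n i *\<^sub>R x n i))" if i: "i \<in> {1..M}" for i
    proof (rule boundedI)
      fix w assume "w \<in> range (\<lambda>n. v n i *\<^sub>R x n i)"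
      then obtain n where w: "w = v n i *\<^sub>R x n i" by blast
      have "norm w \<le> v n i * \<bar>R\<bar>" unfolding w by (rule norm_component_le[OF h(2,1,4) i])
      also have "\<dots> \<le> 1 * \<bar>R\<bar>" using v01[OF i, of n] by (intro mult_right_mono) auto
      finally show "norm w \<le> \<bar>R\<bar>" by simp
    qed
  qed auto
  have "\<exists>q. r2 k = r1 q" for k using r2(2)[of k] by blast
  then obtain q where q: "\<And>k. r2 k = r1 (q k)" by metis
  have "strict_mono q"
    unfolding strict_mono_def
  proof (intro allI impI)
    fix a b :: nat assume "a < b"
    then have "r1 (q a) < r1 (q b)" using strict_monoD[OF r2(1)] q by metis
    then show "q a < q b" using strict_mono_less[OF r1(1)] by blast
  qed
  have v'': "(\<lambda>k. v (r2 k) i) \<longlonglongrightarrow> v' i" if "i \<in> {1..M}" for i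
    using LIMSEQ_subseq_LIMSEQ[OF v'[OF that] \<open>strict_mono q\<close>] q by (simp add: o_def)
  have \<sigma>r: "\<sigma> (r2 k) = s" for k using r1(2) q by (simp add: s_def)
  have "(\<lambda>k. \<Sum>i=1..M. v (r2 k) i *\<^sub>R x (r2 k) i) \<longlonglongrightarrow> (\<Sum>i=1..M. y i)"
    by (intro tendsto_sum y)
  moreover have "(\<lambda>k. \<Sum>i=1..M. v (r2 k) i *\<^sub>R x (r2 k) i) \<longlonglongrightarrow> z0"
    using LIMSEQ_subseq_LIMSEQ[OF lim r2(1)] h(3) by (simp add: o_def)
  ultimately have z0: "z0 = (\<Sum>i=1..M. y i)" by (rule LIMSEQ_unique[symmetric])
  have "J_fun M \<zeta> I U (\<Sum>i=1..M. y i) \<le> ereal \<alpha>"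
  proof (rule J_fun_le[OF s, where v = v' and w = "\<lambda>i. V v' i"])
    show "0 \<le> v' i" if i: "i \<in> {1..M}" for i
      using LIMSEQ_le_const[OF v''[OF i], of 0] v01[OF i] by auto
    have "(\<lambda>k. \<Sum>i=1..M. v (r2 k) i) \<longlonglongrightarrow> (\<Sum>i=1..M. v' i)" by (intro tendsto_sum v'')
    moreover have "(\<Sum>i=1..M. v (r2 k) i) = 1" for k using h(1) by (simp add: prob_vectors_def)
    ultimately show "(\<Sum>i=1..M. v' i) = 1" using LIMSEQ_unique[OF tendsto_const] by fastforce
    show "V v' i \<le> V v' i" for i by simp
    fix l u assume u: "\<And>i. i \<in> {1..<M} \<Longrightarrow> U (\<zeta> (s i)) (\<zeta> (s (i + 1))) \<le> ereal (u i) \<and> u i \<le> 0"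
    let ?c = "\<lambda>k. - (\<Sum>i=1..<M. V (v (r2 k)) i * u i)
      + (\<Sum>i=1..M. l i \<bullet> (v (r2 k) i *\<^sub>R x (r2 k) i) - v (r2 k) i * \<Lambda> (\<zeta> (s i)) (l i))"
    have c: "?c k \<le> \<alpha> + inverse (real (Suc (r2 k)))" for k
      using h[of "r2 k"] u unfolding \<sigma>r by (intro path_cost_lower_bound) auto
    have "?c \<longlonglongrightarrow> - (\<Sum>i=1..<M. V v' i * u i) + (\<Sum>i=1..M. l i \<bullet> y i - v' i * \<Lambda> (\<zeta> (s i)) (l i))"
      by (intro tendsto_intros y v'') auto
    moreover have "(\<lambda>k. \<alpha> + inverse (real (Suc (r2 k)))) \<longlonglongrightarrow> \<alpha> + 0"
      using LIMSEQ_subseq_LIMSEQ[OF LIMSEQ_inverse_real_of_nat r2(1)]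
      by (intro tendsto_add tendsto_const) (simp add: o_def)
    ultimately show "- (\<Sum>i=1..<M. V v' i * u i) + (\<Sum>i=1..M. l i \<bullet> y i - v' i * \<Lambda> (\<zeta> (s i)) (l i)) \<le> \<alpha>"
      using LIMSEQ_le c by fastforce
  qed
  then show "z0 \<in> {z. J_fun M \<zeta> I U z \<le> ereal \<alpha>}" using z0 by simp
qed

lemma good_rate_function_J: "good_rate_function (J_fun M \<zeta> I U)"
  unfolding good_rate_function_def
proof (intro conjI allI)
  show "0 \<le> J_fun M \<zeta> I U z" for z by (rule J_nonneg)
  show "compact {z. J_fun M \<zeta> I U z \<le> ereal \<alpha>}" for \<alpha>
    using J_level_bounded J_level_closed by (simp add: compact_eq_bounded_closed)
  show "lsc (J_fun M \<zeta> I U)"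
    unfolding lsc_def le_Liminf_iff
  proof (intro allI impI)
    fix z and y assume "y < J_fun M \<zeta> I U z"
    then obtain b where b: "y < ereal b" "ereal b < J_fun M \<zeta> I U z" using ereal_dense2 by blast
    have "open (- {z. J_fun M \<zeta> I U z \<le> ereal b})" using J_level_closed by (simp add: open_Compl)
    moreover have "z \<in> - {z. J_fun M \<zeta> I U z \<le> ereal b}" using b by simp
    ultimately have "\<forall>\<^sub>F w in at z. w \<in> - {z. J_fun M \<zeta> I U z \<le> ereal b}"
      by (rule eventually_at_in_open')
    then show "\<forall>\<^sub>F w in at z. y < J_fun M \<zeta> I U w"
      by eventually_elim (use b in auto)
  qed
qed

end

section \<open>The law of the chain on paths\<close>

context
  fixes \<Omega> :: "'w measure" and X :: "nat \<Rightarrow> 'w \<Rightarrow> 's::finite" and \<pi> :: "'s pmf" and P :: "nat \<Rightarrow> 's \<Rightarrow> 's \<Rightarrow> real"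
  assumes chain: "nonhomogeneous_chain \<Omega> X \<pi> P"
begin

lemma chain_prob_space: "prob_space \<Omega>" and chain_measurable: "X n \<in> measurable \<Omega> (count_space UNIV)"
  using chain by (simp_all add: nonhomogeneous_chain_def)

lemma chain_event_sets: "{\<omega> \<in> space \<Omega>. Q (X n \<omega>)} \<in> sets \<Omega>"
  using measurable_sets[OF chain_measurable, of "{x. Q x}" n] by (simp add: vimage_def Int_def conj_commute)

lemma path_event_sets: "{\<omega> \<in> space \<Omega>. X 0 \<omega> = x \<and> (\<forall>k<length ys. X (Suc k) \<omega> = ys ! k)} \<in> sets \<Omega>"
proof -
  have "{\<omega> \<in> space \<Omega>. X 0 \<omega> = x \<and> (\<forall>k<length ys. X (Suc k) \<omega> = ys ! k)}
     = {\<omega> \<in> space \<Omega>. X 0 \<omega> = x} \<inter> {\<omega> \<in> space \<Omega>. \<forall>k\<in>{..<length ys}. X (Suc k) \<omega> = ys ! k}" by auto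
  also have "\<dots> \<in> sets \<Omega>"
    using chain_event_sets[of "\<lambda>a. a = x" 0] by (intro sets.Int sets.sets_Collect_finite_All chain_event_sets) auto
  finally show ?thesis .
qed

lemma prob_path:
  "measure \<Omega> {\<omega> \<in> space \<Omega>. X 0 \<omega> = x \<and> (\<forall>k<length ys. X (Suc k) \<omega> = ys ! k)} = pmf \<pi> x * pathw P 0 x ys"
proof (induction ys rule: rev_induct)
  case Nil
  then show ?case using chain by (simp add: nonhomogeneous_chain_def)
next
  case (snoc y ys)
  interpret prob_space \<Omega> by (rule chain_prob_space)
  define n where "n = length ys"
  define xs where "xs k = (x # ys) ! k" for k
  let ?E = "{\<omega> \<in> space \<Omega>. X 0 \<omega> = x \<and> (\<forall>k<length ys. X (Suc k) \<omega> = ys ! k)}"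
  let ?E' = "{\<omega> \<in> space \<Omega>. X 0 \<omega> = x \<and> (\<forall>k<length (ys @ [y]). X (Suc k) \<omega> = (ys @ [y]) ! k)}"
  have E: "?E = {\<omega> \<in> space \<Omega>. \<forall>k\<le>n. X k \<omega> = xs k}"
    unfolding n_def xs_def less_Suc_eq_le[symmetric] All_less_Suc2 by simp
  have E': "?E' = {\<omega> \<in> space \<Omega>. X (Suc n) \<omega> = y \<and> (\<forall>k\<le>n. X k \<omega> = xs k)}"
    unfolding n_def xs_def less_Suc_eq_le[symmetric] All_less_Suc2
    by (auto simp: less_Suc_eq nth_append)
  have last: "last (x # ys) = xs n" unfolding xs_def n_def by (simp add: last_conv_nth)
  have pw: "pathw P 0 x (ys @ [y]) = pathw P 0 x ys * P (Suc n) (xs n) y"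
    by (simp add: pathw_append n_def[symmetric] last[symmetric])
  show ?case
  proof (cases "prob ?E > 0")
    case True
    have "prob ?E' / prob ?E = P (Suc n) (xs n) y"
      using chain True unfolding nonhomogeneous_chain_def cond_prob_def E E' by blast
    then have "prob ?E' = prob ?E * P (Suc n) (xs n) y" using True by (simp add: field_simps)
    then show ?thesis using snoc pw by simp
  next
    \<comment> \<open>When the past has probability 0 the chain condition says nothing about the
      next step; then both sides are 0, the left by monotonicity, the right by the induction
      hypothesis.\<close>
    case False
    then have "prob ?E = 0" using measure_nonneg[of \<Omega> ?E] by linarith
    moreover have "prob ?E' \<le> prob ?E"
    proof (rule finite_measure_mono[OF _ path_event_sets], intro subsetI CollectI conjI allI impI)
      fix \<omega> k assume w: "\<omega> \<in> ?E'" and k: "k < length ys"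
      then have "X (Suc k) \<omega> = (ys @ [y]) ! k" by simp
      then show "X (Suc k) \<omega> = ys ! k" using k by (simp add: nth_append)
    qed auto
    ultimately have "prob ?E' = 0" using measure_nonneg[of \<Omega> ?E'] by linarith
    moreover have "pmf \<pi> x * pathw P 0 x ys = 0" using snoc \<open>prob ?E = 0\<close> by simp
    ultimately show ?thesis unfolding pw by (metis mult.assoc mult_zero_left)
  qed
qed

lemma prob_eq_sum_paths:
  "measure \<Omega> {\<omega> \<in> space \<Omega>. Q (X 0 \<omega>) (map (\<lambda>k. X (Suc k) \<omega>) [0..<n])}
     = (\<Sum>x\<in>UNIV. pmf \<pi> x * (\<Sum>ys | length ys = n \<and> Q x ys. pathw P 0 x ys))"
proof -
  interpret prob_space \<Omega> by (rule chain_prob_space)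
  let ?E = "\<lambda>(x, ys). {\<omega> \<in> space \<Omega>. X 0 \<omega> = x \<and> (\<forall>k<length ys. X (Suc k) \<omega> = ys ! k)}"
  let ?S = "Sigma (UNIV :: 's set) (\<lambda>x. {ys. length ys = n \<and> Q x ys})"
  have eq: "(\<forall>k<length ys. X (Suc k) \<omega> = ys ! k) \<longleftrightarrow> map (\<lambda>k. X (Suc k) \<omega>) [0..<n] = ys" if "length ys = n" for ys \<omega>
    using that by (auto simp: list_eq_iff_nth_eq)
  have "{\<omega> \<in> space \<Omega>. Q (X 0 \<omega>) (map (\<lambda>k. X (Suc k) \<omega>) [0..<n])} = (\<Union>t\<in>?S. ?E t)"
    using eq by auto
  also have "measure \<Omega> \<dots> = (\<Sum>t\<in>?S. measure \<Omega> (?E t))"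
  proof (rule finite_measure_finite_Union)
    show "finite ?S" by simp
    show "?E ` ?S \<subseteq> sets \<Omega>" using path_event_sets by auto
    show "disjoint_family_on ?E ?S"
      unfolding disjoint_family_on_def using eq by auto
  qed
  also have "\<dots> = (\<Sum>(x, ys)\<in>?S. pmf \<pi> x * pathw P 0 x ys)"
    by (intro sum.cong) (auto simp: prob_path)
  also have "\<dots> = (\<Sum>x\<in>UNIV. pmf \<pi> x * (\<Sum>ys | length ys = n \<and> Q x ys. pathw P 0 x ys))"
    by (simp add: sum.Sigma[symmetric] sum_distrib_left)
  finally show ?thesis .
qed

lemma empirical_mean_eq: "empirical_mean f X n \<omega> = (1 / real n) *\<^sub>R sum_list (map f (map (\<lambda>k. X (Suc k) \<omega>) [0..<n]))"
proof -
  have "(\<Sum>i=1..n. f (X i \<omega>)) = (\<Sum>k=0..<n. f (X (Suc k) \<omega>))"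
    using sum.atLeast1_atMost_eq[of "\<lambda>i. f (X i \<omega>)" n] by (simp add: atLeast0LessThan)
  also have "\<dots> = sum_list (map (\<lambda>k. f (X (Suc k) \<omega>)) [0..<n])"
    by (simp add: interv_sum_list_conv_sum_set_nat)
  finally show ?thesis by (simp add: empirical_mean_def o_def)
qed

lemma prob_empirical_mean:
  "\<P>(\<omega> in \<Omega>. empirical_mean f X n \<omega> \<in> B)
     = (\<Sum>x\<in>UNIV. pmf \<pi> x * (\<Sum>ys | length ys = n \<and> (1 / real n) *\<^sub>R sum_list (map f ys) \<in> B. pathw P 0 x ys))"
  unfolding empirical_mean_eq by (rule prob_eq_sum_paths[where Q = "\<lambda>_ ys. (1 / real n) *\<^sub>R sum_list (map f ys) \<in> B"])

lemma empirical_mean_sets: "{\<omega> \<in> space \<Omega>. empirical_mean f X n \<omega> \<in> B} \<in> sets \<Omega>"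
proof -
  have eq: "{\<omega> \<in> space \<Omega>. empirical_mean f X n \<omega> \<in> B} = (\<Union>ys\<in>{ys. length ys = n \<and> (1 / real n) *\<^sub>R sum_list (map f ys) \<in> B}.
      {\<omega> \<in> space \<Omega>. \<forall>k\<in>{..<n}. X (Suc k) \<omega> = ys ! k})"
  proof -
    have "(\<forall>k\<in>{..<n}. X (Suc k) \<omega> = ys ! k) \<longleftrightarrow> map (\<lambda>k. X (Suc k) \<omega>) [0..<n] = ys" if "length ys = n" for ys \<omega>
      using that by (auto simp: list_eq_iff_nth_eq)
    then show ?thesis unfolding empirical_mean_eq by (auto simp del: map_map)
  qed
  show ?thesis unfolding eq
    by (intro sets.finite_UN finite_lists_length_conj sets.sets_Collect_finite_All chain_event_sets) auto
qed

end

section \<open>Configurations of a path\<close>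

text \<open>Times are counted from 1, so that 0 means that the set is not visited.\<close>

definition last_visit :: "'s set \<Rightarrow> 's list \<Rightarrow> nat" where
  "last_visit A ys = Max (insert 0 {Suc k | k. k < length ys \<and> ys ! k \<in> A})"

lemma finite_visits: "finite (insert 0 {Suc k | k. k < length ys \<and> ys ! k \<in> A})"
proof -
  have "{Suc k | k. k < length ys \<and> ys ! k \<in> A} \<subseteq> {..length ys}" by auto
  then show ?thesis by (simp add: finite_subset)
qed

lemma last_visit_ge: "k < length ys \<Longrightarrow> ys ! k \<in> A \<Longrightarrow> Suc k \<le> last_visit A ys"
  unfolding last_visit_def by (intro Max_ge finite_visits) blast

lemma last_visit_cases: "last_visit A ys = 0 \<or> (\<exists>k. last_visit A ys = Suc k \<and> k < length ys \<and> ys ! k \<in> A)"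
proof -
  have "last_visit A ys \<in> insert 0 {Suc k | k. k < length ys \<and> ys ! k \<in> A}"
    unfolding last_visit_def by (intro Max_in finite_visits) simp
  then show ?thesis by blast
qed

lemma last_visit_le: "last_visit A ys \<le> length ys"
  using last_visit_cases[of A ys] by auto

lemma sum_count_list_eq: "(\<Sum>x\<in>S. count_list ys x) = length (filter (\<lambda>x. x \<in> S) ys)" if "finite S"
proof (induction ys)
  case (Cons y ys)
  have "(\<Sum>x\<in>S. count_list (y # ys) x) = (\<Sum>x\<in>S. (if x = y then 1 else 0) + count_list ys x)"
    by (intro sum.cong) auto
  also have "\<dots> = (if y \<in> S then 1 else 0) + (\<Sum>x\<in>S. count_list ys x)"
    using that by (simp add: sum.distrib)
  finally show ?case using Cons by simp
qed simp

lemma sum_list_map_eq_count: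
  fixes g :: "'s::finite \<Rightarrow> 'v::real_vector"
  shows "sum_list (map g ys) = (\<Sum>x\<in>UNIV. real (count_list ys x) *\<^sub>R g x)"
proof (induction ys)
  case (Cons y ys)
  have "(\<Sum>x\<in>UNIV. real (count_list (y # ys) x) *\<^sub>R g x)
      = (\<Sum>x\<in>UNIV. (if x = y then g x else 0) + real (count_list ys x) *\<^sub>R g x)"
    by (intro sum.cong) (auto simp: algebra_simps)
  then show ?case using Cons by (simp add: sum.distrib)
qed simp

text \<open>Used with \<open>k\<close> the configuration of a path: as there are only polynomially
  many, restricting to one configuration loses no exponential rate.\<close>

lemma exists_large_fiber:
  fixes w :: "'a \<Rightarrow> real"
  assumes "finite Y" "Y \<noteq> {}"
  obtains y where "y \<in> Y" "(\<Sum>z\<in>Y. w z) \<le> real (card (k ` Y)) * (\<Sum>z | z \<in> Y \<and> k z = k y. w z)"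
proof -
  let ?h = "\<lambda>t. \<Sum>z | z \<in> Y \<and> k z = t. w z"
  have "(\<Sum>z\<in>Y. w z) = (\<Sum>t\<in>k ` Y. ?h t)" using assms(1) by (rule sum.image_gen)
  also have "\<dots> \<le> real (card (k ` Y)) * Max (?h ` k ` Y)"
    by (rule sum_bounded_above) (use assms in auto)
  finally have le: "(\<Sum>z\<in>Y. w z) \<le> real (card (k ` Y)) * Max (?h ` k ` Y)" .
  have "Max (?h ` k ` Y) \<in> ?h ` k ` Y" using assms by (intro Max_in) auto
  then obtain y where "y \<in> Y" "Max (?h ` k ` Y) = ?h (k y)" by auto
  with le show ?thesis using that by simp
qed

lemma sorting_permutation:
  fixes L :: "nat \<Rightarrow> nat"
  obtains \<sigma> where "\<sigma> permutes {1..M}" "\<And>i. i \<in> {1..<M} \<Longrightarrow> L (\<sigma> i) \<le> L (\<sigma> (i + 1))"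
proof -
  define xs where "xs = sort_key L [1..<Suc M]"
  have xs: "length xs = M" "distinct xs" "set xs = {1..M}" "sorted (map L xs)"
    by (auto simp: xs_def)
  define \<sigma> where "\<sigma> i = (if i \<in> {1..M} then xs ! (i - 1) else i)" for i
  have "bij_betw (\<lambda>i. i - 1) {1..M} {..<M}"
    by (rule bij_betw_byWitness[of _ Suc]) auto
  moreover have "bij_betw ((!) xs) {..<M} {1..M}" using xs by (intro bij_betw_nth) auto
  ultimately have "bij_betw ((!) xs \<circ> (\<lambda>i. i - 1)) {1..M} {1..M}" by (rule bij_betw_trans)
  then have "bij_betw \<sigma> {1..M} {1..M}"
    by (rule bij_betw_cong[THEN iffD1, rotated]) (simp add: \<sigma>_def)
  then have "\<sigma> permutes {1..M}" by (rule bij_imp_permutes) (auto simp: \<sigma>_def)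
  moreover have "L (\<sigma> i) \<le> L (\<sigma> (i + 1))" if "i \<in> {1..<M}" for i
    using sorted_nth_mono[OF xs(4), of "i - 1" i] that xs(1) by (simp add: \<sigma>_def)
  ultimately show ?thesis by (rule that)
qed

section \<open>The upper bound\<close>

locale ldp_setting = converging_chain P p C K
  for P :: "nat \<Rightarrow> 's::finite \<Rightarrow> 's \<Rightarrow> real" and p C K +
  fixes f :: "'s \<Rightarrow> real ^ 'd" and M :: nat and \<zeta> :: "nat \<Rightarrow> nat"
  assumes enumeration: "bij_betw \<zeta> {1..M} (irreducible_indices p K C)"
begin

abbreviation "G \<equiv> irreducible_indices p K C"

definition \<Lambda> :: "nat \<Rightarrow> real ^ 'd \<Rightarrow> real" where
  "\<Lambda> i l = ln (tilted_eigenvalue p f (C i) l)"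

lemma G_subset: "i \<in> G \<Longrightarrow> i \<in> {1..K}" and G_irreducible: "i \<in> G \<Longrightarrow> irreducible_on (C i) p"
  by (auto simp: irreducible_indices_def)

lemma \<zeta>_in: "i \<in> {1..M} \<Longrightarrow> \<zeta> i \<in> G"
  using enumeration by (rule bij_betw_apply)

lemma \<zeta>_inj: "i \<in> {1..M} \<Longrightarrow> j \<in> {1..M} \<Longrightarrow> \<zeta> i = \<zeta> j \<Longrightarrow> i = j"
  using inj_onD[OF bij_betw_imp_inj_on[OF enumeration]] by blast

lemma permuted_classes:
  assumes \<sigma>: "\<sigma> permutes {1..M}"
  shows "i \<in> {1..M} \<Longrightarrow> \<zeta> (\<sigma> i) \<in> G"
    and "i \<in> {1..M} \<Longrightarrow> j \<in> {1..M} \<Longrightarrow> C (\<zeta> (\<sigma> i)) \<inter> C (\<zeta> (\<sigma> j)) \<noteq> {} \<Longrightarrow> i = j"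
proof -
  have s: "\<sigma> i \<in> {1..M}" if "i \<in> {1..M}" for i using permutes_in_image[OF \<sigma>] that by blast
  show G: "\<zeta> (\<sigma> i) \<in> G" if "i \<in> {1..M}" for i by (rule \<zeta>_in[OF s[OF that]])
  assume ij: "i \<in> {1..M}" "j \<in> {1..M}" and "C (\<zeta> (\<sigma> i)) \<inter> C (\<zeta> (\<sigma> j)) \<noteq> {}"
  then have "\<zeta> (\<sigma> i) = \<zeta> (\<sigma> j)"
    using class_unique[OF G_subset[OF G[OF ij(1)]] G_subset[OF G[OF ij(2)]]] by blast
  then have "\<sigma> i = \<sigma> j" using \<zeta>_inj[OF s[OF ij(1)] s[OF ij(2)]] by blast
  then show "i = j" using injD[OF permutes_inj[OF \<sigma>]] by blast
qed

lemma tilted_eigenvector: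
  assumes i: "i \<in> G"
  obtains u where "tilted_eigenvalue p f (C i) l > 0" "\<And>x. x \<in> C i \<Longrightarrow> u x > 0"
    "\<And>x. x \<in> C i \<Longrightarrow> (\<Sum>y\<in>C i. p x y * exp (l \<bullet> f y) * u y) = tilted_eigenvalue p f (C i) l * u x"
proof -
  let ?A = "\<lambda>x y. p x y * exp (l \<bullet> f y)"
  have nn: "\<forall>x y. 0 \<le> ?A x y" using p_nonneg by simp
  have irr: "irreducible_on (C i) ?A"
    by (rule irreducible_on_same_support[OF G_irreducible[OF i] p_nonneg_all]) (use p_nonneg in \<open>auto simp: zero_less_mult_iff\<close>)
  have ne: "C i \<noteq> {}" using class_nonempty[OF G_subset[OF i]] .
  show ?thesis
  proof (rule PF_eigenvector[OF irr nn ne])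
    fix u assume "PF_eigenvalue (C i) ?A > 0" "\<And>x. x \<in> C i \<Longrightarrow> u x > 0"
      "\<And>x. x \<in> C i \<Longrightarrow> (\<Sum>y\<in>C i. ?A x y * u y) = PF_eigenvalue (C i) ?A * u x"
    then show ?thesis using that[of u] by (simp add: tilted_eigenvalue_def)
  qed
qed

definition R :: real where "R = (\<Sum>x\<in>UNIV. norm (f x))"

lemma norm_f_le: "norm (f x) \<le> R"
  unfolding R_def by (rule member_le_sum) auto

text \<open>At a maximum of the eigenvector the eigenvalue equation bounds the eigenvalue by a row
  sum, and rows of \<open>p\<close> restricted to a class sum to at most 1.\<close>

lemma \<Lambda>_le_norm:
  assumes i: "i \<in> G"
  shows "\<Lambda> i l \<le> R * norm l"
proof (rule tilted_eigenvector[OF i, of l])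
  fix u assume pos: "tilted_eigenvalue p f (C i) l > 0" and u: "\<And>x. x \<in> C i \<Longrightarrow> u x > 0"
    and eig: "\<And>x. x \<in> C i \<Longrightarrow> (\<Sum>y\<in>C i. p x y * exp (l \<bullet> f y) * u y) = tilted_eigenvalue p f (C i) l * u x"
  have ne: "C i \<noteq> {}" using class_nonempty[OF G_subset[OF i]] .
  have "Max (u ` C i) \<in> u ` C i" using ne by (intro Max_in) auto
  then obtain x where x: "x \<in> C i" "u x = Max (u ` C i)" by auto
  then have max: "u y \<le> u x" if "y \<in> C i" for y using that by simp
  have "tilted_eigenvalue p f (C i) l * u x = (\<Sum>y\<in>C i. p x y * exp (l \<bullet> f y) * u y)" using eig x by simp
  also have "\<dots> \<le> (\<Sum>y\<in>C i. p x y * exp (R * norm l) * u x)"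
  proof (intro sum_mono mult_mono mult_left_mono)
    fix y assume y: "y \<in> C i"
    have "l \<bullet> f y \<le> norm l * norm (f y)" by (rule norm_cauchy_schwarz)
    also have "\<dots> \<le> norm l * R" using norm_f_le by (intro mult_left_mono) auto
    finally show "exp (l \<bullet> f y) \<le> exp (R * norm l)" by (simp add: mult.commute)
  qed (use p_nonneg u max in \<open>auto simp: less_imp_le\<close>)
  also have "\<dots> = (\<Sum>y\<in>C i. p x y) * (exp (R * norm l) * u x)" by (simp add: sum_distrib_right mult.assoc)
  also have "\<dots> \<le> 1 * (exp (R * norm l) * u x)"
  proof (rule mult_right_mono)
    have "(\<Sum>y\<in>C i. p x y) \<le> (\<Sum>y\<in>UNIV. p x y)" using p_nonneg by (intro sum_mono2) auto
    then show "(\<Sum>y\<in>C i. p x y) \<le> 1" using stochastic_p by (simp add: stochastic_def)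
    show "0 \<le> exp (R * norm l) * u x" using u[OF x(1)] by simp
  qed
  finally have "tilted_eigenvalue p f (C i) l \<le> exp (R * norm l)" using u[OF x(1)] by simp
  then show ?thesis unfolding \<Lambda>_def using pos by (metis exp_le_cancel_iff exp_ln)
qed

text \<open>From a state of the last class every positive step stays in that class, and a row of
  \<open>p\<close> has a positive entry; so the last class is irreducible.\<close>

lemma M_pos: "M \<ge> 1"
proof -
  have "K \<ge> 1" using cls(1)[of undefined] by simp
  then obtain x where x: "x \<in> C K" using class_nonempty[of K] by fastforce
  have "\<exists>y. p x y > 0"
  proof (rule ccontr)
    assume "\<not> ?thesis"
    then have "(\<Sum>y\<in>UNIV. p x y) \<le> 0" by (intro sum_nonpos) (auto simp: not_less)
    then show False using stochastic_p by (simp add: stochastic_def)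
  qed
  then obtain y where y: "p x y > 0" by blast
  have "cls y = K" using cls_mono[OF y] cls_eq[of K x] x \<open>K \<ge> 1\<close> cls(1)[of y] by simp
  then have "y \<in> C K" using cls(2)[of y] by simp
  then have "K \<in> G" using irreducible_or_zero[of K x y] x y \<open>K \<ge> 1\<close> by (simp add: irreducible_indices_def)
  then have "G \<noteq> {}" by blast
  then have "{1..M} \<noteq> {}" using enumeration by (metis bij_betw_empty1)
  then show ?thesis by simp
qed

lemma class_rate_eq:
  assumes "i \<in> G"
  shows "class_rate p f (C i) x = (SUP l. ereal (l \<bullet> x - \<Lambda> i l))"
proof -
  have "elog (tilted_eigenvalue p f (C i) l) = ereal (\<Lambda> i l)" for l
    by (rule tilted_eigenvector[OF assms, of l]) (simp add: elog_def \<Lambda>_def)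
  then show ?thesis unfolding class_rate_def by simp
qed

sublocale rate_data M \<zeta> "\<lambda>i. class_rate p f (C i)" "U0 K P C" \<Lambda> R
proof
  show "M \<ge> 1" by (rule M_pos)
  show "class_rate p f (C (\<zeta> i)) x = (SUP l. ereal (l \<bullet> x - \<Lambda> (\<zeta> i) l))" if "i \<in> {1..M}" for i x
    by (rule class_rate_eq[OF \<zeta>_in[OF that]])
  show "\<Lambda> (\<zeta> i) l \<le> R * norm l" if "i \<in> {1..M}" for i l by (rule \<Lambda>_le_norm[OF \<zeta>_in[OF that]])
  show "\<Lambda> (\<zeta> i) 0 \<le> 0" if "i \<in> {1..M}" for i using \<Lambda>_le_norm[OF \<zeta>_in[OF that], of 0] by simp
  show "U0 K P C (\<zeta> i) (\<zeta> j) \<le> 0" if "i \<in> {1..M}" "j \<in> {1..M}" "i \<noteq> j" for i j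
    using U0_nonpos[OF G_subset[OF \<zeta>_in[OF that(1)]] G_subset[OF \<zeta>_in[OF that(2)]]] \<zeta>_inj[OF that(1,2)] that(3) by blast
qed

definition tilt :: "(nat \<Rightarrow> real ^ 'd) \<Rightarrow> real \<Rightarrow> 's \<Rightarrow> real" where
  "tilt l \<mu> x = (if cls x \<in> G then l (cls x) \<bullet> f x - \<Lambda> (cls x) (l (cls x)) else \<mu>)"

text \<open>On a degenerate class the tilt is arbitrary, since \<open>p\<close> vanishes there.  Letting \<open>\<mu>\<close> tend to infinity
  shows that a path spends a negligible part of its time in degenerate classes.\<close>

lemma admissible_tilt: "admissible_tilt (tilt l \<mu>)"
proof -
  define Q where "Q i u \<longleftrightarrow> (\<forall>x\<in>C i. u x > 0) \<and>
    (\<forall>x\<in>C i. (\<Sum>y\<in>C i. p x y * exp (l i \<bullet> f y) * u y) = exp (\<Lambda> i (l i)) * u x)" for i u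
  have "\<forall>i. \<exists>u. i \<in> G \<longrightarrow> Q i u"
  proof
    fix i
    show "\<exists>u. i \<in> G \<longrightarrow> Q i u"
    proof (cases "i \<in> G")
      case True
      show ?thesis
      proof (rule tilted_eigenvector[OF True, of "l i"])
        fix u assume "tilted_eigenvalue p f (C i) (l i) > 0" "\<And>x. x \<in> C i \<Longrightarrow> u x > 0"
          "\<And>x. x \<in> C i \<Longrightarrow> (\<Sum>y\<in>C i. p x y * exp (l i \<bullet> f y) * u y) = tilted_eigenvalue p f (C i) (l i) * u x"
        then have "Q i u" by (simp add: Q_def \<Lambda>_def)
        then show ?thesis by blast
      qed
    qed simp
  qed
  then obtain us where us: "\<And>i. i \<in> G \<Longrightarrow> Q i (us i)" using choice[of "\<lambda>i u. i \<in> G \<longrightarrow> Q i u"] by blast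
  define u where "u x = (if cls x \<in> G then us (cls x) x else 1)" for x
  have u: "u x > 0" for x using us[of "cls x"] cls(2)[of x] by (auto simp: u_def Q_def)
  moreover have "(\<Sum>y\<in>C (cls x). p x y * exp (tilt l \<mu> y) * u y) \<le> u x" for x
  proof (cases "cls x \<in> G")
    case True
    let ?i = "cls x"
    have "(\<Sum>y\<in>C ?i. p x y * exp (tilt l \<mu> y) * u y) = (\<Sum>y\<in>C ?i. p x y * exp (l ?i \<bullet> f y) * us ?i y) * exp (- \<Lambda> ?i (l ?i))"
      unfolding sum_distrib_right
    proof (rule sum.cong[OF refl])
      fix y assume "y \<in> C ?i"
      then have "cls y = ?i" using cls_eq cls(1) by blast
      then show "p x y * exp (tilt l \<mu> y) * u y = p x y * exp (l ?i \<bullet> f y) * us ?i y * exp (- \<Lambda> ?i (l ?i))"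
        using True by (simp add: tilt_def u_def exp_diff exp_minus field_simps)
    qed
    also have "(\<Sum>y\<in>C ?i. p x y * exp (l ?i \<bullet> f y) * us ?i y) = exp (\<Lambda> ?i (l ?i)) * us ?i x"
      using us[OF True] cls(2)[of x] by (simp add: Q_def)
    also have "exp (\<Lambda> ?i (l ?i)) * us ?i x * exp (- \<Lambda> ?i (l ?i)) = u x"
      using True by (simp add: u_def exp_minus field_simps)
    finally show ?thesis by simp
  next
    case False
    have "(\<Sum>y\<in>C (cls x). p x y * exp (tilt l \<mu> y) * u y) = (\<Sum>y\<in>C (cls x). 0)"
      by (rule sum.cong[OF refl]) (use degenerate_class(2)[OF cls(1) False cls(2)] in simp)
    then show ?thesis using u[of x] by simp
  qed
  ultimately show ?thesis unfolding admissible_tilt_def by blast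
qed

text \<open>Change of measure: the density of the tilt is constant on the paths with occupation
  counts \<open>N\<close>, so it can be taken out of the sum. The last visits enter only through
  membership at the checkpoint times, and the weight of paths restricted in this way is what
  \<open>checkpoint_bound\<close> estimates.\<close>

lemma config_bound:
  assumes \<sigma>: "\<sigma> permutes {1..M}" and eps: "eps > 0" and \<delta>: "0 < \<delta>" "\<delta> < 1" and B: "B \<ge> 0"
  obtains b where "b > 0"
    "\<And>n L N x. (\<And>i. i \<in> {1..M} \<Longrightarrow> L i \<le> n) \<Longrightarrow>
       (\<And>i. i \<in> {1..<M} \<Longrightarrow> L (\<sigma> i) < L (\<sigma> (i + 1)) \<or> (L (\<sigma> i) = 0 \<and> L (\<sigma> (i + 1)) = 0)) \<Longrightarrow>
       (\<Sum>ys | length ys = n \<and> (\<forall>i\<in>{1..M}. last_visit (C (\<zeta> i)) ys = L i) \<and> count_list ys = N. pathw P 0 x ys)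
         \<le> b * exp (eps * real n)
             * exp (\<Sum>i=1..<M. real (L (\<sigma> i)) * U0_potential \<delta> B (\<zeta> (\<sigma> (i + 1))) (\<zeta> (\<sigma> i)))
             * exp (- (\<Sum>x\<in>UNIV. real (N x) * tilt l \<mu> x))"
proof -
  let ?g = "tilt l \<mu>"
  let ?c = "\<lambda>i. \<zeta> (\<sigma> i)"
  let ?d = "\<lambda>i. U0_potential \<delta> B (?c (i + 1))"
  have \<sigma>in: "\<sigma> i \<in> {1..M}" if "i \<in> {1..M}" for i using perm_in(1)[OF \<sigma> that] .
  have c: "?c i \<in> {1..K}" if "i \<in> {1..M}" for i using G_subset[OF \<zeta>_in[OF \<sigma>in[OF that]]] .
  show ?thesis
  proof (rule checkpoint_bound[OF admissible_tilt[of l \<mu>] eps M_pos, where c = ?c and d = ?d])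
    show "potential (?d i)" if "i \<in> {1..<M}" for i
      using that by (intro potential_U0[OF \<delta> B] c) auto
    show "?d i (?c (i + 1)) = 0" for i by (simp add: U0_potential_def)
    show "?c i \<in> {1..K}" if "i \<in> {1..M}" for i by (rule c[OF that])
    fix b :: real
    assume b: "b > 0" and bound: "\<And>n L D x. (\<And>i. i \<in> {1..M} \<Longrightarrow> L i \<le> n) \<Longrightarrow>
       (\<And>i. i \<in> {1..<M} \<Longrightarrow> L i < L (i + 1) \<or> (L i = 0 \<and> L (i + 1) = 0)) \<Longrightarrow>
       (\<And>i. i \<in> {1..M} \<Longrightarrow> L i \<ge> 1 \<Longrightarrow> D (L i) \<subseteq> C (?c i)) \<Longrightarrow>
       evol (\<lambda>m x y. if y \<in> D m then P m x y * exp (?g y) else 0) n 0 (\<lambda>_. 1) x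
         \<le> b * exp (eps * real n) * exp (\<Sum>i=1..<M. real (L i) * ?d i (?c i))"
    show thesis
    proof (rule that[OF b])
      fix n :: nat and L :: "nat \<Rightarrow> nat" and N :: "'s \<Rightarrow> nat" and x
      assume Ln: "\<And>i. i \<in> {1..M} \<Longrightarrow> L i \<le> n"
        and Ls: "\<And>i. i \<in> {1..<M} \<Longrightarrow> L (\<sigma> i) < L (\<sigma> (i + 1)) \<or> (L (\<sigma> i) = 0 \<and> L (\<sigma> (i + 1)) = 0)"
      \<comment> \<open>At every time that is the last visit of some class, the state is confined to
        that class. A class with \<open>L i = 0\<close> constrains only \<open>D 0\<close>, which no
        step consults.\<close>
      define D where "D m = {y. \<forall>i\<in>{1..M}. L i = m \<longrightarrow> y \<in> C (\<zeta> i)}" for m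
      let ?B = "\<lambda>m x y. if y \<in> D m then P m x y * exp (?g y) else 0"
      let ?S = "{ys. length ys = n \<and> (\<forall>i\<in>{1..M}. last_visit (C (\<zeta> i)) ys = L i) \<and> count_list ys = N}"
      let ?e = "exp (- (\<Sum>x\<in>UNIV. real (N x) * ?g x))"
      have eq: "pathw P 0 x ys = pathw ?B 0 x ys * ?e" if ys: "ys \<in> ?S" for ys
      proof -
        have "ys ! k \<in> D (0 + Suc k)" if k: "k < length ys" for k
          unfolding D_def
        proof (intro CollectI ballI impI)
          fix i assume i: "i \<in> {1..M}" "L i = 0 + Suc k"
          then have "last_visit (C (\<zeta> i)) ys = Suc k" using ys by simp
          then show "ys ! k \<in> C (\<zeta> i)" using last_visit_cases[of "C (\<zeta> i)" ys] by auto
        qed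
        then have "pathw ?B 0 x ys = pathw P 0 x ys * exp (sum_list (map ?g ys))"
          unfolding pathw_restrict pathw_tilt by simp
        moreover have "sum_list (map ?g ys) = (\<Sum>x\<in>UNIV. real (N x) * ?g x)"
          using sum_list_map_eq_count[of ?g ys] ys by simp
        ultimately show ?thesis by (simp add: exp_minus)
      qed
      have B0: "0 \<le> ?B m x y" if "m > 0" for m x y using P_nonneg that by simp
      have "(\<Sum>ys\<in>?S. pathw P 0 x ys) = (\<Sum>ys\<in>?S. pathw ?B 0 x ys) * ?e"
        unfolding sum_distrib_right by (rule sum.cong[OF refl eq])
      also have "\<dots> \<le> (\<Sum>ys | length ys = n. pathw ?B 0 x ys) * ?e"
        using B0 by (intro mult_right_mono sum_mono2 pathw_nonneg) auto
      also have "(\<Sum>ys | length ys = n. pathw ?B 0 x ys) = evol ?B n 0 (\<lambda>_. 1) x"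
        by (simp add: evol_eq_sum)
      also have "\<dots> \<le> b * exp (eps * real n) * exp (\<Sum>i=1..<M. real (L (\<sigma> i)) * ?d i (?c i))"
      proof (rule bound)
        show "L (\<sigma> i) \<le> n" if "i \<in> {1..M}" for i using Ln[OF \<sigma>in[OF that]] .
        show "L (\<sigma> i) < L (\<sigma> (i + 1)) \<or> (L (\<sigma> i) = 0 \<and> L (\<sigma> (i + 1)) = 0)" if "i \<in> {1..<M}" for i
          using Ls[OF that] .
        show "D (L (\<sigma> i)) \<subseteq> C (?c i)" if "i \<in> {1..M}" for i using \<sigma>in[OF that] by (auto simp: D_def)
      qed
      finally show "(\<Sum>ys\<in>?S. pathw P 0 x ys) \<le> b * exp (eps * real n)
             * exp (\<Sum>i=1..<M. real (L (\<sigma> i)) * ?d i (?c i)) * ?e" by simp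
    qed
  qed
qed

section \<open>Counting configurations and choosing a heavy one\<close>

definition config :: "'s list \<Rightarrow> (nat \<Rightarrow> nat) \<times> ('s \<Rightarrow> nat)" where
  "config ys = ((\<lambda>i\<in>{1..M}. last_visit (C (\<zeta> i)) ys), count_list ys)"

lemma card_configs_le: "real (card (config ` {ys. length ys = n \<and> Q ys})) \<le> (real n + 1) ^ (M + CARD('s))"
proof -
  let ?T = "({1..M} \<rightarrow>\<^sub>E {..n}) \<times> ((UNIV :: 's set) \<rightarrow>\<^sub>E {..n})"
  have "config ` {ys. length ys = n \<and> Q ys} \<subseteq> ?T"
  proof
    fix t assume "t \<in> config ` {ys. length ys = n \<and> Q ys}"
    then obtain ys where ys: "length ys = n" "t = config ys" by blast
    have "last_visit A ys \<le> n" for A using last_visit_le[of A ys] ys by simp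
    moreover have "count_list ys x \<le> n" for x using count_le_length[of ys x] ys by simp
    ultimately show "t \<in> ?T" by (auto simp: ys(2) config_def)
  qed
  then have "card (config ` {ys. length ys = n \<and> Q ys}) \<le> card ?T"
    by (intro card_mono) (auto intro!: finite_PiE)
  also have "card ?T = (n + 1) ^ (M + CARD('s))"
    by (simp add: card_cartesian_product card_PiE power_add)
  finally have "real (card (config ` {ys. length ys = n \<and> Q ys})) \<le> real ((n + 1) ^ (M + CARD('s)))"
    by (rule of_nat_mono)
  then show ?thesis by (simp add: add.commute)
qed

text \<open>Every visit to one of the first \<open>i\<close> classes comes no later than the last
  visit to the \<open>i\<close>-th, and visits to disjoint classes occupy different times; so the
  visits inject into the times up to that one.\<close>

lemma class_time_le_last_visit:
  assumes \<sigma>: "\<sigma> permutes {1..M}" and i: "i \<in> {1..M}"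
    and mono: "\<And>j. j \<in> {1..i} \<Longrightarrow> last_visit (C (\<zeta> (\<sigma> j))) ys \<le> last_visit (C (\<zeta> (\<sigma> i))) ys"
  shows "(\<Sum>j=1..i. \<Sum>x\<in>C (\<zeta> (\<sigma> j)). count_list ys x) \<le> last_visit (C (\<zeta> (\<sigma> i))) ys"
proof -
  let ?A = "\<Union>j\<in>{1..i}. C (\<zeta> (\<sigma> j))"
  have "(\<Sum>j=1..i. \<Sum>x\<in>C (\<zeta> (\<sigma> j)). count_list ys x) = (\<Sum>x\<in>?A. count_list ys x)"
  proof (rule sum.UNION_disjoint[symmetric])
    show "\<forall>j\<in>{1..i}. \<forall>k\<in>{1..i}. j \<noteq> k \<longrightarrow> C (\<zeta> (\<sigma> j)) \<inter> C (\<zeta> (\<sigma> k)) = {}"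
    proof (intro ballI impI)
      fix j k assume "j \<in> {1..i}" "k \<in> {1..i}" "j \<noteq> k"
      then show "C (\<zeta> (\<sigma> j)) \<inter> C (\<zeta> (\<sigma> k)) = {}" using permuted_classes(2)[OF \<sigma>, of j k] i by auto
    qed
  qed auto
  also have "\<dots> = card {k. k < length ys \<and> ys ! k \<in> ?A}"
    by (simp add: sum_count_list_eq length_filter_conv_card)
  also have "\<dots> \<le> card {..<last_visit (C (\<zeta> (\<sigma> i))) ys}"
  proof (intro card_mono subsetI)
    fix k assume "k \<in> {k. k < length ys \<and> ys ! k \<in> ?A}"
    then obtain j where j: "j \<in> {1..i}" "k < length ys" "ys ! k \<in> C (\<zeta> (\<sigma> j))" by blast
    then have "Suc k \<le> last_visit (C (\<zeta> (\<sigma> j))) ys" by (intro last_visit_ge)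
    then show "k \<in> {..<last_visit (C (\<zeta> (\<sigma> i))) ys}" using mono[OF j(1)] by simp
  qed simp
  finally show ?thesis by simp
qed

abbreviation J :: "real ^ 'd \<Rightarrow> ereal" where
  "J \<equiv> J_fun M \<zeta> (\<lambda>i. class_rate p f (C i)) (U0 K P C)"

lemma sum_over_classes:
  fixes h :: "'s \<Rightarrow> 'v::comm_monoid_add"
  assumes \<sigma>: "\<sigma> permutes {1..M}"
  shows "(\<Sum>i=1..M. \<Sum>x\<in>C (\<zeta> (\<sigma> i)). h x) = (\<Sum>x | cls x \<in> G. h x)"
proof -
  have K: "\<zeta> (\<sigma> i) \<in> {1..K}" if "i \<in> {1..M}" for i using G_subset[OF permuted_classes(1)[OF \<sigma> that]] .
  have "(\<Union>i\<in>{1..M}. C (\<zeta> (\<sigma> i))) = {x. cls x \<in> G}"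
  proof (intro equalityI subsetI)
    fix x assume "x \<in> (\<Union>i\<in>{1..M}. C (\<zeta> (\<sigma> i)))"
    then obtain i where i: "i \<in> {1..M}" "x \<in> C (\<zeta> (\<sigma> i))" by blast
    then have "cls x = \<zeta> (\<sigma> i)" using cls_eq[OF K] by blast
    then show "x \<in> {x. cls x \<in> G}" using permuted_classes(1)[OF \<sigma> i(1)] by simp
  next
    fix x assume "x \<in> {x. cls x \<in> G}"
    then have "cls x \<in> \<zeta> ` {1..M}" using enumeration by (simp add: bij_betw_def)
    then obtain j where j: "j \<in> {1..M}" "cls x = \<zeta> j" by blast
    have "j \<in> \<sigma> ` {1..M}" using permutes_image[OF \<sigma>] j(1) by simp
    then obtain i where "i \<in> {1..M}" "j = \<sigma> i" by blast
    then show "x \<in> (\<Union>i\<in>{1..M}. C (\<zeta> (\<sigma> i)))" using j cls(2)[of x] by auto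
  qed
  moreover have "(\<Sum>x\<in>(\<Union>i\<in>{1..M}. C (\<zeta> (\<sigma> i))). h x) = (\<Sum>i=1..M. \<Sum>x\<in>C (\<zeta> (\<sigma> i)). h x)"
  proof (rule sum.UNION_disjoint)
    show "\<forall>i\<in>{1..M}. \<forall>j\<in>{1..M}. i \<noteq> j \<longrightarrow> C (\<zeta> (\<sigma> i)) \<inter> C (\<zeta> (\<sigma> j)) = {}"
      using permuted_classes(2)[OF \<sigma>] by blast
  qed auto
  ultimately show ?thesis by simp
qed

text \<open>Different classes are disjoint, so two positive last visit times cannot coincide; a tie
  means that neither class is visited. This is the form of order that
  \<open>checkpoint_bound\<close> asks for.\<close>

lemma visits_sorted:
  assumes \<sigma>: "\<sigma> permutes {1..M}" and i: "i \<in> {1..<M}"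
    and le: "last_visit (C (\<zeta> (\<sigma> i))) ys \<le> last_visit (C (\<zeta> (\<sigma> (i + 1)))) ys"
  shows "last_visit (C (\<zeta> (\<sigma> i))) ys < last_visit (C (\<zeta> (\<sigma> (i + 1)))) ys \<or>
    (last_visit (C (\<zeta> (\<sigma> i))) ys = 0 \<and> last_visit (C (\<zeta> (\<sigma> (i + 1)))) ys = 0)"
    (is "?a < ?b \<or> _")
proof (rule ccontr)
  assume "\<not> ?thesis"
  then have eq: "?a = ?b" "?a \<noteq> 0" using le by auto
  obtain k where k: "?a = Suc k" "ys ! k \<in> C (\<zeta> (\<sigma> i))" using last_visit_cases[of "C (\<zeta> (\<sigma> i))" ys] eq by auto
  obtain m where m: "?b = Suc m" "ys ! m \<in> C (\<zeta> (\<sigma> (i + 1)))" using last_visit_cases[of "C (\<zeta> (\<sigma> (i + 1)))" ys] eq by auto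
  have "k = m" using k m eq by simp
  then have "i = i + 1" using permuted_classes(2)[OF \<sigma>, of i "i + 1"] k(2) m(2) i by auto
  then show False by simp
qed

text \<open>The average over the initial state is at most the largest of its values, which fixes
  \<open>x\<close>; the pigeonhole principle then fixes the configuration. The path
  \<open>ys\<close> is kept as a witness that the configuration is compatible with
  \<open>Q\<close>.\<close>

lemma exists_heavy_config:
  fixes w :: "'s \<Rightarrow> real" and Q :: "'s list \<Rightarrow> bool"
  assumes w: "\<And>x. 0 \<le> w x" "(\<Sum>x\<in>UNIV. w x) = 1"
    and lb: "c \<le> (\<Sum>x\<in>UNIV. w x * (\<Sum>ys | length ys = n \<and> Q ys. pathw P 0 x ys))" and c: "c > 0"
  obtains x ys where "length ys = n" "Q ys"
    "c \<le> (real n + 1) ^ (M + CARD('s)) *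
       (\<Sum>zs | length zs = n \<and> (\<forall>i\<in>{1..M}. last_visit (C (\<zeta> i)) zs = last_visit (C (\<zeta> i)) ys) \<and>
          count_list zs = count_list ys. pathw P 0 x zs)"
proof -
  let ?Y = "{ys. length ys = n \<and> Q ys}"
  let ?S = "\<lambda>x. \<Sum>ys\<in>?Y. pathw P 0 x ys"
  have pw0: "0 \<le> pathw P 0 x ys" for x ys using P_nonneg by (intro pathw_nonneg) auto
  have "Max (range ?S) \<in> range ?S" by (intro Max_in) auto
  then obtain x where x: "?S x = Max (range ?S)" by (metis (no_types, lifting) imageE)
  have "?S y \<le> ?S x" for y unfolding x by (rule Max_ge) auto
  then have "c \<le> (\<Sum>y\<in>UNIV. w y * ?S x)"
    by (rule order_trans[OF lb sum_mono[OF mult_left_mono[OF _ w(1)]]])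
  also have "\<dots> = ?S x" using w(2) by (simp add: sum_distrib_right[symmetric])
  finally have cS: "c \<le> ?S x" .
  have "?Y \<noteq> {}"
  proof
    assume "?Y = {}"
    then have "?S x = 0" by (simp only: sum.empty)
    then show False using cS c by linarith
  qed
  from exists_large_fiber[OF finite_lists_length_conj this, of "pathw P 0 x" config]
  obtain ys where ys: "ys \<in> ?Y"
    "?S x \<le> real (card (config ` ?Y)) * (\<Sum>zs | zs \<in> ?Y \<and> config zs = config ys. pathw P 0 x zs)" .
  let ?T = "{zs. length zs = n \<and> (\<forall>i\<in>{1..M}. last_visit (C (\<zeta> i)) zs = last_visit (C (\<zeta> i)) ys) \<and> count_list zs = count_list ys}"
  have "(\<Sum>zs | zs \<in> ?Y \<and> config zs = config ys. pathw P 0 x zs) \<le> (\<Sum>zs\<in>?T. pathw P 0 x zs)"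
  proof (rule sum_mono2)
    show "{zs. zs \<in> ?Y \<and> config zs = config ys} \<subseteq> ?T"
    proof
      fix zs assume zs: "zs \<in> {zs. zs \<in> ?Y \<and> config zs = config ys}"
      then have e: "(\<lambda>i\<in>{1..M}. last_visit (C (\<zeta> i)) zs) = (\<lambda>i\<in>{1..M}. last_visit (C (\<zeta> i)) ys)"
        and "count_list zs = count_list ys" by (auto simp: config_def)
      moreover have "last_visit (C (\<zeta> i)) zs = last_visit (C (\<zeta> i)) ys" if "i \<in> {1..M}" for i
        using fun_cong[OF e, of i] that by simp
      ultimately show "zs \<in> ?T" using zs by blast
    qed
  qed (use pw0 in auto)
  then have "real (card (config ` ?Y)) * (\<Sum>zs | zs \<in> ?Y \<and> config zs = config ys. pathw P 0 x zs)
      \<le> (real n + 1) ^ (M + CARD('s)) * (\<Sum>zs\<in>?T. pathw P 0 x zs)"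
    using card_configs_le[of n Q] pw0 by (intro mult_mono sum_nonneg) auto
  then show ?thesis using that[of ys x] ys cS by simp
qed

lemma U0_potential_le:
  assumes "i \<in> {1..K}" "t \<in> {1..K}" "i \<noteq> t" "\<delta> < 1" "U0 K P C i t \<le> ereal u" "- B \<le> u"
  shows "U0_potential \<delta> B t i \<le> (1 - \<delta>) * u"
proof -
  have le: "max (U0 K P C i t) (ereal (- B)) \<le> ereal u" using assms by simp
  have ge: "ereal (- B) \<le> max (U0 K P C i t) (ereal (- B))" by simp
  have "real_of_ereal (max (U0 K P C i t) (ereal (- B))) \<le> u"
    using le ge by (cases "max (U0 K P C i t) (ereal (- B))") auto
  then show ?thesis using assms by (simp add: U0_potential_def mult_left_mono)
qed

text \<open>Compactness: a heavy configuration is chosen for every \<open>n\<close> in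
  \<open>I\<close>, and the fractions of time in the states and of the last visits converge along a
  subsequence on which the order of the classes is constant. The limit mean lies in \<open>F\<close>
  because \<open>F\<close> is closed, and the duality in \<open>J_fun_le\<close> turns the family of
  tilted bounds into one for \<open>J\<close>.\<close>

lemma upper_bound_point:
  fixes w :: "'s \<Rightarrow> real"
  assumes w: "\<And>x. 0 \<le> w x" "(\<Sum>x\<in>UNIV. w x) = 1" and F: "closed F"
    and I: "infinite I" "\<And>n. n \<in> I \<Longrightarrow> n \<ge> 1"
    and lb: "\<And>n. n \<in> I \<Longrightarrow> exp (real n * a) \<le>
      (\<Sum>x\<in>UNIV. w x * (\<Sum>ys | length ys = n \<and> (1 / real n) *\<^sub>R sum_list (map f ys) \<in> F. pathw P 0 x ys))"
  shows "\<exists>z\<in>F. J z \<le> ereal (- a)"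
proof -
  define dim where "dim = M + CARD('s)"
  define lv where "lv ys i = last_visit (C (\<zeta> i)) ys" for ys i
  define W where "W n x ys = (\<Sum>zs | length zs = n \<and> (\<forall>i\<in>{1..M}. last_visit (C (\<zeta> i)) zs = lv ys i) \<and>
          count_list zs = count_list ys. pathw P 0 x zs)" for n x ys
  define Q where "Q n t \<longleftrightarrow> (case t of (x, ys, \<sigma>) \<Rightarrow> length ys = n \<and> (1 / real n) *\<^sub>R sum_list (map f ys) \<in> F \<and>
    \<sigma> permutes {1..M} \<and> (\<forall>i\<in>{1..<M}. lv ys (\<sigma> i) \<le> lv ys (\<sigma> (i + 1))) \<and>
    exp (real n * a) \<le> (real n + 1) ^ dim * W n x ys)" for n t
  have "\<exists>t. n \<in> I \<longrightarrow> Q n t" for n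
  proof (cases "n \<in> I")
    case True
    show ?thesis
    proof (rule exists_heavy_config[OF w lb[OF True]])
      fix x ys assume ys: "length ys = n" "(1 / real n) *\<^sub>R sum_list (map f ys) \<in> F"
        "exp (real n * a) \<le> (real n + 1) ^ (M + CARD('s)) *
       (\<Sum>zs | length zs = n \<and> (\<forall>i\<in>{1..M}. last_visit (C (\<zeta> i)) zs = last_visit (C (\<zeta> i)) ys) \<and>
          count_list zs = count_list ys. pathw P 0 x zs)"
      obtain \<sigma> where "\<sigma> permutes {1..M}" "\<And>i. i \<in> {1..<M} \<Longrightarrow> lv ys (\<sigma> i) \<le> lv ys (\<sigma> (i + 1))"
        using sorting_permutation by blast
      then have "Q n (x, ys, \<sigma>)" using ys by (simp add: Q_def W_def lv_def dim_def)
      then show ?thesis by blast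
    qed simp
  qed simp
  then obtain t where t: "\<And>n. n \<in> I \<Longrightarrow> Q n (t n)" by metis
  define x ys \<sigma> where "x n = fst (t n)" and "ys n = fst (snd (t n))" and "\<sigma> n = snd (snd (t n))" for n
  have h: "length (ys n) = n" "(1 / real n) *\<^sub>R sum_list (map f (ys n)) \<in> F" "\<sigma> n permutes {1..M}"
    "\<And>i. i \<in> {1..<M} \<Longrightarrow> lv (ys n) (\<sigma> n i) \<le> lv (ys n) (\<sigma> n (i + 1))"
    "exp (real n * a) \<le> (real n + 1) ^ dim * W n (x n) (ys n)" if "n \<in> I" for n
    using t[OF that] by (auto simp: Q_def x_def ys_def \<sigma>_def split: prod.splits)
  have "finite (\<sigma> ` I)"
    by (rule finite_subset[OF _ finite_permutations[of "{1..M}"]]) (use h(3) in auto)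
  then obtain m where m: "m \<in> I" and inf: "infinite {n \<in> I. \<sigma> n = \<sigma> m}"
    using pigeonhole_infinite[OF I(1), of \<sigma>] by blast
  define s where "s = \<sigma> m"
  have s: "s permutes {1..M}" using h(3)[OF m] by (simp add: s_def)
  \<comment> \<open>The last visits and the occupation counts, divided by \<open>n\<close>, form one
    finite family over a sum type, so that a single subsequence serves all; outside \<open>I\<close>
    the value 0 keeps the family bounded.\<close>
  define as where "as j n = (if n \<in> I then (case j of Inl i \<Rightarrow> real (lv (ys n) i) / real n
    | Inr y \<Rightarrow> real (count_list (ys n) y) / real n) else 0)" for j n
  have as01: "0 \<le> as j n \<and> as j n \<le> 1" for j n
  proof (cases "n \<in> I")
    case True
    have n: "n \<ge> 1" using I(2)[OF True] .
    show ?thesis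
    proof (cases j)
      case (Inl i)
      have "lv (ys n) i \<le> n" using last_visit_le[of "C (\<zeta> i)" "ys n"] h(1)[OF True] by (simp add: lv_def)
      then show ?thesis using Inl True n by (simp add: as_def)
    next
      case (Inr y)
      have "count_list (ys n) y \<le> n" using count_le_length[of "ys n" y] h(1)[OF True] by simp
      then show ?thesis using Inr True n by (simp add: as_def)
    qed
  qed (simp add: as_def)
  have bdd: "bounded (range (as j))" for j
    by (rule boundedI[of _ 1]) (use as01[of j] in auto)
  have fin: "finite (Inl ` {1..M} \<union> range (Inr :: 's \<Rightarrow> nat + 's))" by simp
  obtain r lim where r: "strict_mono r" "\<And>k. r k \<in> {n \<in> I. \<sigma> n = \<sigma> m}"
    and lim: "\<And>j. j \<in> Inl ` {1..M} \<union> range Inr \<Longrightarrow> (\<lambda>k. as j (r k)) \<longlonglongrightarrow> lim j"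
    by (rule common_convergent_subsequence[OF fin inf, where a = as]) (use bdd in auto)
  define ell where "ell i = lim (Inl i)" for i
  define nu where "nu y = lim (Inr y)" for y
  have rI: "r k \<in> I" and \<sigma>r: "\<sigma> (r k) = s" for k using r(2)[of k] by (auto simp: s_def)
  have r1: "r k \<ge> 1" for k using I(2)[OF rI] .
  have ell: "(\<lambda>k. real (lv (ys (r k)) i) / real (r k)) \<longlonglongrightarrow> ell i" if "i \<in> {1..M}" for i
    using lim[of "Inl i"] that rI by (simp add: as_def ell_def)
  have nu: "(\<lambda>k. real (count_list (ys (r k)) y) / real (r k)) \<longlonglongrightarrow> nu y" for y
    using lim[of "Inr y"] rI by (simp add: as_def nu_def)
  have nu0: "nu y \<ge> 0" for y by (rule LIMSEQ_le_const[OF nu]) auto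
  have s_in: "s i \<in> {1..M}" if "i \<in> {1..M}" for i using perm_in(1)[OF s that] .
  have ell0: "ell i \<ge> 0" if "i \<in> {1..M}" for i by (rule LIMSEQ_le_const[OF ell[OF that]]) auto
  \<comment> \<open>The bound for one configuration, after logarithms and division by
    \<open>n\<close>, in the limit along \<open>r\<close>. It holds for all tilts simultaneously,
    because neither the subsequence nor the limits depend on \<open>l\<close>, \<open>\<mu>\<close>,
    \<open>\<delta>\<close> or \<open>B\<close>.\<close>
  have key: "a \<le> eps + (\<Sum>i=1..<M. ell (s i) * U0_potential \<delta> B (\<zeta> (s (i + 1))) (\<zeta> (s i)))
      - (\<Sum>y\<in>UNIV. nu y * tilt l \<mu> y)"
    if eps: "eps > 0" and \<delta>: "0 < \<delta>" "\<delta> < 1" and B: "B \<ge> 0" for eps \<delta> B l \<mu>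
  proof (rule config_bound[OF s eps \<delta> B, of l \<mu>])
    fix b :: real
    let ?d = "\<lambda>i. U0_potential \<delta> B (\<zeta> (s (i + 1))) (\<zeta> (s i))"
    assume b: "b > 0" and bound: "\<And>n L N x. (\<And>i. i \<in> {1..M} \<Longrightarrow> L i \<le> n) \<Longrightarrow>
       (\<And>i. i \<in> {1..<M} \<Longrightarrow> L (s i) < L (s (i + 1)) \<or> (L (s i) = 0 \<and> L (s (i + 1)) = 0)) \<Longrightarrow>
       (\<Sum>ys | length ys = n \<and> (\<forall>i\<in>{1..M}. last_visit (C (\<zeta> i)) ys = L i) \<and> count_list ys = N. pathw P 0 x ys)
         \<le> b * exp (eps * real n) * exp (\<Sum>i=1..<M. real (L (s i)) * ?d i) * exp (- (\<Sum>x\<in>UNIV. real (N x) * tilt l \<mu> x))"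
    define rhs where "rhs n = real dim * (ln 2 / real n + ln (real n) / real n) + ln b / real n + eps
        + (\<Sum>i=1..<M. real (lv (ys n) (s i)) / real n * ?d i) - (\<Sum>y\<in>UNIV. real (count_list (ys n) y) / real n * tilt l \<mu> y)" for n
    have le: "a \<le> rhs (r k)" for k
    proof -
      let ?n = "r k"
      let ?S1 = "\<Sum>i=1..<M. real (lv (ys ?n) (s i)) * ?d i"
      let ?S2 = "\<Sum>y\<in>UNIV. real (count_list (ys ?n) y) * tilt l \<mu> y"
      have n: "real ?n \<ge> 1" using r1[of k] by simp
      have "W ?n (x ?n) (ys ?n) \<le> b * exp (eps * real ?n) * exp ?S1 * exp (- ?S2)"
        unfolding W_def
      proof (rule bound)
        show "lv (ys ?n) i \<le> ?n" for i
          using last_visit_le[of "C (\<zeta> i)" "ys ?n"] h(1)[OF rI] by (simp add: lv_def)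
        show "lv (ys ?n) (s i) < lv (ys ?n) (s (i + 1)) \<or> (lv (ys ?n) (s i) = 0 \<and> lv (ys ?n) (s (i + 1)) = 0)"
          if i: "i \<in> {1..<M}" for i
          using visits_sorted[OF s i, of "ys ?n"] h(4)[OF rI i, of k] unfolding \<sigma>r lv_def by blast
      qed
      then have "(real ?n + 1) ^ dim * W ?n (x ?n) (ys ?n) \<le> (2 * real ?n) ^ dim * (b * exp (eps * real ?n) * exp ?S1 * exp (- ?S2))"
        using n b by (intro mult_mono power_mono) (auto simp: W_def intro!: sum_nonneg pathw_nonneg P_nonneg)
      with h(5)[OF rI, of k]
      have "exp (real ?n * a) \<le> (2 * real ?n) ^ dim * (b * exp (eps * real ?n) * exp ?S1 * exp (- ?S2))" by linarith
      then have "ln (exp (real ?n * a)) \<le> ln ((2 * real ?n) ^ dim * (b * exp (eps * real ?n) * exp ?S1 * exp (- ?S2)))"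
        by (intro ln_mono) auto
      then have "real ?n * a \<le> real dim * (ln 2 + ln (real ?n)) + ln b + eps * real ?n + ?S1 - ?S2"
        using n b by (simp add: ln_mult ln_realpow algebra_simps)
      then have "real ?n * a / real ?n \<le> (real dim * (ln 2 + ln (real ?n)) + ln b + eps * real ?n + ?S1 - ?S2) / real ?n"
        using n by (intro divide_right_mono) auto
      also have "\<dots> = rhs ?n"
        using n unfolding rhs_def add_divide_distrib diff_divide_distrib sum_divide_distrib
        by (simp add: add_divide_distrib[symmetric])
      finally show ?thesis using n by simp
    qed
    have z: "(\<lambda>k. c / real (r k)) \<longlonglongrightarrow> 0" for c :: real
      using LIMSEQ_subseq_LIMSEQ[OF lim_const_over_n[of c] r(1)] by (simp add: o_def)
    have zl: "(\<lambda>k. ln (real (r k)) / real (r k)) \<longlonglongrightarrow> 0"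
      using LIMSEQ_subseq_LIMSEQ[OF lim_ln_over_n r(1)] by (simp add: o_def)
    have "(\<lambda>k. rhs (r k)) \<longlonglongrightarrow> real dim * (0 + 0) + 0 + eps + (\<Sum>i=1..<M. ell (s i) * ?d i) - (\<Sum>y\<in>UNIV. nu y * tilt l \<mu> y)"
      unfolding rhs_def
      by (intro tendsto_diff tendsto_add tendsto_mult tendsto_sum tendsto_const z zl nu ell s_in) auto
    then show "a \<le> eps + (\<Sum>i=1..<M. ell (s i) * ?d i) - (\<Sum>y\<in>UNIV. nu y * tilt l \<mu> y)"
      using LIMSEQ_le_const[of "\<lambda>k. rhs (r k)" _ a] le by simp
  qed
  \<comment> \<open>\<open>B\<close> is taken above all \<open>\<bar>u i\<bar>\<close>, so that
    truncation does not interfere; then \<open>eps = \<delta>\<close> tends to 0.\<close>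
  have key': "a \<le> (\<Sum>i=1..<M. ell (s i) * u i) - (\<Sum>y\<in>UNIV. nu y * tilt l \<mu> y)"
    if u: "\<And>i. i \<in> {1..<M} \<Longrightarrow> U0 K P C (\<zeta> (s i)) (\<zeta> (s (i + 1))) \<le> ereal (u i)" for u l \<mu>
  proof (rule le_of_le_add_small)
    fix \<delta> :: real assume \<delta>: "0 < \<delta>" "\<delta> < 1"
    define B where "B = (\<Sum>i=1..<M. \<bar>u i\<bar>)"
    have B: "B \<ge> 0" by (simp add: B_def sum_nonneg)
    have "(\<Sum>i=1..<M. ell (s i) * U0_potential \<delta> B (\<zeta> (s (i + 1))) (\<zeta> (s i))) \<le> (\<Sum>i=1..<M. ell (s i) * ((1 - \<delta>) * u i))"
    proof (intro sum_mono mult_left_mono)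
      fix i assume i: "i \<in> {1..<M}"
      then have i': "i \<in> {1..M}" "i + 1 \<in> {1..M}" by auto
      show "0 \<le> ell (s i)" using ell0[OF s_in[OF i'(1)]] .
      have "\<bar>u i\<bar> \<le> B" unfolding B_def using i by (intro member_le_sum[of i _ "\<lambda>i. \<bar>u i\<bar>"]) auto
      then have uB: "- B \<le> u i" by linarith
      have "s i \<noteq> s (i + 1)" using injD[OF permutes_inj[OF s], of i "i + 1"] by auto
      then have ne: "\<zeta> (s i) \<noteq> \<zeta> (s (i + 1))" using \<zeta>_inj[OF s_in[OF i'(1)] s_in[OF i'(2)]] by blast
      show "U0_potential \<delta> B (\<zeta> (s (i + 1))) (\<zeta> (s i)) \<le> (1 - \<delta>) * u i"
        by (rule U0_potential_le[OF G_subset[OF \<zeta>_in[OF s_in[OF i'(1)]]] G_subset[OF \<zeta>_in[OF s_in[OF i'(2)]]] ne \<delta>(2) u[OF i] uB])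
    qed
    also have "\<dots> = (\<Sum>i=1..<M. ell (s i) * u i) - \<delta> * (\<Sum>i=1..<M. ell (s i) * u i)"
      by (simp add: algebra_simps sum_subtractf sum_distrib_left)
    finally show "a \<le> (\<Sum>i=1..<M. ell (s i) * u i) - (\<Sum>y\<in>UNIV. nu y * tilt l \<mu> y) + \<delta> * (1 - (\<Sum>i=1..<M. ell (s i) * u i))"
      using key[OF \<delta>(1) \<delta> B, of l \<mu>] by (simp add: algebra_simps)
  qed
  have U_le_0: "U0 K P C (\<zeta> (s i)) (\<zeta> (s (i + 1))) \<le> ereal 0" if "i \<in> {1..<M}" for i
    using perm_in(2)[OF s that] by (simp add: zero_ereal_def)
  have split: "(\<Sum>y\<in>UNIV. h y) = (\<Sum>y | cls y \<in> G. h y) + (\<Sum>y | cls y \<notin> G. h y)" for h :: "'s \<Rightarrow> 'v::comm_monoid_add"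
    using sum.Int_Diff[of UNIV h "{y. cls y \<in> G}"] by (simp add: Compl_eq_Diff_UNIV[symmetric] Collect_neg_eq)
  have deg: "nu y = 0" if "cls y \<notin> G" for y
  proof -
    have "\<mu> * (\<Sum>y | cls y \<notin> G. nu y) \<le> - a" if "\<mu> > 0" for \<mu>
    proof -
      have "a \<le> (\<Sum>i=1..<M. ell (s i) * 0) - (\<Sum>y\<in>UNIV. nu y * tilt (\<lambda>_. 0) \<mu> y)"
        by (rule key') (rule U_le_0)
      also have "(\<Sum>y\<in>UNIV. nu y * tilt (\<lambda>_. 0) \<mu> y) = (\<Sum>y | cls y \<in> G. nu y * tilt (\<lambda>_. 0) \<mu> y) + (\<Sum>y | cls y \<notin> G. nu y * tilt (\<lambda>_. 0) \<mu> y)"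
        by (rule split)
      also have "(\<Sum>y | cls y \<notin> G. nu y * tilt (\<lambda>_. 0) \<mu> y) = \<mu> * (\<Sum>y | cls y \<notin> G. nu y)"
        unfolding sum_distrib_left by (rule sum.cong) (auto simp: tilt_def)
      finally have "a \<le> - (\<Sum>y | cls y \<in> G. nu y * tilt (\<lambda>_. 0) \<mu> y) - \<mu> * (\<Sum>y | cls y \<notin> G. nu y)" by simp
      moreover have "(\<Sum>y | cls y \<in> G. nu y * tilt (\<lambda>_. 0) \<mu> y) \<ge> 0"
      proof (intro sum_nonneg mult_nonneg_nonneg nu0)
        fix y assume "y \<in> {y. cls y \<in> G}"
        then show "0 \<le> tilt (\<lambda>_. 0) \<mu> y" using \<Lambda>_le_norm[of "cls y" 0] by (simp add: tilt_def)
      qed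
      ultimately show ?thesis by linarith
    qed
    then have "(\<Sum>y | cls y \<notin> G. nu y) \<le> 0" by (rule real_le_if_all_multiples_le)
    moreover have "nu y \<le> (\<Sum>y | cls y \<notin> G. nu y)" using that nu0 by (intro member_le_sum) auto
    ultimately show ?thesis using nu0[of y] by linarith
  qed
  have nu1: "(\<Sum>y\<in>UNIV. nu y) = 1"
  proof -
    have "(\<Sum>y\<in>UNIV. real (count_list (ys (r k)) y) / real (r k)) = 1" for k
    proof -
      have "(\<Sum>y\<in>UNIV. count_list (ys (r k)) y) = r k"
        using sum_count_set[of "ys (r k)" UNIV] h(1)[OF rI] by simp
      then have "real (\<Sum>y\<in>UNIV. count_list (ys (r k)) y) = real (r k)" by (rule arg_cong)
      then show ?thesis using r1[of k] by (simp add: sum_divide_distrib[symmetric])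
    qed
    moreover have "(\<lambda>k. \<Sum>y\<in>UNIV. real (count_list (ys (r k)) y) / real (r k)) \<longlonglongrightarrow> (\<Sum>y\<in>UNIV. nu y)"
      by (intro tendsto_sum nu)
    ultimately show ?thesis using LIMSEQ_unique[OF tendsto_const] by fastforce
  qed
  define v where "v i = (\<Sum>y\<in>C (\<zeta> (s i)). nu y)" for i
  define q where "q i = (\<Sum>y\<in>C (\<zeta> (s i)). nu y *\<^sub>R f y)" for i
  have v1: "(\<Sum>i=1..M. v i) = 1"
    unfolding v_def sum_over_classes[OF s] using split[of nu] nu1 deg by simp
  have q1: "(\<Sum>i=1..M. q i) = (\<Sum>y\<in>UNIV. nu y *\<^sub>R f y)"
    unfolding q_def sum_over_classes[OF s] using split[of "\<lambda>y. nu y *\<^sub>R f y"] deg by simp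
  have "(\<Sum>i=1..M. q i) \<in> F"
  proof (rule closed_sequentially[OF F])
    show "(1 / real (r k)) *\<^sub>R sum_list (map f (ys (r k))) \<in> F" for k by (rule h(2)[OF rI])
    have "(1 / real (r k)) *\<^sub>R sum_list (map f (ys (r k))) = (\<Sum>y\<in>UNIV. (real (count_list (ys (r k)) y) / real (r k)) *\<^sub>R f y)" for k
      unfolding sum_list_map_eq_count by (simp add: scaleR_sum_right)
    then show "(\<lambda>k. (1 / real (r k)) *\<^sub>R sum_list (map f (ys (r k)))) \<longlonglongrightarrow> (\<Sum>i=1..M. q i)"
      unfolding q1 by (simp only:) (intro tendsto_sum tendsto_scaleR nu tendsto_const)
  qed
  moreover have "J (\<Sum>i=1..M. q i) \<le> ereal (- a)"
  proof (rule J_fun_le[OF s, where v = v and w = "\<lambda>i. ell (s i)"])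
    show "0 \<le> v i" for i unfolding v_def by (intro sum_nonneg nu0)
    show "(\<Sum>i=1..M. v i) = 1" by (rule v1)
    show "(\<Sum>j=1..i. v j) \<le> ell (s i)" if i: "i \<in> {1..<M}" for i
    proof -
      have iM: "i \<in> {1..M}" using i by simp
      have le: "(\<Sum>j=1..i. \<Sum>y\<in>C (\<zeta> (s j)). real (count_list (ys (r k)) y) / real (r k)) \<le> real (lv (ys (r k)) (s i)) / real (r k)" for k
      proof -
        have mono: "lv (ys (r k)) (s j) \<le> lv (ys (r k)) (s i)" if "j \<in> {1..i}" for j
        proof -
          have "j \<le> i" using that by simp
          then show ?thesis
            using that i
          proof (induction i rule: dec_induct)
            case (step n)
            have n: "n \<in> {1..<M}" using step by simp
            show ?case using h(4)[OF rI n, of k] step unfolding \<sigma>r by simp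
          qed simp
        qed
        have "(\<Sum>j=1..i. \<Sum>y\<in>C (\<zeta> (s j)). count_list (ys (r k)) y) \<le> lv (ys (r k)) (s i)"
          unfolding lv_def by (rule class_time_le_last_visit[OF s iM]) (use mono in \<open>simp add: lv_def\<close>)
        then have "real (\<Sum>j=1..i. \<Sum>y\<in>C (\<zeta> (s j)). count_list (ys (r k)) y) \<le> real (lv (ys (r k)) (s i))" by (rule of_nat_mono)
        then have "real (\<Sum>j=1..i. \<Sum>y\<in>C (\<zeta> (s j)). count_list (ys (r k)) y) / real (r k) \<le> real (lv (ys (r k)) (s i)) / real (r k)"
          by (intro divide_right_mono) auto
        then show ?thesis by (simp add: sum_divide_distrib)
      qed
      show ?thesis
        unfolding v_def
      proof (rule LIMSEQ_le)
        show "(\<lambda>k. \<Sum>j=1..i. \<Sum>y\<in>C (\<zeta> (s j)). real (count_list (ys (r k)) y) / real (r k)) \<longlonglongrightarrow> (\<Sum>j=1..i. \<Sum>y\<in>C (\<zeta> (s j)). nu y)"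
          by (intro tendsto_sum nu)
        show "(\<lambda>k. real (lv (ys (r k)) (s i)) / real (r k)) \<longlonglongrightarrow> ell (s i)" by (rule ell[OF s_in[OF iM]])
      qed (use le in auto)
    qed
    fix l :: "nat \<Rightarrow> real ^ 'd" and u :: "nat \<Rightarrow> real"
    assume u: "\<And>i. i \<in> {1..<M} \<Longrightarrow> U0 K P C (\<zeta> (s i)) (\<zeta> (s (i + 1))) \<le> ereal (u i) \<and> u i \<le> 0"
    \<comment> \<open>\<open>tilt\<close> takes slopes indexed by classes, whereas
      \<open>J_fun_le\<close> indexes them by the position in the order \<open>s\<close>.\<close>
    define l' where "l' c = l (inv_into {1..M} (\<lambda>i. \<zeta> (s i)) c)" for c
    have inj: "inj_on (\<lambda>i. \<zeta> (s i)) {1..M}"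
    proof (rule inj_onI)
      fix i j assume ij: "i \<in> {1..M}" "j \<in> {1..M}" "\<zeta> (s i) = \<zeta> (s j)"
      then have "s i = s j" using \<zeta>_inj[OF s_in[OF ij(1)] s_in[OF ij(2)]] by blast
      then show "i = j" using injD[OF permutes_inj[OF s]] by blast
    qed
    have l': "l' (\<zeta> (s i)) = l i" if "i \<in> {1..M}" for i
      unfolding l'_def using inv_into_f_f[OF inj that] by simp
    have "(\<Sum>y\<in>UNIV. nu y * tilt l' 0 y) = (\<Sum>i=1..M. \<Sum>y\<in>C (\<zeta> (s i)). nu y * tilt l' 0 y)"
      unfolding sum_over_classes[OF s] using split[of "\<lambda>y. nu y * tilt l' 0 y"] deg by simp
    also have "\<dots> = (\<Sum>i=1..M. l i \<bullet> q i - v i * \<Lambda> (\<zeta> (s i)) (l i))"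
    proof (rule sum.cong[OF refl])
      fix i assume i: "i \<in> {1..M}"
      have "nu y * tilt l' 0 y = l i \<bullet> (nu y *\<^sub>R f y) - nu y * \<Lambda> (\<zeta> (s i)) (l i)" if "y \<in> C (\<zeta> (s i))" for y
      proof -
        have "cls y = \<zeta> (s i)" using cls_eq[OF G_subset[OF \<zeta>_in[OF s_in[OF i]]] that] .
        then show ?thesis using \<zeta>_in[OF s_in[OF i]] l'[OF i] by (simp add: tilt_def algebra_simps)
      qed
      then have "(\<Sum>y\<in>C (\<zeta> (s i)). nu y * tilt l' 0 y) = (\<Sum>y\<in>C (\<zeta> (s i)). l i \<bullet> (nu y *\<^sub>R f y) - nu y * \<Lambda> (\<zeta> (s i)) (l i))"
        by (intro sum.cong) auto
      also have "\<dots> = l i \<bullet> q i - v i * \<Lambda> (\<zeta> (s i)) (l i)"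
        by (simp only: sum_subtractf q_def v_def inner_sum_right sum_distrib_right)
      finally show "(\<Sum>y\<in>C (\<zeta> (s i)). nu y * tilt l' 0 y) = l i \<bullet> q i - v i * \<Lambda> (\<zeta> (s i)) (l i)" .
    qed
    finally have "(\<Sum>y\<in>UNIV. nu y * tilt l' 0 y) = (\<Sum>i=1..M. l i \<bullet> q i - v i * \<Lambda> (\<zeta> (s i)) (l i))" .
    moreover have "a \<le> (\<Sum>i=1..<M. ell (s i) * u i) - (\<Sum>y\<in>UNIV. nu y * tilt l' 0 y)"
      by (rule key') (use u in blast)
    ultimately show "- (\<Sum>i=1..<M. ell (s i) * u i) + (\<Sum>i=1..M. l i \<bullet> q i - v i * \<Lambda> (\<zeta> (s i)) (l i)) \<le> - a"
      by linarith
  qed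
  ultimately show ?thesis by blast
qed

text \<open>A violation leaves a real \<open>a\<close> strictly between the two sides, hence
  infinitely many \<open>n\<close> with probability at least \<open>exp (real n * a)\<close>; then
  \<open>upper_bound_point\<close> produces a point of \<open>F\<close> at which \<open>J\<close> is
  too small.\<close>

lemma upper_bound:
  fixes \<Omega> :: "'w measure" and X :: "nat \<Rightarrow> 'w \<Rightarrow> 's"
  assumes chain: "nonhomogeneous_chain \<Omega> X \<pi> P" and F: "closed F"
  shows "limsup (log_rate (\<lambda>n. \<P>(\<omega> in \<Omega>. empirical_mean f X n \<omega> \<in> F))) \<le> - (INF z\<in>F. J z)"
    (is "limsup (log_rate ?p) \<le> _")
proof (rule ccontr)
  assume "\<not> ?thesis"
  then have "- (INF z\<in>F. J z) < limsup (log_rate ?p)" by simp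
  then obtain a where a: "- (INF z\<in>F. J z) < ereal a" "ereal a < limsup (log_rate ?p)"
    using ereal_dense2 by blast
  define I where "I = {n. n \<ge> 1 \<and> ereal a \<le> log_rate ?p n}"
  have "infinite I"
  proof
    assume "finite I"
    then obtain k where k: "\<forall>n\<in>I. n < k" unfolding finite_nat_set_iff_bounded by (rule exE)
    have "limsup (log_rate ?p) \<le> ereal a"
    proof (rule Limsup_bounded)
      show "\<forall>\<^sub>F n in sequentially. log_rate ?p n \<le> ereal a"
        using eventually_ge_at_top[of "max 1 k"]
      proof eventually_elim
        case (elim n)
        then have "n \<notin> I" "n \<ge> 1" using k by auto
        then have "\<not> ereal a \<le> log_rate ?p n" unfolding I_def by simp
        then show ?case by simp
      qed
    qed
    then show False using a by simp
  qed
  have "\<exists>z\<in>F. J z \<le> ereal (- a)"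
  proof (rule upper_bound_point[where w = "pmf \<pi>" and I = I])
    show "(\<Sum>x\<in>UNIV. pmf \<pi> x) = 1" by (rule sum_pmf_eq_1) auto
    fix n assume n: "n \<in> I"
    then have "exp (real n * a) \<le> ?p n" unfolding I_def using log_rate_ge_iff[of n a ?p] by simp
    then show "exp (real n * a) \<le>
      (\<Sum>x\<in>UNIV. pmf \<pi> x * (\<Sum>ys | length ys = n \<and> (1 / real n) *\<^sub>R sum_list (map f ys) \<in> F. pathw P 0 x ys))"
      unfolding prob_empirical_mean[OF chain] .
  qed (use F \<open>infinite I\<close> in \<open>auto simp: I_def\<close>)
  then have "(INF z\<in>F. J z) \<le> ereal (- a)" by (auto intro: INF_lower2)
  then have "ereal a \<le> - (INF z\<in>F. J z)"
    by (metis ereal_minus_le_minus ereal_uminus_uminus uminus_ereal.simps(1))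
  then show False using a(1) by simp
qed

end

section \<open>Loops realise the rate function of a class\<close>

lemma pathw_const: "pathw (\<lambda>_. q) S x ys = pathw (\<lambda>_. q) 0 x ys"
proof (induction ys arbitrary: S x)
  case (Cons y ys)
  show ?case using Cons[of "Suc S" y] Cons[of "Suc 0" y] by simp
qed simp

lemma last_Cons_append: "last (x # ys @ zs) = last (last (x # ys) # zs)"
  by (cases zs) auto

lemma pathw_pos:
  assumes "steps (\<lambda>x y. q x y > 0) x ys"
  shows "pathw (\<lambda>_. q) S x ys > 0"
  using assms by (induction ys arbitrary: S x) auto

text \<open>Concatenation is injective here because all first pieces have the same length
  \<open>m\<close>, and weights multiply because these pieces all end in \<open>b\<close>, where the
  second pieces start.\<close>

lemma sum_pathw_append_le:
  assumes "\<And>m x y. m > S \<Longrightarrow> 0 \<le> A m x y" "finite A3"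
    and "\<And>ys. ys \<in> A1 \<Longrightarrow> length ys = m \<and> last (x # ys) = b"
    and "\<And>ys zs. ys \<in> A1 \<Longrightarrow> zs \<in> A2 \<Longrightarrow> ys @ zs \<in> A3"
  shows "(\<Sum>ys\<in>A1. pathw A S x ys) * (\<Sum>zs\<in>A2. pathw A (S + m) b zs) \<le> (\<Sum>us\<in>A3. pathw A S x us)"
proof -
  have inj: "inj_on (\<lambda>(ys, zs). ys @ zs) (A1 \<times> A2)"
    unfolding inj_on_def using assms(3) by fastforce
  have "(\<Sum>ys\<in>A1. pathw A S x ys) * (\<Sum>zs\<in>A2. pathw A (S + m) b zs)
      = (\<Sum>(ys, zs)\<in>A1 \<times> A2. pathw A S x ys * pathw A (S + m) b zs)"
    by (simp add: sum_product sum.cartesian_product)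
  also have "\<dots> = (\<Sum>(ys, zs)\<in>A1 \<times> A2. pathw A S x (ys @ zs))"
  proof (rule sum.cong[OF refl], clarify)
    fix ys zs assume "ys \<in> A1"
    then have "length ys = m" "last (x # ys) = b" using assms(3) by blast+
    then show "pathw A S x ys * pathw A (S + m) b zs = pathw A S x (ys @ zs)" by (simp only: pathw_append)
  qed
  also have "\<dots> = (\<Sum>us\<in>(\<lambda>(ys, zs). ys @ zs) ` (A1 \<times> A2). pathw A S x us)"
    by (subst sum.reindex[OF inj]) (simp add: o_def case_prod_unfold)
  also have "\<dots> \<le> (\<Sum>us\<in>A3. pathw A S x us)"
    using assms(2,4) by (intro sum_mono2 pathw_nonneg assms(1)) auto
  finally show ?thesis .
qed

text \<open>Concatenating loops realises only proportions of whole numbers. An arbitrary proportion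
  \<open>t\<close> is approximated by the floor of \<open>(n + 1) * t\<close> over
  \<open>n + 1\<close>, and points of the closure by points of \<open>Q\<close>.\<close>

lemma convex_closure_of_rational_convex:
  fixes Q :: "'v::real_normed_vector set"
  assumes "\<And>x y k l. x \<in> Q \<Longrightarrow> y \<in> Q \<Longrightarrow> k + l \<ge> (1 :: nat) \<Longrightarrow>
    (real k / real (k + l)) *\<^sub>R x + (real l / real (k + l)) *\<^sub>R y \<in> Q"
  shows "convex (closure Q)"
proof -
  have seg: "(1 - t) *\<^sub>R x + t *\<^sub>R y \<in> closure Q" if xy: "x \<in> Q" "y \<in> Q" and t: "0 \<le> t" "t \<le> 1" for x y t
  proof -
    define l where "l n = nat \<lfloor>real (Suc n) * t\<rfloor>" for n
    have fl: "real (l n) \<le> real (Suc n) * t" "real (Suc n) * t - 1 \<le> real (l n)" for n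
      using t by (auto simp: l_def of_nat_nat)
    have ln: "l n \<le> Suc n" for n
    proof -
      have "real (l n) \<le> real (Suc n) * 1" using fl(1)[of n] t mult_left_mono[of t 1 "real (Suc n)"] by linarith
      then show ?thesis by simp
    qed
    have lim: "(\<lambda>n. real (l n) / real (Suc n)) \<longlonglongrightarrow> t"
    proof (rule tendsto_sandwich)
      show "\<forall>\<^sub>F n in sequentially. t - inverse (real (Suc n)) \<le> real (l n) / real (Suc n)"
      proof (intro always_eventually allI)
        fix n
        have "(real (Suc n) * t - 1) / real (Suc n) \<le> real (l n) / real (Suc n)"
          by (rule divide_right_mono[OF fl(2)]) simp
        then show "t - inverse (real (Suc n)) \<le> real (l n) / real (Suc n)"
          by (simp add: diff_divide_distrib inverse_eq_divide)
      qed
      show "\<forall>\<^sub>F n in sequentially. real (l n) / real (Suc n) \<le> t"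
      proof (intro always_eventually allI)
        fix n
        have "real (l n) / real (Suc n) \<le> (real (Suc n) * t) / real (Suc n)"
          by (rule divide_right_mono[OF fl(1)]) simp
        then show "real (l n) / real (Suc n) \<le> t" by simp
      qed
      show "(\<lambda>n. t - inverse (real (Suc n))) \<longlonglongrightarrow> t"
        using tendsto_diff[OF tendsto_const[of t] LIMSEQ_inverse_real_of_nat] by simp
    qed auto
    have mem: "(1 - real (l n) / real (Suc n)) *\<^sub>R x + (real (l n) / real (Suc n)) *\<^sub>R y \<in> closure Q" for n
    proof -
      have e: "Suc n - l n + l n = Suc n" using ln[of n] by simp
      have "real (Suc n - l n) / real (Suc n) = 1 - real (l n) / real (Suc n)"
        using ln[of n] by (simp add: of_nat_diff diff_divide_distrib)
      then show ?thesis using subsetD[OF closure_subset assms[OF xy, of "Suc n - l n" "l n"]] unfolding e by simp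
    qed
    have lim':  "(\<lambda>n. (1 - real (l n) / real (Suc n)) *\<^sub>R x + (real (l n) / real (Suc n)) *\<^sub>R y) \<longlonglongrightarrow> (1 - t) *\<^sub>R x + t *\<^sub>R y"
      by (intro tendsto_intros lim)
    show ?thesis by (rule closed_sequentially[OF closed_closure mem lim'])
  qed
  show ?thesis
    unfolding convex_alt
  proof (intro ballI allI impI)
    fix x y and t :: real assume x: "x \<in> closure Q" and y: "y \<in> closure Q" and t: "0 \<le> t \<and> t \<le> 1"
    obtain xs where xs: "\<And>n. xs n \<in> Q" "xs \<longlonglongrightarrow> x" using x unfolding closure_sequential by blast
    obtain ys where ys: "\<And>n. ys n \<in> Q" "ys \<longlonglongrightarrow> y" using y unfolding closure_sequential by blast
    have "(\<lambda>n. (1 - t) *\<^sub>R xs n + t *\<^sub>R ys n) \<longlonglongrightarrow> (1 - t) *\<^sub>R x + t *\<^sub>R y"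
      by (intro tendsto_intros xs(2) ys(2))
    then show "(1 - t) *\<^sub>R x + t *\<^sub>R y \<in> closure Q"
      by (rule closed_sequentially[OF closed_closure, rotated]) (use seg[OF xs(1) ys(1)] t in blast)
  qed
qed

context ldp_setting
begin

text \<open>The sum of \<open>f\<close> is prescribed exactly, not up to an error, so that
  concatenation adds lengths and sums and loop weights are supermultiplicative.\<close>

definition loops :: "'s \<Rightarrow> nat \<Rightarrow> real ^ 'd \<Rightarrow> 's list set" where
  "loops a m s = {ys. length ys = m \<and> last (a # ys) = a \<and> sum_list (map f ys) = s}"

definition loop_weight :: "'s \<Rightarrow> nat \<Rightarrow> real ^ 'd \<Rightarrow> real" where
  "loop_weight a m s = (\<Sum>ys\<in>loops a m s. pathw (\<lambda>_. p) 0 a ys)"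

lemma finite_loops: "finite (loops a m s)"
  by (simp add: loops_def)

lemma loop_weight_nonneg: "0 \<le> loop_weight a m s"
  unfolding loop_weight_def using p_nonneg by (intro sum_nonneg pathw_nonneg) auto

lemma loop_weight_le_1: "loop_weight a m s \<le> 1"
proof -
  have "loop_weight a m s \<le> (\<Sum>ys | length ys = m. pathw (\<lambda>_. p) 0 a ys)"
    unfolding loop_weight_def loops_def using p_nonneg by (intro sum_mono2 pathw_nonneg) auto
  also have "\<dots> = evol (\<lambda>_. p) m 0 (\<lambda>_. 1) a" by (simp add: evol_eq_sum)
  also have "\<dots> = 1" using stochastic_p by (intro evol_stochastic)
  finally show ?thesis .
qed

lemma loop_weight_add: "loop_weight a m s * loop_weight a n t \<le> loop_weight a (m + n) (s + t)"
proof -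
  have "loop_weight a n t = (\<Sum>ys\<in>loops a n t. pathw (\<lambda>_. p) (0 + m) a ys)"
    unfolding loop_weight_def by (rule sum.cong[OF refl pathw_const[symmetric]])
  moreover have "(\<Sum>ys\<in>loops a m s. pathw (\<lambda>_. p) 0 a ys) * (\<Sum>ys\<in>loops a n t. pathw (\<lambda>_. p) (0 + m) a ys)
      \<le> (\<Sum>ys\<in>loops a (m + n) (s + t). pathw (\<lambda>_. p) 0 a ys)"
  proof (rule sum_pathw_append_le)
    show "finite (loops a (m + n) (s + t))" by (rule finite_loops)
    show "ys @ zs \<in> loops a (m + n) (s + t)" if "ys \<in> loops a m s" "zs \<in> loops a n t" for ys zs
      using that unfolding loops_def by (simp add: last_Cons_append del: last.simps)
  qed (auto simp: loops_def p_nonneg)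
  ultimately show ?thesis unfolding loop_weight_def by simp
qed

lemma loop_weight_power: "loop_weight a m s ^ k \<le> loop_weight a (k * m) (real k *\<^sub>R s)"
proof (induction k)
  case 0
  have "loops a 0 0 = {[]}" by (auto simp: loops_def)
  then show ?case by (simp add: loop_weight_def)
next
  case (Suc k)
  have "loop_weight a m s ^ Suc k \<le> loop_weight a m s * loop_weight a (k * m) (real k *\<^sub>R s)"
    using Suc loop_weight_nonneg by (simp add: mult_left_mono)
  also have "\<dots> \<le> loop_weight a (m + k * m) (s + real k *\<^sub>R s)" by (rule loop_weight_add)
  finally show ?case by (simp add: algebra_simps)
qed

lemma path_to_state:
  assumes "i \<in> G" "a \<in> C i"
  shows "\<exists>d. \<forall>b\<in>C i. \<exists>zs. length zs \<le> d \<and> steps (\<lambda>x y. p x y > 0) b zs \<and> last (b # zs) = a"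
proof -
  define Z where "Z b zs \<longleftrightarrow> steps (\<lambda>x y. p x y > 0) b zs \<and> last (b # zs) = a" for b zs
  have "\<forall>b. \<exists>zs. b \<in> C i \<longrightarrow> Z b zs"
  proof
    fix b
    show "\<exists>zs. b \<in> C i \<longrightarrow> Z b zs"
    proof (cases "b \<in> C i")
      case True
      show ?thesis
        by (rule irreducible_on_path[OF G_irreducible[OF assms(1)] p_nonneg_all True assms(2)]) (auto simp: Z_def)
    qed simp
  qed
  then obtain ret where ret: "\<And>b. b \<in> C i \<Longrightarrow> Z b (ret b)" using choice[of "\<lambda>b zs. b \<in> C i \<longrightarrow> Z b zs"] by blast
  show ?thesis
  proof (intro exI[of _ "\<Sum>b\<in>UNIV. length (ret b)"] ballI)
    fix b assume "b \<in> C i"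
    moreover have "length (ret b) \<le> (\<Sum>b\<in>UNIV. length (ret b))" by (intro member_le_sum) auto
    ultimately show "\<exists>zs. length zs \<le> (\<Sum>b\<in>UNIV. length (ret b)) \<and> steps (\<lambda>x y. p x y > 0) b zs \<and> last (b # zs) = a"
      using ret[of b] unfolding Z_def by blast
  qed
qed

text \<open>Every path of length \<open>m\<close> inside the class extends to a loop by a bounded number of steps, and there are
  only polynomially many values of \<open>sum_list (map f ys)\<close>; so the growth of loop weights determines the
  eigenvalue.\<close>

lemma \<Lambda>_le_of_loops:
  assumes i: "i \<in> G" and a: "a \<in> C i"
    and le: "\<And>m s. m \<ge> 1 \<Longrightarrow> loop_weight a m s > 0 \<Longrightarrow> l \<bullet> s + ln (loop_weight a m s) \<le> real m * B"
  shows "\<Lambda> i l \<le> B"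
proof (rule tilted_eigenvector[OF i, of l])
  fix u
  define \<rho> where "\<rho> = tilted_eigenvalue p f (C i) l"
  assume pos: "tilted_eigenvalue p f (C i) l > 0" and u: "\<And>x. x \<in> C i \<Longrightarrow> u x > 0"
    and eig: "\<And>x. x \<in> C i \<Longrightarrow> (\<Sum>y\<in>C i. p x y * exp (l \<bullet> f y) * u y) = tilted_eigenvalue p f (C i) l * u x"
  define w where "w x ys = pathw (\<lambda>_. p) 0 x ys * exp (l \<bullet> sum_list (map f ys))" for x ys
  have w0: "0 \<le> w x ys" for x ys unfolding w_def using p_nonneg by (intro mult_nonneg_nonneg pathw_nonneg) auto
  have lsum: "l \<bullet> sum_list (map f ys) = sum_list (map (\<lambda>y. l \<bullet> f y) ys)" for ys
    by (induction ys) (simp_all add: inner_add_right)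
  let ?A = "\<lambda>m x y. if y \<in> C i then p x y * exp (l \<bullet> f y) else 0"
  have pw: "pathw ?A 0 x ys = (if set ys \<subseteq> C i then w x ys else 0)" for x ys
  proof -
    have "pathw ?A 0 x ys = (if \<forall>k<length ys. ys ! k \<in> C i then pathw (\<lambda>m x y. p x y * exp (l \<bullet> f y)) 0 x ys else 0)"
      using pathw_restrict[of "\<lambda>_. C i" "\<lambda>m x y. p x y * exp (l \<bullet> f y)" 0 x ys] by simp
    moreover have "pathw (\<lambda>m x y. p x y * exp (l \<bullet> f y)) 0 x ys = w x ys"
      unfolding w_def lsum by (rule pathw_tilt)
    moreover have "(\<forall>k<length ys. ys ! k \<in> C i) \<longleftrightarrow> set ys \<subseteq> C i" by (auto simp: in_set_conv_nth subset_iff)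
    ultimately show ?thesis by simp
  qed
  \<comment> \<open>The eigenvector makes the tilted weight of paths inside the class grow exactly
    like \<open>\<rho> ^ m\<close>.\<close>
  have ev: "evol ?A m S u x = \<rho> ^ m * u x" if "x \<in> C i" for m S x
    using that
  proof (induction m arbitrary: S x)
    case (Suc m)
    have "evol ?A (Suc m) S u x = (\<Sum>y\<in>UNIV. if y \<in> C i then p x y * exp (l \<bullet> f y) * (\<rho> ^ m * u y) else 0)"
      unfolding evol.simps using Suc.IH by (intro sum.cong) auto
    also have "\<dots> = (\<Sum>y\<in>C i. p x y * exp (l \<bullet> f y) * (\<rho> ^ m * u y))"
      by (simp add: sum.If_cases)
    also have "\<dots> = \<rho> ^ m * (\<Sum>y\<in>C i. p x y * exp (l \<bullet> f y) * u y)" by (simp add: sum_distrib_left mult_ac)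
    also have "\<dots> = \<rho> ^ Suc m * u x" using eig[OF Suc.prems] by (simp add: \<rho>_def)
    finally show ?case .
  qed simp
  obtain d where "\<forall>b\<in>C i. \<exists>zs. length zs \<le> d \<and> steps (\<lambda>x y. p x y > 0) b zs \<and> last (b # zs) = a"
    using path_to_state[OF i a] by (rule exE)
  from bchoice[OF this] obtain ret where
    ret: "\<forall>b\<in>C i. length (ret b) \<le> d \<and> steps (\<lambda>x y. p x y > 0) b (ret b) \<and> last (b # ret b) = a" by (rule exE)
  define N where "N = M + CARD('s)"
  have loopsum: "(\<Sum>us | length us = n \<and> last (a # us) = a. w a us) \<le> (real n + 1) ^ N * exp (real n * B)" if n: "n \<ge> 1" for n
  proof -
    let ?L = "{us. length us = n \<and> last (a # us) = a}"
    let ?h = "\<lambda>us. sum_list (map f us)"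
    have "(\<Sum>us\<in>?L. w a us) = (\<Sum>s\<in>?h ` ?L. \<Sum>us | us \<in> ?L \<and> ?h us = s. w a us)"
      by (rule sum.image_gen) simp
    also have "\<dots> \<le> (\<Sum>s\<in>?h ` ?L. exp (real n * B))"
    proof (rule sum_mono)
      fix s
      have "(\<Sum>us | us \<in> ?L \<and> ?h us = s. w a us) = loop_weight a n s * exp (l \<bullet> s)"
        unfolding loop_weight_def sum_distrib_right w_def by (rule sum.cong) (auto simp: loops_def)
      also have "\<dots> \<le> exp (real n * B)"
      proof (cases "loop_weight a n s > 0")
        case True
        have "loop_weight a n s * exp (l \<bullet> s) = exp (l \<bullet> s + ln (loop_weight a n s))"
          using True by (simp add: exp_add)
        also have "\<dots> \<le> exp (real n * B)" using le[OF n True] by simp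
        finally show ?thesis .
      next
        case False
        then have "loop_weight a n s = 0" using loop_weight_nonneg[of a n s] by linarith
        then show ?thesis by simp
      qed
      finally show "(\<Sum>us | us \<in> ?L \<and> ?h us = s. w a us) \<le> exp (real n * B)" .
    qed
    also have "\<dots> = real (card (?h ` ?L)) * exp (real n * B)" by simp
    also have "\<dots> \<le> (real n + 1) ^ N * exp (real n * B)"
    proof (rule mult_right_mono)
      \<comment> \<open>The sum of \<open>f\<close> along a path is determined by its occupation
        counts, so the polynomial count of configurations bounds the number of values.\<close>
      have "?h ` ?L = (\<lambda>t. \<Sum>x\<in>UNIV. real (snd t x) *\<^sub>R f x) ` config ` ?L"
        unfolding image_image sum_list_map_eq_count by (simp add: config_def)
      then have "card (?h ` ?L) \<le> card (config ` ?L)"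
        by (simp only:) (rule card_image_le[OF finite_imageI[OF finite_lists_length_conj]])
      then show "real (card (?h ` ?L)) \<le> (real n + 1) ^ N"
        using card_configs_le[of n "\<lambda>us. last (a # us) = a"] unfolding N_def by linarith
    qed simp
    finally show ?thesis .
  qed
  \<comment> \<open>Tilted weight of the chosen way from \<open>b\<close> back to \<open>a\<close>;
    dividing by it undoes the extension of a path to a loop.\<close>
  define \<kappa> where "\<kappa> b = w b (ret b)" for b
  have \<kappa>: "\<kappa> b > 0" if "b \<in> C i" for b
    using pathw_pos[of p b "ret b" 0] bspec[OF ret that] by (simp add: \<kappa>_def w_def)
  define c where "c = (\<Sum>b\<in>C i. u b / \<kappa> b * (real d + 2) ^ N * exp (real (length (ret b)) * B))"
  have bound: "\<rho> ^ m * u a \<le> c * real m ^ N * exp (real m * B)" if m: "m \<ge> 1" for m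
  proof -
    have one: "(\<Sum>ys | length ys = m \<and> set ys \<subseteq> C i \<and> last (a # ys) = b. w a ys) \<le>
        1 / \<kappa> b * ((real d + 2) ^ N * real m ^ N * exp (real (m + length (ret b)) * B))" if b: "b \<in> C i" for b
    proof -
      let ?Y = "{ys. length ys = m \<and> set ys \<subseteq> C i \<and> last (a # ys) = b}"
      have lastr: "last (b # ret b) = a" using bspec[OF ret b] by blast
      have "(\<Sum>ys\<in>?Y. w a ys) * \<kappa> b = (\<Sum>ys\<in>?Y. w a (ys @ ret b))"
        unfolding sum_distrib_right
      proof (rule sum.cong[OF refl])
        fix ys assume "ys \<in> ?Y"
        then have "last (a # ys) = b" by blast
        then show "w a ys * \<kappa> b = w a (ys @ ret b)"
          unfolding w_def \<kappa>_def pathw_append pathw_const[of p "0 + length ys"]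
          by (simp add: inner_add_right exp_add)
      qed
      also have "\<dots> = (\<Sum>us\<in>(\<lambda>ys. ys @ ret b) ` ?Y. w a us)"
        by (subst sum.reindex) (auto simp: inj_on_def)
      also have "\<dots> \<le> (\<Sum>us | length us = m + length (ret b) \<and> last (a # us) = a. w a us)"
      proof (rule sum_mono2)
        show "(\<lambda>ys. ys @ ret b) ` ?Y \<subseteq> {us. length us = m + length (ret b) \<and> last (a # us) = a}"
        proof (intro subsetI, elim imageE)
          fix us ys assume us: "us = ys @ ret b" and "ys \<in> ?Y"
          then have ys: "length ys = m" "last (a # ys) = b" by blast+
          have "last (a # us) = a" unfolding us last_Cons_append ys(2) by (rule lastr)
          then show "us \<in> {us. length us = m + length (ret b) \<and> last (a # us) = a}" using us ys(1) by simp
        qed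
      qed (use w0 in auto)
      also have "\<dots> \<le> (real (m + length (ret b)) + 1) ^ N * exp (real (m + length (ret b)) * B)"
        using m by (intro loopsum) simp
      also have "\<dots> \<le> ((real d + 2) * real m) ^ N * exp (real (m + length (ret b)) * B)"
      proof (intro mult_right_mono power_mono)
        have "real (m + length (ret b)) + 1 \<le> real m + real d + 1" using bspec[OF ret b] by simp
        also have "\<dots> \<le> (real d + 2) * real m"
        proof -
          have "real d * 1 \<le> real d * real m" using m by (intro mult_left_mono) auto
          then show ?thesis using m by (simp add: distrib_right)
        qed
        finally show "real (m + length (ret b)) + 1 \<le> (real d + 2) * real m" .
      qed auto
      also have "\<dots> = (real d + 2) ^ N * real m ^ N * exp (real (m + length (ret b)) * B)"
        by (simp only: power_mult_distrib)
      finally have "(\<Sum>ys\<in>?Y. w a ys) \<le> (real d + 2) ^ N * real m ^ N * exp (real (m + length (ret b)) * B) / \<kappa> b"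
        unfolding pos_le_divide_eq[OF \<kappa>[OF b]] .
      then show ?thesis by (simp only: divide_inverse mult_1_left mult_ac)
    qed
    have "\<rho> ^ m * u a = (\<Sum>ys | length ys = m. pathw ?A 0 a ys * u (last (a # ys)))"
      using ev[OF a, of m 0] by (simp add: evol_eq_sum)
    also have "\<dots> = (\<Sum>ys | length ys = m \<and> set ys \<subseteq> C i. w a ys * u (last (a # ys)))"
      unfolding pw by (rule sum.mono_neutral_cong_right) auto
    also have "\<dots> = (\<Sum>b\<in>C i. \<Sum>ys | ys \<in> {ys. length ys = m \<and> set ys \<subseteq> C i} \<and> last (a # ys) = b. w a ys * u (last (a # ys)))"
    proof (rule sum.group[symmetric])
      show "(\<lambda>ys. last (a # ys)) ` {ys. length ys = m \<and> set ys \<subseteq> C i} \<subseteq> C i"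
      proof (clarify)
        fix ys assume "set ys \<subseteq> C i"
        then show "last (a # ys) \<in> C i" using a last_in_set[of "a # ys"] by auto
      qed
    qed auto
    also have "\<dots> = (\<Sum>b\<in>C i. u b * (\<Sum>ys | length ys = m \<and> set ys \<subseteq> C i \<and> last (a # ys) = b. w a ys))"
      unfolding sum_distrib_left
      by (intro sum.cong) auto
    also have "\<dots> \<le> (\<Sum>b\<in>C i. u b * (1 / \<kappa> b * ((real d + 2) ^ N * real m ^ N * exp (real (m + length (ret b)) * B))))"
      using one u by (intro sum_mono mult_left_mono) (auto simp: less_imp_le)
    also have "\<dots> = c * real m ^ N * exp (real m * B)"
      unfolding c_def sum_distrib_right by (intro sum.cong) (auto simp: exp_add distrib_right)
    finally show ?thesis .
  qed
  have c: "c > 0"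
  proof -
    have "0 < \<rho> ^ 1 * u a" using pos u[OF a] by (simp add: \<rho>_def)
    also have "\<dots> \<le> c * exp B" using bound[of 1] by simp
    finally show ?thesis by (simp add: zero_less_mult_iff)
  qed
  have "ln \<rho> - B \<le> 0"
  proof (rule LIMSEQ_le_const)
    have "(\<lambda>m. (ln c - ln (u a)) / real m + real N * (ln (real m) / real m)) \<longlonglongrightarrow> 0 + real N * 0"
      by (intro tendsto_add tendsto_mult tendsto_const lim_const_over_n lim_ln_over_n)
    then show "(\<lambda>m. (ln c - ln (u a)) / real m + real N * (ln (real m) / real m)) \<longlonglongrightarrow> 0" by simp
    show "\<exists>n. \<forall>m\<ge>n. ln \<rho> - B \<le> (ln c - ln (u a)) / real m + real N * (ln (real m) / real m)"
    proof (intro exI[of _ 1] allI impI)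
      fix m :: nat assume m: "m \<ge> 1"
      have "ln (\<rho> ^ m * u a) \<le> ln (c * real m ^ N * exp (real m * B))"
        using bound[OF m] pos u[OF a] by (intro ln_mono) (auto simp: \<rho>_def)
      then have "real m * ln \<rho> + ln (u a) \<le> ln c + real N * ln (real m) + real m * B"
        using m c pos u[OF a] by (simp add: ln_mult ln_realpow \<rho>_def)
      then have "real m * (ln \<rho> - B) \<le> ln c - ln (u a) + real N * ln (real m)" by (simp add: algebra_simps)
      then show "ln \<rho> - B \<le> (ln c - ln (u a)) / real m + real N * (ln (real m) / real m)"
      proof -
        assume le: "real m * (ln \<rho> - B) \<le> ln c - ln (u a) + real N * ln (real m)"
        then have "real m * (ln \<rho> - B) / real m \<le> (ln c - ln (u a) + real N * ln (real m)) / real m"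
          by (rule divide_right_mono) simp
        then show ?thesis using m by (simp add: add_divide_distrib)
      qed
    qed
  qed
  then show "\<Lambda> i l \<le> B" by (simp add: \<Lambda>_def \<rho>_def)
qed

text \<open>Duality without smoothness: were \<open>(x, - c - eps / 2)\<close> outside
  \<open>closure Q\<close>, a hyperplane would separate the two, and
  \<open>\<Lambda>_le_of_loops\<close> would turn it into a bound on \<open>\<Lambda>\<close> that
  the rate \<open>c\<close> at \<open>x\<close> rules out. Half of \<open>eps\<close> is spent on
  strict separation, the other half on approximation from \<open>Q\<close>.\<close>

lemma exists_loop:
  assumes i: "i \<in> G" and a: "a \<in> C i" and I: "class_rate p f (C i) x \<le> ereal c" and eps: "eps > 0"
  obtains m s where "m \<ge> 1" "norm (s - real m *\<^sub>R x) \<le> eps * real m" "exp (- (c + eps) * real m) \<le> loop_weight a m s"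
proof -
  \<comment> \<open>Pairs of a mean and a rate. The rate may be lowered freely, so \<open>Q\<close>
    is the hypograph of the rates that loops attain.\<close>
  define Q where "Q = {(y, r). \<exists>m\<ge>1. exp (real m * r) \<le> loop_weight a m (real m *\<^sub>R y)}"
  have QI: "(y, r) \<in> Q" if "m \<ge> 1" "exp (real m * r) \<le> loop_weight a m (real m *\<^sub>R y)" for y r m
    using that by (auto simp: Q_def)
  have rc: "(real k / real (k + n)) *\<^sub>R q1 + (real n / real (k + n)) *\<^sub>R q2 \<in> Q"
    if q: "q1 \<in> Q" "q2 \<in> Q" and kn: "k + n \<ge> 1" for q1 q2 k n
  proof -
    obtain y1 r1 m1 where 1: "q1 = (y1, r1)" "m1 \<ge> 1" "exp (real m1 * r1) \<le> loop_weight a m1 (real m1 *\<^sub>R y1)"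
      using q(1) by (auto simp: Q_def)
    obtain y2 r2 m2 where 2: "q2 = (y2, r2)" "m2 \<ge> 1" "exp (real m2 * r2) \<le> loop_weight a m2 (real m2 *\<^sub>R y2)"
      using q(2) by (auto simp: Q_def)
    \<comment> \<open>The first loop is run \<open>k * m2\<close> times and the second
      \<open>n * m1\<close> times, so that their total durations are in the proportion
      \<open>k\<close> to \<open>n\<close>.\<close>
    define m where "m = (k * m2) * m1 + (n * m1) * m2"
    define y where "y = (real k / real (k + n)) *\<^sub>R y1 + (real n / real (k + n)) *\<^sub>R y2"
    define r where "r = (real k / real (k + n)) * r1 + (real n / real (k + n)) * r2"
    have m_eq: "m = (k + n) * (m1 * m2)" by (simp add: m_def algebra_simps)
    have m1: "m \<ge> 1" unfolding m_eq using 1 2 kn by (simp add: Suc_le_eq)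
    have kn': "real (k + n) > 0" using kn by linarith
    have e: "real m * (real k / real (k + n)) = real (k * m2) * real m1"
      "real m * (real n / real (k + n)) = real (n * m1) * real m2"
      unfolding m_eq using kn' by (simp_all add: field_simps)
    have my: "real m *\<^sub>R y = real (k * m2) *\<^sub>R (real m1 *\<^sub>R y1) + real (n * m1) *\<^sub>R (real m2 *\<^sub>R y2)"
      unfolding y_def scaleR_add_right scaleR_scaleR e by (rule refl)
    have mr: "real m * r = real (k * m2) * (real m1 * r1) + real (n * m1) * (real m2 * r2)"
      unfolding r_def distrib_left mult.assoc[symmetric] e by (rule refl)
    have "exp (real m * r) = exp (real m1 * r1) ^ (k * m2) * exp (real m2 * r2) ^ (n * m1)"
      unfolding mr exp_add exp_of_nat_mult[symmetric] by simp
    also have "\<dots> \<le> loop_weight a m1 (real m1 *\<^sub>R y1) ^ (k * m2) * loop_weight a m2 (real m2 *\<^sub>R y2) ^ (n * m1)"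
      by (intro mult_mono power_mono 1(3) 2(3) zero_le_power loop_weight_nonneg exp_ge_zero)
    also have "\<dots> \<le> loop_weight a ((k * m2) * m1) (real (k * m2) *\<^sub>R (real m1 *\<^sub>R y1)) * loop_weight a ((n * m1) * m2) (real (n * m1) *\<^sub>R (real m2 *\<^sub>R y2))"
      by (intro mult_mono loop_weight_power zero_le_power loop_weight_nonneg)
    also have "\<dots> \<le> loop_weight a m (real m *\<^sub>R y)"
      unfolding my by (subst m_def) (rule loop_weight_add)
    finally have "(y, r) \<in> Q" by (rule QI[OF m1])
    then show ?thesis by (simp add: 1 2 y_def r_def)
  qed
  have conv: "convex (closure Q)" by (rule convex_closure_of_rational_convex[OF rc])
  have IL: "l \<bullet> x - \<Lambda> i l \<le> c" for l
  proof -
    have "ereal (l \<bullet> x - \<Lambda> i l) \<le> class_rate p f (C i) x" unfolding class_rate_eq[OF i] by (rule SUP_upper) simp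
    then have "ereal (l \<bullet> x - \<Lambda> i l) \<le> ereal c" using I by (rule order_trans)
    then show ?thesis by simp
  qed
  have inQ: "(s /\<^sub>R real m, ln (loop_weight a m s) / real m) \<in> Q" if "m \<ge> 1" "loop_weight a m s > 0" for m s
    by (rule QI[OF that(1)]) (use that in simp)
  have "(x, - c - eps / 2) \<in> closure Q"
  proof (rule ccontr)
    assume nin: "(x, - c - eps / 2) \<notin> closure Q"
    obtain h b where hb: "inner h (x, - c - eps / 2) < b" "\<And>q. q \<in> closure Q \<Longrightarrow> b < inner h q"
      using separating_hyperplane_closed_point[OF conv closed_closure nin] by blast
    obtain l0 \<gamma> where h: "h = (l0, \<gamma>)" by (cases h)
    define l where "l = - l0"
    have sep0: "- b < l \<bullet> x + \<gamma> * (c + eps / 2)" using hb(1) by (simp add: h l_def algebra_simps)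
    have sepQ: "l \<bullet> y - \<gamma> * r < - b" if "(y, r) \<in> Q" for y r
    proof -
      have "(y, r) \<in> closure Q" using that closure_subset by blast
      then show ?thesis using hb(2)[of "(y, r)"] by (simp add: h l_def)
    qed
    \<comment> \<open>One loop of positive weight shows that \<open>Q\<close> is not empty; lowering
      its rate without bound fixes the sign of \<open>\<gamma>\<close>.\<close>
    obtain m0 s0 where 0: "m0 \<ge> 1" "loop_weight a m0 s0 > 0"
    proof (rule irreducible_on_path[OF G_irreducible[OF i] p_nonneg_all a a])
      fix zs assume zs: "zs \<noteq> []" "set zs \<subseteq> C i" "steps (\<lambda>x y. p x y > 0) a zs" "last zs = a"
      have "pathw (\<lambda>_. p) 0 a zs \<le> loop_weight a (length zs) (sum_list (map f zs))"
        unfolding loop_weight_def using p_nonneg zs(1,4)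
        by (intro member_le_sum pathw_nonneg finite_loops) (auto simp: loops_def)
      then have "loop_weight a (length zs) (sum_list (map f zs)) > 0" using pathw_pos[OF zs(3), of 0] by linarith
      moreover have "length zs \<ge> 1" using zs(1) by (cases zs) auto
      ultimately show thesis using that by blast
    qed
    have \<gamma>: "\<gamma> \<le> 0"
    proof (rule real_le_if_all_multiples_le)
      fix t :: real assume t: "t > 0"
      let ?r = "ln (loop_weight a m0 s0) / real m0 - t"
      have "(s0 /\<^sub>R real m0, ?r) \<in> Q"
      proof (rule QI[OF 0(1)])
        have "real m0 * ?r \<le> ln (loop_weight a m0 s0)" using 0 t by (simp add: right_diff_distrib)
        then have "exp (real m0 * ?r) \<le> exp (ln (loop_weight a m0 s0))" by simp
        then show "exp (real m0 * ?r) \<le> loop_weight a m0 (real m0 *\<^sub>R (s0 /\<^sub>R real m0))" using 0 by simp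
      qed
      from sepQ[OF this]
      show "t * \<gamma> \<le> - b - l \<bullet> (s0 /\<^sub>R real m0) + \<gamma> * (ln (loop_weight a m0 s0) / real m0)"
        by (simp add: algebra_simps)
    qed
    show False
    proof (cases "\<gamma> = 0")
      case False
      then have g: "- \<gamma> > 0" using \<gamma> by simp
      \<comment> \<open>A hyperplane that is not vertical bounds the rates of all loops by an affine
        function of their means; its slope \<open>l'\<close> contradicts the Legendre bound
        \<open>IL\<close>.\<close>
      define l' where "l' = (1 / - \<gamma>) *\<^sub>R l"
      have "\<Lambda> i l' \<le> - b / - \<gamma>"
      proof (rule \<Lambda>_le_of_loops[OF i a])
        fix m s assume m: "m \<ge> 1" "loop_weight a m s > 0"
        have "l \<bullet> (s /\<^sub>R real m) + (- \<gamma>) * (ln (loop_weight a m s) / real m) < - b" using sepQ[OF inQ[OF m]] by simp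
        then have "real m * (l \<bullet> (s /\<^sub>R real m) + (- \<gamma>) * (ln (loop_weight a m s) / real m)) \<le> real m * - b"
          using m by (intro mult_left_mono) auto
        then have "l \<bullet> s + (- \<gamma>) * ln (loop_weight a m s) \<le> real m * - b"
          using m by (simp add: right_diff_distrib mult.assoc[symmetric])
        then have "(l \<bullet> s + (- \<gamma>) * ln (loop_weight a m s)) / - \<gamma> \<le> (real m * - b) / - \<gamma>"
          using g by (intro divide_right_mono) auto
        then show "l' \<bullet> s + ln (loop_weight a m s) \<le> real m * (- b / - \<gamma>)"
          using g by (simp add: l'_def add_divide_distrib diff_divide_distrib)
      qed
      moreover have "- b / - \<gamma> < l' \<bullet> x - (c + eps / 2)"
      proof -
        have "- b / - \<gamma> < (l \<bullet> x + \<gamma> * (c + eps / 2)) / - \<gamma>" using sep0 g by (intro divide_strict_right_mono)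
        also have "\<dots> = l' \<bullet> x - (c + eps / 2)" using g by (simp add: l'_def field_simps)
        finally show ?thesis .
      qed
      ultimately show False using IL[of l'] eps by linarith
    next
      \<comment> \<open>A vertical hyperplane separates the means alone: every multiple
        \<open>t *\<^sub>R l\<close> is then bounded on loops, and \<open>t\<close> tending to
        infinity would make the rate at \<open>x\<close> exceed \<open>c\<close>.\<close>
      case True
      have "t * (l \<bullet> x + b) \<le> c" if t: "t > 0" for t
      proof -
        have "\<Lambda> i (t *\<^sub>R l) \<le> t * - b"
        proof (rule \<Lambda>_le_of_loops[OF i a])
          fix m s assume m: "m \<ge> 1" "loop_weight a m s > 0"
          have "l \<bullet> (s /\<^sub>R real m) < - b" using sepQ[OF inQ[OF m]] True by simp
          then have "real m * t * (l \<bullet> (s /\<^sub>R real m)) \<le> real m * t * - b"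
            using m t by (intro mult_left_mono) auto
          then have "t * (l \<bullet> s) \<le> real m * (t * - b)" using m by (simp add: field_simps)
          moreover have "ln (loop_weight a m s) \<le> 0" using m loop_weight_le_1[of a m s] by simp
          ultimately show "(t *\<^sub>R l) \<bullet> s + ln (loop_weight a m s) \<le> real m * (t * - b)" by simp
        qed
        then show ?thesis using IL[of "t *\<^sub>R l"] by (simp add: algebra_simps)
      qed
      then have "l \<bullet> x + b \<le> 0" by (rule real_le_if_all_multiples_le)
      then show False using sep0 True by simp
    qed
  qed
  then obtain q where q: "q \<in> Q" "dist q (x, - c - eps / 2) < eps / 2"
    using eps unfolding closure_approachable by (metis half_gt_zero)
  obtain y r where yr: "q = (y, r)" by (cases q)
  obtain m where m: "m \<ge> 1" "exp (real m * r) \<le> loop_weight a m (real m *\<^sub>R y)" using q(1) by (auto simp: Q_def yr)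
  have "dist y x \<le> dist q (x, - c - eps / 2)" "dist r (- c - eps / 2) \<le> dist q (x, - c - eps / 2)"
    using dist_fst_le[of q "(x, - c - eps / 2)"] dist_snd_le[of q "(x, - c - eps / 2)"] by (auto simp: yr)
  then have d: "norm (y - x) \<le> eps" "- (c + eps) \<le> r" using q(2) eps by (auto simp: dist_norm)
  show ?thesis
  proof (rule that[OF m(1)])
    have "norm (real m *\<^sub>R y - real m *\<^sub>R x) = real m * norm (y - x)"
      by (simp add: scaleR_diff_right[symmetric])
    also have "\<dots> \<le> real m * eps" using d(1) by (intro mult_left_mono) auto
    finally show "norm (real m *\<^sub>R y - real m *\<^sub>R x) \<le> eps * real m" by (simp add: mult.commute)
    have "- (c + eps) * real m \<le> r * real m" using d(2) by (intro mult_right_mono) auto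
    then have "exp (- (c + eps) * real m) \<le> exp (real m * r)" by (simp only: exp_le_cancel_iff mult.commute)
    then show "exp (- (c + eps) * real m) \<le> loop_weight a m (real m *\<^sub>R y)" using m(2) by linarith
  qed
qed

section \<open>The lower bound\<close>

lemma norm_sum_list_f_le: "norm (sum_list (map f ys)) \<le> R * real (length ys)"
proof (induction ys)
  case (Cons y ys)
  have "norm (sum_list (map f (y # ys))) \<le> norm (f y) + norm (sum_list (map f ys))"
    using norm_triangle_ineq by simp
  also have "\<dots> \<le> R + R * real (length ys)" using norm_f_le[of y] Cons by linarith
  finally show ?case by (simp add: algebra_simps)
qed simp

lemma R_nonneg: "0 \<le> R"
  using norm_f_le[of undefined] norm_ge_zero order_trans by blast

definition mass :: "('s \<Rightarrow> real) \<Rightarrow> nat \<Rightarrow> 's \<Rightarrow> (real ^ 'd) set \<Rightarrow> real" where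
  "mass w T a B = (\<Sum>x\<in>UNIV. w x * (\<Sum>ys | length ys = T \<and> last (x # ys) = a \<and> sum_list (map f ys) \<in> B. pathw P 0 x ys))"

text \<open>\<open>Q\<close> is left general because the final free piece of a path prescribes no
  end state, in contrast to the pieces in \<open>mass_append\<close>.\<close>

lemma mass_extend:
  assumes w: "\<And>x. 0 \<le> w x"
    and A: "\<And>zs. zs \<in> A \<Longrightarrow> length zs = k"
    and Q: "\<And>x ys zs. length ys = T \<Longrightarrow> last (x # ys) = a \<Longrightarrow> sum_list (map f ys) \<in> B \<Longrightarrow> zs \<in> A \<Longrightarrow> Q x (ys @ zs)"
  shows "mass w T a B * (\<Sum>zs\<in>A. pathw P T a zs) \<le> (\<Sum>x\<in>UNIV. w x * (\<Sum>us | length us = T + k \<and> Q x us. pathw P 0 x us))"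
  unfolding mass_def sum_distrib_right
proof (rule sum_mono)
  fix x
  have "(\<Sum>ys | length ys = T \<and> last (x # ys) = a \<and> sum_list (map f ys) \<in> B. pathw P 0 x ys) * (\<Sum>zs\<in>A. pathw P (0 + T) a zs)
     \<le> (\<Sum>us | length us = T + k \<and> Q x us. pathw P 0 x us)"
  proof (rule sum_pathw_append_le)
    show "0 \<le> P m x y" if "m > 0" for m x y using P_nonneg that by simp
    show "ys @ zs \<in> {us. length us = T + k \<and> Q x us}"
      if "ys \<in> {ys. length ys = T \<and> last (x # ys) = a \<and> sum_list (map f ys) \<in> B}" "zs \<in> A" for ys zs
      using A[OF that(2)] Q[of ys x zs] that by simp
  qed auto
  then show "w x * (\<Sum>ys | length ys = T \<and> last (x # ys) = a \<and> sum_list (map f ys) \<in> B. pathw P 0 x ys) * (\<Sum>zs\<in>A. pathw P T a zs)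
     \<le> w x * (\<Sum>us | length us = T + k \<and> Q x us. pathw P 0 x us)"
    unfolding mult.assoc by (intro mult_left_mono w) simp
qed

lemma mass_append:
  assumes w: "\<And>x. 0 \<le> w x"
    and A: "\<And>zs. zs \<in> A \<Longrightarrow> length zs = k \<and> last (a # zs) = b"
    and B: "\<And>s zs. s \<in> B \<Longrightarrow> zs \<in> A \<Longrightarrow> s + sum_list (map f zs) \<in> B'"
  shows "mass w T a B * (\<Sum>zs\<in>A. pathw P T a zs) \<le> mass w (T + k) b B'"
  unfolding mass_def[of w "T + k"]
proof (rule mass_extend[OF w])
  show "length zs = k" if "zs \<in> A" for zs using A[OF that] by simp
  show "last (x # ys @ zs) = b \<and> sum_list (map f (ys @ zs)) \<in> B'"
    if "last (x # ys) = a" "sum_list (map f ys) \<in> B" "zs \<in> A" for x ys zs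
  proof
    show "last (x # ys @ zs) = b" unfolding last_Cons_append that(1) using A[OF that(3)] by simp
    show "sum_list (map f (ys @ zs)) \<in> B'" using B[OF that(2,3)] by simp
  qed
qed

lemma mass_nonneg: "(\<And>x. 0 \<le> w x) \<Longrightarrow> 0 \<le> mass w T a B"
  unfolding mass_def using P_nonneg by (intro sum_nonneg mult_nonneg_nonneg pathw_nonneg) auto

text \<open>\<open>lower_rate w i t y c\<close>: up to factors \<open>exp (o n)\<close>, with probability \<open>exp (- c n)\<close> the chain is in class \<open>i\<close> at
  some deterministic time \<open>t n + o n\<close>, and the sum of \<open>f\<close> along the path is \<open>n y + o n\<close>.\<close>

definition lower_rate :: "('s \<Rightarrow> real) \<Rightarrow> nat \<Rightarrow> real \<Rightarrow> real ^ 'd \<Rightarrow> real \<Rightarrow> bool" where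
  "lower_rate w i t y c \<longleftrightarrow> (\<forall>\<epsilon>>0. \<forall>T0. \<exists>n0. \<forall>n\<ge>n0. \<exists>T a. T0 \<le> T \<and> a \<in> C i \<and>
     \<bar>real T - t * real n\<bar> \<le> \<epsilon> * real n \<and>
     exp (- (real n * (c + \<epsilon>))) \<le> mass w T a {s. norm (s - real n *\<^sub>R y) \<le> \<epsilon> * real n})"

lemma lower_rateD:
  assumes "lower_rate w i t y c" "\<epsilon> > 0"
  shows "\<exists>n0. \<forall>n\<ge>n0. \<exists>T a. T0 \<le> T \<and> a \<in> C i \<and>
     \<bar>real T - t * real n\<bar> \<le> \<epsilon> * real n \<and>
     exp (- (real n * (c + \<epsilon>))) \<le> mass w T a {s. norm (s - real n *\<^sub>R y) \<le> \<epsilon> * real n}"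
  using assms(1)[unfolded lower_rate_def] assms(2) by simp

lemma lower_rate_mono:
  assumes "lower_rate w i t y c" "c \<le> c'"
  shows "lower_rate w i t y c'"
  unfolding lower_rate_def
proof (intro allI impI)
  fix \<epsilon> :: real and T0 :: nat assume "\<epsilon> > 0"
  from lower_rateD[OF assms(1) this, of T0] obtain n0 where n0: "\<forall>n\<ge>n0. \<exists>T a. T0 \<le> T \<and> a \<in> C i \<and>
     \<bar>real T - t * real n\<bar> \<le> \<epsilon> * real n \<and>
     exp (- (real n * (c + \<epsilon>))) \<le> mass w T a {s. norm (s - real n *\<^sub>R y) \<le> \<epsilon> * real n}" by (rule exE)
  have e: "exp (- (real n * (c' + \<epsilon>))) \<le> exp (- (real n * (c + \<epsilon>)))" for n
    using assms(2) by (simp add: mult_left_mono)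
  show "\<exists>n0. \<forall>n\<ge>n0. \<exists>T a. T0 \<le> T \<and> a \<in> C i \<and> \<bar>real T - t * real n\<bar> \<le> \<epsilon> * real n \<and>
     exp (- (real n * (c' + \<epsilon>))) \<le> mass w T a {s. norm (s - real n *\<^sub>R y) \<le> \<epsilon> * real n}"
    using n0 order_trans[OF e] by meson
qed

lemma eventually_const_le:
  assumes "e > (0 :: real)"
  shows "\<exists>n0. \<forall>n\<ge>n0. b \<le> e * real n"
proof -
  obtain n0 :: nat where n0: "b / e \<le> real n0" using real_arch_simple by blast
  have "b \<le> e * real n" if "n \<ge> n0" for n
  proof -
    have "b / e \<le> real n" using n0 that by linarith
    then show ?thesis using assms by (simp add: field_simps)
  qed
  then show ?thesis by blast
qed

text \<open>Steps without exponential cost. Besides positive entries of \<open>p\<close> these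
  include the entries that \<open>augmented_matrix\<close> adds.\<close>

definition cheap :: "'s \<Rightarrow> 's \<Rightarrow> bool" where
  "cheap x y \<longleftrightarrow> (\<forall>e>0. \<forall>\<^sub>F k in sequentially. exp (- (real k * e)) \<le> P k x y)"

lemma cheap_of_pos:
  assumes "p x y > 0"
  shows "cheap x y"
  unfolding cheap_def
proof (intro allI impI)
  fix e :: real assume "e > 0"
  then have lim: "(\<lambda>k. exp (real k * (- e))) \<longlonglongrightarrow> 0" by (intro exp_mult_tendsto_0) simp
  have "\<forall>\<^sub>F k in sequentially. exp (real k * (- e)) < p x y / 2"
    by (rule order_tendstoD(2)[OF lim]) (use assms in simp)
  moreover have "\<forall>\<^sub>F k in sequentially. p x y / 2 < P k x y"
    by (rule order_tendstoD(1)[OF convergence]) (use assms in simp)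
  ultimately show "\<forall>\<^sub>F k in sequentially. exp (- (real k * e)) \<le> P k x y"
    by eventually_elim simp
qed

text \<open>Every step happens no later than time \<open>S + r\<close>, so a loss rate of
  \<open>e / (r + 1)\<close> per step keeps the loss of the whole path below
  \<open>(S + r) * e\<close> in the exponent. The length is only bounded, as connections from
  different states differ in length.\<close>

lemma cheap_path_weight:
  assumes e: "e > 0"
  shows "\<exists>T1. \<forall>S\<ge>T1. \<forall>b zs. steps cheap b zs \<longrightarrow> length zs \<le> r \<longrightarrow>
    exp (- (real (S + r) * e)) \<le> pathw P S b zs"
proof -
  define e' where "e' = e / (real r + 1)"
  have e': "e' > 0" using e by (simp add: e'_def)
  have "\<forall>\<^sub>F k in sequentially. \<forall>x. \<forall>y. cheap x y \<longrightarrow> exp (- (real k * e')) \<le> P k x y"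
  proof (intro eventually_all_finite)
    show "\<forall>\<^sub>F k in sequentially. cheap x y \<longrightarrow> exp (- (real k * e')) \<le> P k x y" for x y
      using e' by (cases "cheap x y") (auto simp: cheap_def)
  qed
  then obtain T1 where T1: "\<And>k x y. k \<ge> T1 \<Longrightarrow> cheap x y \<Longrightarrow> exp (- (real k * e')) \<le> P k x y"
    unfolding eventually_sequentially by blast
  have iter: "exp (- (real m * e')) ^ length zs \<le> pathw P S b zs"
    if "steps cheap b zs" "S + length zs \<le> m" "S \<ge> T1" for S b zs m
    using that
  proof (induction zs arbitrary: S b)
    case (Cons z zs)
    have "exp (- (real m * e')) \<le> exp (- (real (Suc S) * e'))" using Cons.prems e' by (simp add: mult_right_mono)
    also have "\<dots> \<le> P (Suc S) b z" using Cons.prems by (intro T1) auto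
    finally have "exp (- (real m * e')) \<le> P (Suc S) b z" .
    moreover have "exp (- (real m * e')) ^ length zs \<le> pathw P (Suc S) z zs"
      using Cons.prems by (intro Cons.IH) auto
    ultimately show ?case using P_nonneg[of "Suc S"] by (simp add: mult_mono)
  qed simp
  show ?thesis
  proof (intro exI[of _ T1] allI impI)
    fix S b zs assume S: "S \<ge> T1" "steps cheap b zs" "length zs \<le> r"
    have "real (length zs) * e' \<le> e"
    proof -
      have "real (length zs) * e \<le> (real r + 1) * e" using S(3) e by (intro mult_right_mono) auto
      then show ?thesis by (simp add: e'_def field_simps)
    qed
    then have "real (S + r) * (real (length zs) * e') \<le> real (S + r) * e" by (rule mult_left_mono) simp
    then have "exp (- (real (S + r) * e)) \<le> exp (real (length zs) * - (real (S + r) * e'))"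
      by (simp only: exp_le_cancel_iff) (simp add: algebra_simps)
    also have "\<dots> = exp (- (real (S + r) * e')) ^ length zs" by (rule exp_of_nat_mult)
    also have "\<dots> \<le> pathw P S b zs" using S by (intro iter) auto
    finally show "exp (- (real (S + r) * e)) \<le> pathw P S b zs" .
  qed
qed

text \<open>Entrywise convergence is relative convergence where \<open>p\<close> is positive, and
  where \<open>p\<close> is 0 there is nothing to bound; so from some time on, replacing
  \<open>p\<close> by \<open>P\<close> costs at most a factor \<open>exp (- e)\<close> per step,
  whatever the starting time.\<close>

lemma pathw_ge_limit:
  assumes e: "e > 0"
  shows "\<exists>T1. \<forall>S\<ge>T1. \<forall>x ys. exp (- (real (length ys) * e)) * pathw (\<lambda>_. p) 0 x ys \<le> pathw P S x ys"
proof -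
  have "\<forall>\<^sub>F k in sequentially. \<forall>x. \<forall>y. exp (- e) * p x y \<le> P k x y"
  proof (intro eventually_all_finite)
    show "\<forall>\<^sub>F k in sequentially. exp (- e) * p x y \<le> P k x y" for x y
    proof (cases "p x y = 0")
      case True
      show ?thesis using eventually_ge_at_top[of "1::nat"] by eventually_elim (simp add: True P_nonneg)
    next
      case False
      then have "p x y > 0" using p_nonneg[of x y] by simp
      then have "exp (- e) * p x y < p x y" using e by simp
      then have "\<forall>\<^sub>F k in sequentially. exp (- e) * p x y < P k x y" by (rule order_tendstoD(1)[OF convergence])
      then show ?thesis by eventually_elim simp
    qed
  qed
  then obtain T1 where T1: "\<And>k x y. k \<ge> T1 \<Longrightarrow> exp (- e) * p x y \<le> P k x y"
    unfolding eventually_sequentially by blast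
  have pw0: "0 \<le> pathw (\<lambda>_. p) S x ys" for S x ys using p_nonneg by (intro pathw_nonneg)
  have "exp (- e) ^ length ys * pathw (\<lambda>_. p) 0 x ys \<le> pathw P S x ys" if "S \<ge> T1" for S x ys
    using that
  proof (induction ys arbitrary: S x)
    case (Cons y ys)
    have IH: "exp (- e) ^ length ys * pathw (\<lambda>_. p) 0 y ys \<le> pathw P (Suc S) y ys" using Cons by simp
    have "(exp (- e) * p x y) * (exp (- e) ^ length ys * pathw (\<lambda>_. p) 0 y ys) \<le> P (Suc S) x y * pathw P (Suc S) y ys"
      using T1[of "Suc S" x y] Cons.prems IH P_nonneg[of "Suc S"] pw0 by (intro mult_mono) auto
    then show ?case by (simp add: pathw_const[of p "Suc 0"] mult_ac)
  qed simp
  moreover have "exp (- (real n * e)) = exp (- e) ^ n" for n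
    using exp_of_nat_mult[of n "- e"] by simp
  ultimately show ?thesis by (intro exI[of _ T1]) simp
qed

text \<open>Condition SIE at work: after time \<open>n1\<close> the positive entries of
  \<open>p\<close> within the class are positive in \<open>P m\<close>, so the class is occupied
  with positive probability at every later time. \<open>T\<close> is fixed before \<open>n\<close>
  grows, whence time 0, displacement 0 and cost 0, while any threshold \<open>T0\<close> is
  met.\<close>

lemma lower_rate_start:
  assumes w: "\<And>x. 0 \<le> w x" and i: "i \<in> G"
    and pos: "\<And>m s t. m > n1 \<Longrightarrow> s \<in> C i \<Longrightarrow> t \<in> C i \<Longrightarrow> p s t > 0 \<Longrightarrow> P m s t > 0"
    and a1: "a1 \<in> C i" "mass w n1 a1 UNIV > 0"
  shows "lower_rate w i 0 0 0"
  unfolding lower_rate_def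
proof (intro allI impI)
  fix \<epsilon> :: real and T0 :: nat assume \<epsilon>: "\<epsilon> > 0"
  have ex: "\<exists>a\<in>C i. mass w (n1 + k) a UNIV > 0" for k
  proof (induction k)
    case 0 then show ?case using a1 by auto
  next
    case (Suc k)
    then obtain a where a: "a \<in> C i" "mass w (n1 + k) a UNIV > 0" by blast
    obtain zs where zs: "zs \<noteq> []" "set zs \<subseteq> C i" "steps (\<lambda>x y. p x y > 0) a zs"
      using irreducible_on_path[OF G_irreducible[OF i] p_nonneg_all a(1) a(1)] by metis
    then obtain z ws where z: "zs = z # ws" by (cases zs) auto
    have zC: "z \<in> C i" "p a z > 0" using zs z by auto
    have "mass w (n1 + k) a UNIV * (\<Sum>zs\<in>{[z]}. pathw P (n1 + k) a zs) \<le> mass w (n1 + k + 1) z UNIV"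
      by (rule mass_append[OF w]) auto
    moreover have "P (Suc (n1 + k)) a z > 0" using zC a by (intro pos) auto
    ultimately have "mass w (n1 + Suc k) z UNIV > 0" using a(2) by (auto intro: less_le_trans[OF mult_pos_pos])
    then show ?case using zC by blast
  qed
  obtain a where a: "a \<in> C i" "mass w (n1 + T0) a UNIV > 0" using ex[of T0] by blast
  define T where "T = n1 + T0"
  define \<mu> where "\<mu> = mass w T a UNIV"
  have \<mu>: "\<mu> > 0" using a by (simp add: \<mu>_def T_def)
  obtain n2 where n2: "\<forall>n\<ge>n2. max (real T) (max (R * real T) (- ln \<mu>)) \<le> \<epsilon> * real n"
    using eventually_const_le[OF \<epsilon>] by (rule exE)
  show "\<exists>n0. \<forall>n\<ge>n0. \<exists>T a. T0 \<le> T \<and> a \<in> C i \<and> \<bar>real T - 0 * real n\<bar> \<le> \<epsilon> * real n \<and>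
     exp (- (real n * (0 + \<epsilon>))) \<le> mass w T a {s. norm (s - real n *\<^sub>R 0) \<le> \<epsilon> * real n}"
  proof (rule exI[of _ n2], intro allI impI)
    fix n assume n: "n2 \<le> n"
    have 1: "T0 \<le> T" by (simp add: T_def)
    have 2: "\<bar>real T - 0 * real n\<bar> \<le> \<epsilon> * real n" using n2[rule_format, OF n] by simp
    have "exp (- (real n * (0 + \<epsilon>))) \<le> exp (ln \<mu>)" using n2[rule_format, OF n] by (simp add: mult.commute)
    also have "\<dots> = \<mu>" using \<mu> by simp
    also have "\<mu> \<le> mass w T a {s. norm (s - real n *\<^sub>R 0) \<le> \<epsilon> * real n}"
      unfolding \<mu>_def mass_def
    proof (intro sum_mono mult_left_mono w)
      fix x
      have "norm (sum_list (map f ys)) \<le> \<epsilon> * real n" if "length ys = T" for ys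
        using norm_sum_list_f_le[of ys] n2[rule_format, OF n] that by simp
      then have "{ys. length ys = T \<and> last (x # ys) = a \<and> sum_list (map f ys) \<in> UNIV}
          = {ys. length ys = T \<and> last (x # ys) = a \<and> sum_list (map f ys) \<in> {s. norm (s - real n *\<^sub>R 0) \<le> \<epsilon> * real n}}" by auto
      then show "(\<Sum>ys | length ys = T \<and> last (x # ys) = a \<and> sum_list (map f ys) \<in> UNIV. pathw P 0 x ys)
          \<le> (\<Sum>ys | length ys = T \<and> last (x # ys) = a \<and> sum_list (map f ys) \<in> {s. norm (s - real n *\<^sub>R 0) \<le> \<epsilon> * real n}. pathw P 0 x ys)"
        by (simp only:)
    qed
    finally have "exp (- (real n * (0 + \<epsilon>))) \<le> mass w T a {s. norm (s - real n *\<^sub>R 0) \<le> \<epsilon> * real n}" .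
    with 1 2 a(1) show "\<exists>T a. T0 \<le> T \<and> a \<in> C i \<and> \<bar>real T - 0 * real n\<bar> \<le> \<epsilon> * real n \<and>
       exp (- (real n * (0 + \<epsilon>))) \<le> mass w T a {s. norm (s - real n *\<^sub>R 0) \<le> \<epsilon> * real n}"
      by blast
  qed
qed

text \<open>The chain is first led to the base state \<open>a0\<close> within \<open>d\<close> steps
  and then repeats one near-optimal loop. Fixing the loop before \<open>n\<close> grows makes
  connection and rounding effects bounded, so they vanish on the scale of \<open>n\<close>.\<close>

lemma lower_rate_stay:
  assumes w: "\<And>x. 0 \<le> w x" and i: "i \<in> G" and lb: "lower_rate w i t y c" and t: "t \<ge> 0"
    and v: "v \<ge> 0" and c': "c' \<ge> 0" and I: "class_rate p f (C i) x \<le> ereal c'"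
  shows "lower_rate w i (t + v) (y + v *\<^sub>R x) (c + v * c')"
  unfolding lower_rate_def
proof (intro allI impI)
  fix \<epsilon> :: real and T0 :: nat assume \<epsilon>: "\<epsilon> > 0"
  \<comment> \<open>The errors add up to \<open>e * (2 + 2 * v + t) * real n\<close>: one
    \<open>e\<close> from the given mass, \<open>1 + t\<close> times \<open>e\<close> from the
    connecting path at time \<open>T\<close>, and \<open>2 * v\<close> times \<open>e\<close> from
    the rate of the loop and from replacing \<open>p\<close> by \<open>P\<close>.\<close>
  define e where "e = min 1 (\<epsilon> / (2 * (2 + 2 * v + t)))"
  have e: "e > 0" "e \<le> 1" using \<epsilon> v t by (auto simp: e_def)
  have "e \<le> \<epsilon> / (2 * (2 + 2 * v + t))" by (simp add: e_def)
  then have e2: "e * (2 + 2 * v + t) \<le> \<epsilon> / 2" using v t by (simp add: pos_le_divide_eq algebra_simps)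
  obtain a0 where a0: "a0 \<in> C i" using class_nonempty[OF G_subset[OF i]] by blast
  obtain m s where ms: "m \<ge> 1" "norm (s - real m *\<^sub>R x) \<le> e * real m" "exp (- (c' + e) * real m) \<le> loop_weight a0 m s"
    by (rule exists_loop[OF i a0 I e(1)])
  obtain d where d: "\<forall>b\<in>C i. \<exists>zs. length zs \<le> d \<and> steps (\<lambda>x y. p x y > 0) b zs \<and> last (b # zs) = a0"
    using path_to_state[OF i a0] by (rule exE)
  obtain T1 where T1: "\<forall>S\<ge>T1. \<forall>b zs. steps cheap b zs \<longrightarrow> length zs \<le> d \<longrightarrow>
    exp (- (real (S + d) * e)) \<le> pathw P S b zs"
    using cheap_path_weight[OF e(1), of d] by (rule exE)
  obtain T2 where T2: "\<forall>S\<ge>T2. \<forall>x ys. exp (- (real (length ys) * e)) * pathw (\<lambda>_. p) 0 x ys \<le> pathw P S x ys"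
    using pathw_ge_limit[OF e(1)] by (rule exE)
  obtain n1 where n1: "\<forall>n\<ge>n1. \<exists>T a. max T0 (max T1 T2) \<le> T \<and> a \<in> C i \<and>
     \<bar>real T - t * real n\<bar> \<le> e * real n \<and>
     exp (- (real n * (c + e))) \<le> mass w T a {s. norm (s - real n *\<^sub>R y) \<le> e * real n}"
    using lower_rateD[OF lb e(1), of "max T0 (max T1 T2)"] by (rule exE)
  obtain n2 where n2: "\<forall>n\<ge>n2. max (real d + real m) (R * real d + real m * norm x) \<le> (\<epsilon> / 2) * real n"
    using eventually_const_le[OF half_gt_zero[OF \<epsilon>]] by (rule exE)
  show "\<exists>n0. \<forall>n\<ge>n0. \<exists>T a. T0 \<le> T \<and> a \<in> C i \<and> \<bar>real T - (t + v) * real n\<bar> \<le> \<epsilon> * real n \<and>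
     exp (- (real n * (c + v * c' + \<epsilon>))) \<le> mass w T a {s. norm (s - real n *\<^sub>R (y + v *\<^sub>R x)) \<le> \<epsilon> * real n}"
  proof (rule exI[of _ "max n1 n2"], intro allI impI)
    fix n assume n: "max n1 n2 \<le> n"
    obtain T a where Ta: "max T0 (max T1 T2) \<le> T" "a \<in> C i" "\<bar>real T - t * real n\<bar> \<le> e * real n"
      "exp (- (real n * (c + e))) \<le> mass w T a {s. norm (s - real n *\<^sub>R y) \<le> e * real n}"
      using n1[rule_format, of n] n unfolding max.bounded_iff by blast
    have n2': "real d + real m \<le> (\<epsilon> / 2) * real n" "R * real d + real m * norm x \<le> (\<epsilon> / 2) * real n"
      using n2[rule_format, of n] n unfolding max.bounded_iff by auto
    have en: "e * (2 + 2 * v + t) * real n \<le> \<epsilon> / 2 * real n" using e2 by (intro mult_right_mono) auto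
    obtain zs where zs: "length zs \<le> d" "steps (\<lambda>x y. p x y > 0) a zs" "last (a # zs) = a0" using bspec[OF d Ta(2)] by blast
    \<comment> \<open>The loop is repeated as often as it fits into time \<open>v * n\<close>; as
      \<open>m\<close> does not depend on \<open>n\<close>, rounding costs a bounded time.\<close>
    define q where "q = nat \<lfloor>v * real n / real m\<rfloor>"
    have m0: "real m > 0" using ms(1) by simp
    have q0: "0 \<le> v * real n / real m" using v by simp
    have "real q \<le> v * real n / real m" "v * real n / real m \<le> real q + 1"
      using q0 by (auto simp: q_def of_nat_nat)
    then have qm: "real q * real m \<le> v * real n" "v * real n \<le> real q * real m + real m"
      using m0 by (auto simp: field_simps)
    let ?L = "loops a0 (q * m) (real q *\<^sub>R s)"
    let ?A = "(\<lambda>ys. zs @ ys) ` ?L"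
    let ?B = "{s. norm (s - real n *\<^sub>R y) \<le> e * real n}"
    let ?B' = "{s. norm (s - real n *\<^sub>R (y + v *\<^sub>R x)) \<le> \<epsilon> * real n}"
    define T' where "T' = T + (length zs + q * m)"
    have vn: "0 \<le> v * real n" "0 \<le> t * real n" "0 \<le> e * real n" "0 \<le> e * (v * real n)" "0 \<le> e * (t * real n)"
      using v t e by simp_all
    have en': "2 * (e * real n) + 2 * (e * (v * real n)) + e * (t * real n) \<le> \<epsilon> / 2 * real n"
      using en by (simp add: algebra_simps)
    have "mass w T a ?B * (\<Sum>us\<in>?A. pathw P T a us) \<le> mass w T' a0 ?B'"
      unfolding T'_def
    proof (rule mass_append[OF w])
      show "length us = length zs + q * m \<and> last (a # us) = a0" if "us \<in> ?A" for us
      proof -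
        obtain ys where "us = zs @ ys" "ys \<in> ?L" using \<open>us \<in> ?A\<close> by (rule imageE)
        then have ys: "us = zs @ ys" "length ys = q * m" "last (a0 # ys) = a0" unfolding loops_def by blast+
        show ?thesis unfolding ys(1) last_Cons_append zs(3) using ys by simp
      qed
      fix s0 us assume s0: "s0 \<in> ?B" and "us \<in> ?A"
      then obtain ys where "us = zs @ ys" "ys \<in> ?L" by (elim imageE)
      then have ys: "us = zs @ ys" "sum_list (map f ys) = real q *\<^sub>R s" unfolding loops_def by blast+
      have "s0 + sum_list (map f us) - real n *\<^sub>R (y + v *\<^sub>R x)
          = (s0 - real n *\<^sub>R y) + (sum_list (map f zs) + (real q *\<^sub>R (s - real m *\<^sub>R x) + (real q * real m - v * real n) *\<^sub>R x))"
        by (simp add: ys algebra_simps)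
      also have "norm \<dots> \<le> norm (s0 - real n *\<^sub>R y) + (norm (sum_list (map f zs)) + (norm (real q *\<^sub>R (s - real m *\<^sub>R x)) + norm ((real q * real m - v * real n) *\<^sub>R x)))"
        by (intro norm_triangle_mono order_refl)
      also have "\<dots> \<le> e * real n + (R * real d + (e * (v * real n) + real m * norm x))"
      proof (intro add_mono)
        show "norm (s0 - real n *\<^sub>R y) \<le> e * real n" using s0 by simp
        have "R * real (length zs) \<le> R * real d" using zs(1) R_nonneg by (intro mult_left_mono) auto
        then show "norm (sum_list (map f zs)) \<le> R * real d" using norm_sum_list_f_le[of zs] by linarith
        have "norm (real q *\<^sub>R (s - real m *\<^sub>R x)) \<le> real q * (e * real m)" using ms(2) by (simp add: mult_left_mono)
        also have "\<dots> = e * (real q * real m)" by simp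
        also have "\<dots> \<le> e * (v * real n)" using qm e by (intro mult_left_mono) auto
        finally show "norm (real q *\<^sub>R (s - real m *\<^sub>R x)) \<le> e * (v * real n)" .
        have "\<bar>real q * real m - v * real n\<bar> \<le> real m" using qm m0 by linarith
        then show "norm ((real q * real m - v * real n) *\<^sub>R x) \<le> real m * norm x" by (simp add: mult_right_mono)
      qed
      also have "\<dots> \<le> \<epsilon> * real n" using n2'(2) en' vn by linarith
      finally show "s0 + sum_list (map f us) \<in> ?B'" by simp
    qed
    moreover have "exp (- (real (T + d) * e)) * (exp (- (real (q * m) * e)) * exp (- (c' + e) * (real q * real m))) \<le> (\<Sum>us\<in>?A. pathw P T a us)"
    proof -
      have "(\<Sum>us\<in>?A. pathw P T a us) = (\<Sum>ys\<in>?L. pathw P T a zs * pathw P (T + length zs) a0 ys)"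
        by (subst sum.reindex) (auto simp: inj_on_def pathw_append zs(3)[simplified] intro!: sum.cong)
      also have "\<dots> = pathw P T a zs * (\<Sum>ys\<in>?L. pathw P (T + length zs) a0 ys)" by (simp add: sum_distrib_left)
      finally have eq: "(\<Sum>us\<in>?A. pathw P T a us) = pathw P T a zs * (\<Sum>ys\<in>?L. pathw P (T + length zs) a0 ys)" .
      have 1: "exp (- (real (T + d) * e)) \<le> pathw P T a zs"
        using Ta(1) zs by (intro T1[rule_format] steps_mono[OF zs(2) cheap_of_pos]) auto
      have "exp (- (c' + e) * (real q * real m)) = exp (- (c' + e) * real m) ^ q"
        unfolding exp_of_nat_mult[symmetric] by (simp add: mult_ac)
      also have "\<dots> \<le> loop_weight a0 m s ^ q" by (intro power_mono ms(3)) simp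
      also have "\<dots> \<le> loop_weight a0 (q * m) (real q *\<^sub>R s)" by (rule loop_weight_power)
      finally have 2: "exp (- (c' + e) * (real q * real m)) \<le> loop_weight a0 (q * m) (real q *\<^sub>R s)" .
      have "exp (- (real (q * m) * e)) * loop_weight a0 (q * m) (real q *\<^sub>R s) = (\<Sum>ys\<in>?L. exp (- (real (q * m) * e)) * pathw (\<lambda>_. p) 0 a0 ys)"
        by (simp add: loop_weight_def sum_distrib_left)
      also have "\<dots> \<le> (\<Sum>ys\<in>?L. pathw P (T + length zs) a0 ys)"
      proof (rule sum_mono)
        fix ys assume "ys \<in> ?L"
        then have "length ys = q * m" by (simp add: loops_def)
        then show "exp (- (real (q * m) * e)) * pathw (\<lambda>_. p) 0 a0 ys \<le> pathw P (T + length zs) a0 ys"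
          using T2[rule_format, of "T + length zs" ys a0] Ta(1) by simp
      qed
      finally have "exp (- (real (q * m) * e)) * exp (- (c' + e) * (real q * real m)) \<le> (\<Sum>ys\<in>?L. pathw P (T + length zs) a0 ys)"
        using 2 by (meson exp_ge_zero mult_left_mono order_trans)
      then show ?thesis unfolding eq using 1 by (intro mult_mono) (auto intro: order_trans[OF exp_ge_zero])
    qed
    ultimately have "exp (- (real n * (c + e))) * (exp (- (real (T + d) * e)) * (exp (- (real (q * m) * e)) * exp (- (c' + e) * (real q * real m)))) \<le> mass w T' a0 ?B'"
      using Ta(4) mass_nonneg[of w T a ?B, OF w]
      by (meson exp_ge_zero mult_mono mult_nonneg_nonneg order_trans)
    moreover have "exp (- (real n * (c + v * c' + \<epsilon>))) \<le> exp (- (real n * (c + e))) * (exp (- (real (T + d) * e)) * (exp (- (real (q * m) * e)) * exp (- (c' + e) * (real q * real m))))"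
    proof -
      have "real T * e \<le> (t * real n + real n) * e"
      proof (rule mult_right_mono)
        have "e * real n \<le> 1 * real n" using e by (intro mult_right_mono) auto
        then show "real T \<le> t * real n + real n" using Ta(3) by linarith
      qed (use e in simp)
      moreover have "real d * e \<le> real d * 1" using e by (intro mult_left_mono) auto
      moreover have "real q * real m * e \<le> v * real n * e" using qm e by (intro mult_right_mono) auto
      moreover have "(c' + e) * (real q * real m) \<le> (c' + e) * (v * real n)" using qm e c' by (intro mult_left_mono) auto
      ultimately have "real n * (c + e) + (real (T + d) * e + (real (q * m) * e + (c' + e) * (real q * real m))) \<le> real n * (c + v * c' + \<epsilon>)"
        using n2'(1) en' m0 by (simp add: algebra_simps)
      then show ?thesis by (simp add: exp_add[symmetric] algebra_simps)
    qed
    ultimately have "exp (- (real n * (c + v * c' + \<epsilon>))) \<le> mass w T' a0 ?B'" by linarith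
    moreover have "\<bar>real T' - (t + v) * real n\<bar> \<le> \<epsilon> * real n"
    proof -
      have "real T' - (t + v) * real n = (real T - t * real n) + real (length zs) + (real q * real m - v * real n)"
        by (simp add: T'_def algebra_simps)
      then have "\<bar>real T' - (t + v) * real n\<bar> \<le> e * real n + real d + real m" using Ta(3) zs(1) qm by linarith
      also have "\<dots> \<le> \<epsilon> * real n" using n2'(1) en' vn by linarith
      finally show ?thesis .
    qed
    moreover have "T0 \<le> T'" using Ta(1) by (simp add: T'_def)
    ultimately show "\<exists>T a. T0 \<le> T \<and> a \<in> C i \<and> \<bar>real T - (t + v) * real n\<bar> \<le> \<epsilon> * real n \<and>
       exp (- (real n * (c + v * c' + \<epsilon>))) \<le> mass w T a ?B'"
      using a0 by blast
  qed
qed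

text \<open>Uniformity in the departure state \<open>b\<close> matters, since
  \<open>lower_rate\<close> does not reveal where in the class the chain is; \<open>r\<close> bounds
  the duration, so a crossing that starts at time \<open>S\<close> has weight about
  \<open>exp (real S * u)\<close> or more.\<close>

definition crossable :: "nat \<Rightarrow> nat \<Rightarrow> real \<Rightarrow> bool" where
  "crossable i j u \<longleftrightarrow> (\<forall>e>0. \<exists>r T1. \<forall>S\<ge>T1. \<forall>b\<in>C i. \<exists>zs. length zs \<le> r \<and> last (b # zs) \<in> C j \<and>
     exp (- (real (S + r) * (e - u))) \<le> pathw P S b zs)"

text \<open>The jump takes place at time \<open>t * n\<close> up to an error, and a crossing at that
  time has weight about \<open>exp (t * n * u)\<close>; its bounded duration changes neither the
  time nor the sum on the scale of \<open>n\<close>.\<close>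

lemma lower_rate_jump:
  assumes w: "\<And>x. 0 \<le> w x" and lb: "lower_rate w i t y c" and t: "t \<ge> 0"
    and u: "u \<le> 0" and cross: "crossable i j u"
  shows "lower_rate w j t y (c - t * u)"
  unfolding lower_rate_def
proof (intro allI impI)
  fix \<epsilon> :: real and T0 :: nat assume \<epsilon>: "\<epsilon> > 0"
  \<comment> \<open>The loss per unit of \<open>n\<close> is \<open>e\<close> from the given mass,
    \<open>t * e\<close> from the slack of the crossing and at most \<open>e * (1 - u)\<close> from
    the uncertainty of \<open>T\<close>, where \<open>e * e \<le> e\<close>.\<close>
  define e where "e = min 1 (\<epsilon> / (2 * (t + 2 - u)))"
  have e: "e > 0" "e \<le> 1" using \<epsilon> u t by (auto simp: e_def)
  have "e \<le> \<epsilon> / (2 * (t + 2 - u))" by (simp add: e_def)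
  then have e2: "e * (t + 2 - u) \<le> \<epsilon> / 2" using u t by (simp add: pos_le_divide_eq algebra_simps)
  obtain r T1 where rT: "\<forall>S\<ge>T1. \<forall>b\<in>C i. \<exists>zs. length zs \<le> r \<and> last (b # zs) \<in> C j \<and>
     exp (- (real (S + r) * (e - u))) \<le> pathw P S b zs"
    using cross[unfolded crossable_def, rule_format, OF e(1)] by (elim exE)
  obtain n1 where n1: "\<forall>n\<ge>n1. \<exists>T a. max T0 T1 \<le> T \<and> a \<in> C i \<and>
     \<bar>real T - t * real n\<bar> \<le> e * real n \<and>
     exp (- (real n * (c + e))) \<le> mass w T a {s. norm (s - real n *\<^sub>R y) \<le> e * real n}"
    using lower_rateD[OF lb e(1), of "max T0 T1"] by (rule exE)
  obtain n2 where n2: "\<forall>n\<ge>n2. max (real r * (e - u)) (max (real r) (R * real r)) \<le> (\<epsilon> / 2) * real n"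
    using eventually_const_le[OF half_gt_zero[OF \<epsilon>]] by (rule exE)
  show "\<exists>n0. \<forall>n\<ge>n0. \<exists>T a. T0 \<le> T \<and> a \<in> C j \<and> \<bar>real T - t * real n\<bar> \<le> \<epsilon> * real n \<and>
     exp (- (real n * (c - t * u + \<epsilon>))) \<le> mass w T a {s. norm (s - real n *\<^sub>R y) \<le> \<epsilon> * real n}"
  proof (rule exI[of _ "max n1 n2"], intro allI impI)
    fix n assume n: "max n1 n2 \<le> n"
    obtain T a where Ta: "max T0 T1 \<le> T" "a \<in> C i" "\<bar>real T - t * real n\<bar> \<le> e * real n"
      "exp (- (real n * (c + e))) \<le> mass w T a {s. norm (s - real n *\<^sub>R y) \<le> e * real n}"
      using n1[rule_format, of n] n unfolding max.bounded_iff by blast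
    have n2': "real r * (e - u) \<le> (\<epsilon> / 2) * real n" "real r \<le> (\<epsilon> / 2) * real n" "R * real r \<le> (\<epsilon> / 2) * real n"
      using n2[rule_format, of n] n unfolding max.bounded_iff by auto
    have en: "e * (t + 2 - u) * real n \<le> \<epsilon> / 2 * real n" using e2 by (intro mult_right_mono) auto
    have en1: "e * real n \<le> \<epsilon> / 2 * real n"
    proof -
      have "e * 1 \<le> e * (t + 2 - u)" using e u t by (intro mult_left_mono) auto
      then have "e \<le> \<epsilon> / 2" using e2 by linarith
      then show ?thesis by (rule mult_right_mono) simp
    qed
    obtain zs where zs: "length zs \<le> r" "last (a # zs) \<in> C j" "exp (- (real (T + r) * (e - u))) \<le> pathw P T a zs"
      using rT[rule_format, of T a] Ta by auto
    let ?B = "{s. norm (s - real n *\<^sub>R y) \<le> e * real n}"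
    let ?B' = "{s. norm (s - real n *\<^sub>R y) \<le> \<epsilon> * real n}"
    have "mass w T a ?B * (\<Sum>us\<in>{zs}. pathw P T a us) \<le> mass w (T + length zs) (last (a # zs)) ?B'"
    proof (rule mass_append[OF w])
      fix s0 us assume s0: "s0 \<in> ?B" and us: "us \<in> {zs}"
      have "norm (s0 + sum_list (map f us) - real n *\<^sub>R y) = norm ((s0 - real n *\<^sub>R y) + sum_list (map f us))"
        by (simp add: algebra_simps)
      also have "\<dots> \<le> norm (s0 - real n *\<^sub>R y) + norm (sum_list (map f us))" by (rule norm_triangle_ineq)
      also have "\<dots> \<le> e * real n + R * real r"
      proof (rule add_mono)
        show "norm (s0 - real n *\<^sub>R y) \<le> e * real n" using s0 by simp
        have "R * real (length zs) \<le> R * real r" using zs(1) R_nonneg by (intro mult_left_mono) auto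
        then show "norm (sum_list (map f us)) \<le> R * real r" using norm_sum_list_f_le[of us] us by simp
      qed
      also have "\<dots> \<le> \<epsilon> * real n" using n2'(3) en1 by linarith
      finally show "s0 + sum_list (map f us) \<in> ?B'" by simp
    qed auto
    moreover have "exp (- (real n * (c + e))) * exp (- (real (T + r) * (e - u))) \<le> mass w T a ?B * pathw P T a zs"
      using Ta(4) zs(3) by (intro mult_mono) (auto intro: mass_nonneg w)
    moreover have "exp (- (real n * (c - t * u + \<epsilon>))) \<le> exp (- (real n * (c + e))) * exp (- (real (T + r) * (e - u)))"
    proof -
      have "real T * (e - u) \<le> (t * real n + e * real n) * (e - u)"
        using Ta(3) e u by (intro mult_right_mono) auto
      moreover have "e * real n * e \<le> e * real n * 1" using e by (intro mult_left_mono) auto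
      ultimately have "real n * (c + e) + real (T + r) * (e - u) \<le> real n * (c - t * u + \<epsilon>)"
        using n2'(1) en by (simp add: algebra_simps)
      then show ?thesis by (simp add: exp_add[symmetric] algebra_simps)
    qed
    ultimately have "exp (- (real n * (c - t * u + \<epsilon>))) \<le> mass w (T + length zs) (last (a # zs)) ?B'" by simp
    moreover have "\<bar>real (T + length zs) - t * real n\<bar> \<le> \<epsilon> * real n"
    proof -
      have "\<bar>real (T + length zs) - t * real n\<bar> \<le> e * real n + real r" using Ta(3) zs(1) by simp
      also have "\<dots> \<le> \<epsilon> * real n" using n2'(2) en1 by linarith
      finally show ?thesis .
    qed
    moreover have "T0 \<le> T + length zs" using Ta(1) by simp
    ultimately show "\<exists>T a. T0 \<le> T \<and> a \<in> C j \<and> \<bar>real T - t * real n\<bar> \<le> \<epsilon> * real n \<and>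
       exp (- (real n * (c - t * u + \<epsilon>))) \<le> mass w T a ?B'"
      using zs(2) by blast
  qed
qed

text \<open>\<open>x n\<close> and \<open>y n\<close> are the two ends of the good step that ends at
  time \<open>n\<close>. A path \<open>zs\<close> that starts at time \<open>S\<close> arrives at
  time \<open>S + length zs\<close>, so the step that follows ends at the successor of that time,
  and \<open>zs\<close> has to arrive at the departure state belonging to it.\<close>

lemma crossable_via:
  assumes y: "\<And>n. y n \<in> C j"
    and rate: "\<And>e. e > 0 \<Longrightarrow> \<forall>\<^sub>F n in sequentially. exp (real n * (u - e)) \<le> P n (x n) (y n)"
    and reach: "\<And>S b. b \<in> C i \<Longrightarrow> \<exists>zs. length zs \<le> r \<and> steps cheap b zs \<and> last (b # zs) = x (Suc (S + length zs))"
    and u: "u \<le> 0"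
  shows "crossable i j u"
  unfolding crossable_def
proof (intro allI impI)
  fix e :: real assume e: "e > 0"
  define e' where "e' = e / 2"
  have e': "e' > 0" using e by (simp add: e'_def)
  obtain T1 where T1: "\<forall>S\<ge>T1. \<forall>b zs. steps cheap b zs \<longrightarrow> length zs \<le> r \<longrightarrow>
    exp (- (real (S + r) * e')) \<le> pathw P S b zs"
    using cheap_path_weight[OF e', of r] by (rule exE)
  obtain T2 where T2: "\<forall>n\<ge>T2. exp (real n * (u - e')) \<le> P n (x n) (y n)"
    using rate[OF e'] unfolding eventually_sequentially by (rule exE)
  show "\<exists>r T1. \<forall>S\<ge>T1. \<forall>b\<in>C i. \<exists>zs. length zs \<le> r \<and> last (b # zs) \<in> C j \<and> exp (- (real (S + r) * (e - u))) \<le> pathw P S b zs"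
  proof (rule exI[of _ "Suc r"], rule exI[of _ "max T1 T2"], intro allI impI ballI)
    fix S b assume S: "max T1 T2 \<le> S" and b: "b \<in> C i"
    obtain zs where zs: "length zs \<le> r" "steps cheap b zs" "last (b # zs) = x (Suc (S + length zs))"
      using reach[OF b] by blast
    let ?n = "Suc (S + length zs)"
    let ?us = "zs @ [y ?n]"
    have 1: "exp (- (real (S + r) * e')) \<le> pathw P S b zs" using T1 zs S by simp
    have 2: "exp (real ?n * (u - e')) \<le> P ?n (x ?n) (y ?n)" by (rule T2[rule_format]) (use S in simp)
    have "real ?n * (e' - u) \<le> real (S + Suc r) * (e' - u)"
      by (rule mult_right_mono) (use zs(1) e' u in auto)
    moreover have "real (S + r) * e' \<le> real (S + Suc r) * e'" using e' by (intro mult_right_mono) auto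
    moreover have "real (S + Suc r) * (e - u) = real (S + Suc r) * e' + real (S + Suc r) * (e' - u)"
      unfolding e'_def distrib_left[symmetric] by simp
    moreover have "real ?n * (u - e') = - (real ?n * (e' - u))"
      unfolding mult_minus_right[symmetric] by simp
    ultimately have "- (real (S + Suc r) * (e - u)) \<le> - (real (S + r) * e') + real ?n * (u - e')" by linarith
    then have "exp (- (real (S + Suc r) * (e - u))) \<le> exp (- (real (S + r) * e')) * exp (real ?n * (u - e'))"
      unfolding exp_add[symmetric] by simp
    also have "\<dots> \<le> pathw P S b zs * P ?n (x ?n) (y ?n)"
      using 1 2 by (intro mult_mono) (auto intro: order_trans[OF exp_ge_zero])
    also have "\<dots> = pathw P S b ?us" unfolding pathw_append zs(3) by simp
    finally have "exp (- (real (S + Suc r) * (e - u))) \<le> pathw P S b ?us" .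
    moreover have "length ?us \<le> Suc r" using zs(1) by simp
    moreover have "last (b # ?us) \<in> C j" using y by simp
    ultimately show "\<exists>zs. length zs \<le> Suc r \<and> last (b # zs) \<in> C j \<and> exp (- (real (S + Suc r) * (e - u))) \<le> pathw P S b zs"
      by blast
  qed
qed

section \<open>Crossings between classes under either assumption\<close>

lemma degenerate_reach:
  assumes "i \<in> {1..K}" "i \<notin> G" "a \<in> C i" "b \<in> C i"
  shows "length [] \<le> (r :: nat) \<and> steps cheap b [] \<and> last (b # []) = a"
  using degenerate_class(1)[OF assms(1,2,3)] assms(4) by simp

text \<open>The departure state \<open>a\<close> is the same at all times, so it does not matter how
  long the way to it takes, as long as this is bounded; irreducibility provides it in a
  nondegenerate class, and a degenerate class consists of \<open>a\<close> alone.\<close>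

lemma crossable_B:
  assumes A: "assumption_A K P C" and B: "assumption_B K P C"
    and ij: "i \<in> {1..K}" "j \<in> {1..K}" "i \<noteq> j" and u: "ups i j = ereal u"
  shows "crossable i j u"
proof -
  have u0: "u \<le> 0" using ups_nonpos[OF ij(1,2)] u by (simp add: zero_ereal_def)
  have low: "lower_cost P C i j = ereal u" using A ij u unfolding assumption_A_def by simp
  obtain a b where a: "a \<in> C i" and b: "\<forall>n. b n \<in> C j"
    and lim: "log_rate (\<lambda>n. P n a (b n)) \<longlonglongrightarrow> lower_cost P C i j"
    using B ij unfolding assumption_B_def by blast
  have "liminf (log_rate (\<lambda>n. P n a (b n))) = ereal u"
    using lim_imp_Liminf[OF _ lim] low by simp
  then have rate: "\<forall>\<^sub>F n in sequentially. exp (real n * (u - e)) \<le> P n a (b n)" if "e > 0" for e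
    using that by (intro eventually_ge_exp_of_liminf) simp
  show ?thesis
  proof (cases "i \<in> G")
    case True
    obtain d where d: "\<forall>b\<in>C i. \<exists>zs. length zs \<le> d \<and> steps (\<lambda>x y. p x y > 0) b zs \<and> last (b # zs) = a"
      using path_to_state[OF True a] by (rule exE)
    show ?thesis
    proof (rule crossable_via[where x = "\<lambda>_. a" and y = b and r = d, OF _ rate _ u0])
      fix S :: nat and c assume "c \<in> C i"
      then obtain zs where zs: "length zs \<le> d" "steps (\<lambda>x y. p x y > 0) c zs" "last (c # zs) = a" using bspec[OF d] by blast
      have "steps cheap c zs" by (rule steps_mono[OF zs(2) cheap_of_pos])
      with zs show "\<exists>zs. length zs \<le> d \<and> steps cheap c zs \<and> last (c # zs) = a" by blast
    qed (use b in auto)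
  next
    case False
    show ?thesis
    proof (rule crossable_via[where x = "\<lambda>_. a" and y = b and r = 0, OF _ rate _ u0])
      show "\<exists>zs. length zs \<le> 0 \<and> steps cheap c zs \<and> last (c # zs) = a" if "c \<in> C i" for c
        using degenerate_reach[OF ij(1) False a that] by blast
    qed (use b in auto)
  qed
qed

lemma cheap_of_augmented:
  assumes "augmented_matrix p P x y > 0"
  shows "cheap x y"
proof (cases "p x y > 0")
  case True then show ?thesis by (rule cheap_of_pos)
next
  case False
  then have l: "liminf (log_rate (\<lambda>n. P n x y)) = 0"
    using assms by (simp add: augmented_matrix_def split: if_splits)
  show ?thesis
    unfolding cheap_def
  proof (intro allI impI)
    fix e :: real assume "e > 0"
    then have "\<forall>\<^sub>F k in sequentially. exp (real k * (- e)) \<le> P k x y"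
      using l by (intro eventually_ge_exp_of_liminf) (simp add: zero_ereal_def)
    then show "\<forall>\<^sub>F k in sequentially. exp (- (real k * e)) \<le> P k x y" by simp
  qed
qed

text \<open>The best transition may leave from a state that changes with time. Primitivity of the
  augmented matrix gives, between any two states of the class, a path of exactly \<open>r\<close>
  cheap steps, so the time of arrival is fixed before the target state is chosen.\<close>

lemma crossable_C:
  assumes A: "assumption_A K P C" and prim: "assumption_C p P C G"
    and ij: "i \<in> {1..K}" "j \<in> {1..K}" "i \<noteq> j" and u: "ups i j = ereal u"
  shows "crossable i j u"
proof -
  have u0: "u \<le> 0" using ups_nonpos[OF ij(1,2)] u by (simp add: zero_ereal_def)
  have low: "liminf (log_rate (max_transition P C i j)) = ereal u"
    using A ij u unfolding assumption_A_def lower_cost_def by simp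
  have "\<exists>t. fst t \<in> C i \<and> snd t \<in> C j \<and> max_transition P C i j n = P n (fst t) (snd t)" for n
    by (rule max_transition_attained[OF ij(1,2), of n]) auto
  then have "\<exists>t. \<forall>n. fst (t n) \<in> C i \<and> snd (t n) \<in> C j \<and> max_transition P C i j n = P n (fst (t n)) (snd (t n))"
    by (intro choice allI)
  then obtain t where t: "\<And>n. fst (t n) \<in> C i" "\<And>n. snd (t n) \<in> C j"
    "\<And>n. max_transition P C i j n = P n (fst (t n)) (snd (t n))" by auto
  have rate: "\<forall>\<^sub>F n in sequentially. exp (real n * (u - e)) \<le> P n (fst (t n)) (snd (t n))" if "e > 0" for e
    unfolding t(3)[symmetric] using that low by (intro eventually_ge_exp_of_liminf) simp
  show ?thesis
  proof (cases "i \<in> G")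
    case True
    have "\<forall>x y. 0 \<le> augmented_matrix p P x y" by (simp add: augmented_matrix_def)
    note power_pos = matrix_power_pos_iff[OF this]
    obtain r where r: "\<forall>x\<in>C i. \<forall>y\<in>C i. matrix_power (C i) (augmented_matrix p P) r x y > 0"
      using prim True unfolding assumption_C_def primitive_on_def by blast
    show ?thesis
    proof (rule crossable_via[where x = "\<lambda>n. fst (t n)" and y = "\<lambda>n. snd (t n)" and r = r, OF t(2) rate _ u0])
      fix S :: nat and b assume "b \<in> C i"
      then have "matrix_power (C i) (augmented_matrix p P) r b (fst (t (Suc (S + r)))) > 0" using r t(1) by blast
      then obtain zs where zs: "length zs = r" "steps (\<lambda>x y. augmented_matrix p P x y > 0) b zs" "last (b # zs) = fst (t (Suc (S + r)))"
        unfolding power_pos by blast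
      have "steps cheap b zs" by (rule steps_mono[OF zs(2) cheap_of_augmented])
      with zs show "\<exists>zs. length zs \<le> r \<and> steps cheap b zs \<and> last (b # zs) = fst (t (Suc (S + length zs)))"
        by (intro exI[of _ zs]) simp
    qed
  next
    case False
    show ?thesis
    proof (rule crossable_via[where x = "\<lambda>n. fst (t n)" and y = "\<lambda>n. snd (t n)" and r = 0, OF t(2) rate _ u0])
      show "\<exists>zs. length zs \<le> 0 \<and> steps cheap c zs \<and> last (c # zs) = fst (t (Suc (S + length zs)))" if "c \<in> C i" for S c
        using degenerate_reach[OF ij(1) False t(1) that] by blast
    qed
  qed
qed

text \<open>All classes on the route are crossed at time \<open>t * n\<close> up to an error, so
  every step is charged the same time \<open>t\<close> and the charges add up to
  \<open>route_cost\<close>. A finite sum of costs has finite summands because all are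
  nonpositive.\<close>

lemma lower_rate_route:
  assumes w: "\<And>x. 0 \<le> w x" and t: "t \<ge> 0"
    and cross: "\<And>i j u. i \<in> {1..K} \<Longrightarrow> j \<in> {1..K} \<Longrightarrow> i \<noteq> j \<Longrightarrow> ups i j = ereal u \<Longrightarrow> crossable i j u"
  shows "lower_rate w (hd l) t y c \<Longrightarrow> l \<noteq> [] \<Longrightarrow> distinct l \<Longrightarrow> set l \<subseteq> {1..K} \<Longrightarrow> route_cost l = ereal u \<Longrightarrow>
    lower_rate w (last l) t y (c - t * u)"
proof (induction l arbitrary: c u rule: route_cost.induct)
  case (1 i j l)
  have ij: "i \<in> {1..K}" "j \<in> {1..K}" "i \<noteq> j" using "1.prems" by auto
  have u: "ups i j + route_cost (j # l) = ereal u" using "1.prems" by simp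
  have "ups i j \<le> 0" "route_cost (j # l) \<le> 0" using ups_nonpos[OF ij(1,2)] route_cost_nonpos[of "j # l"] "1.prems" by auto
  then obtain u1 u2 where u12: "ups i j = ereal u1" "route_cost (j # l) = ereal u2" "u = u1 + u2"
    using u by (cases "ups i j"; cases "route_cost (j # l)") auto
  have u1: "u1 \<le> 0" using \<open>ups i j \<le> 0\<close> u12 by (simp add: zero_ereal_def)
  have lb: "lower_rate w i t y c" using "1.prems"(1) by simp
  have "lower_rate w j t y (c - t * u1)"
    by (rule lower_rate_jump[OF w lb t u1 cross[OF ij u12(1)]])
  then have "lower_rate w (last (j # l)) t y (c - t * u1 - t * u2)"
    using "1.prems" u12 by (intro "1.IH") auto
  then show ?case using u12 by (simp add: algebra_simps)
next
  case ("2_1")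
  then show ?case by simp
next
  case ("2_2" i)
  then show ?case by (simp add: zero_ereal_def)
qed

text \<open>The classes are visited in the order \<open>\<sigma>\<close>, for a time
  \<open>\<kappa> * v i * n\<close> each, and the jump to the next one happens at the fraction
  \<open>\<kappa> * V v i\<close> of \<open>n\<close>, which reproduces the weights of
  \<open>path_cost\<close>. The factor \<open>\<kappa>\<close> scales the cost as well, which does
  no harm because the cost is nonnegative.\<close>

lemma lower_rate_total:
  assumes w: "\<And>x. 0 \<le> w x" and start: "\<And>i. i \<in> G \<Longrightarrow> lower_rate w i 0 0 0"
    and cross: "\<And>i j u. i \<in> {1..K} \<Longrightarrow> j \<in> {1..K} \<Longrightarrow> i \<noteq> j \<Longrightarrow> ups i j = ereal u \<Longrightarrow> crossable i j u"
    and \<sigma>: "\<sigma> permutes {1..M}" and v: "v \<in> prob_vectors M"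
    and cost: "path_cost M \<zeta> (\<lambda>i. class_rate p f (C i)) (U0 K P C) v \<sigma> x < ereal \<beta>"
    and \<kappa>: "0 < \<kappa>" "\<kappa> < 1"
  shows "lower_rate w (\<zeta> (\<sigma> M)) \<kappa> (\<kappa> *\<^sub>R (\<Sum>i=1..M. v i *\<^sub>R x i)) \<beta>"
proof -
  have s_in: "\<sigma> i \<in> {1..M}" if "i \<in> {1..M}" for i using perm_in(1)[OF \<sigma> that] .
  have G: "\<zeta> (\<sigma> i) \<in> G" if "i \<in> {1..M}" for i using \<zeta>_in[OF s_in[OF that]] .
  have v0: "0 \<le> v i" if "i \<in> {1..M}" for i using v that by (simp add: prob_vectors_def)
  have v1: "(\<Sum>i=1..M. v i) = 1" using v by (simp add: prob_vectors_def)
  have V0: "0 \<le> V v i" if "i \<in> {1..M}" for i using v0 that by (auto intro!: sum_nonneg)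
  define I where "I i = class_rate p f (C (\<zeta> (\<sigma> i))) (x i)" for i
  define U where "U i = U0 K P C (\<zeta> (\<sigma> i)) (\<zeta> (\<sigma> (i + 1)))" for i
  define r where "r i = real_of_ereal (I i)" for i
  define u where "u i = real_of_ereal (U i)" for i
  let ?S1 = "\<Sum>i=1..<M. ereal (V v i) * - U i"
  let ?S2 = "\<Sum>i=1..M. ereal (v i) * I i"
  have I0: "0 \<le> I i" if "i \<in> {1..M}" for i unfolding I_def by (rule I_nonneg[OF s_in[OF that]])
  have U_le: "U i \<le> 0" if "i \<in> {1..<M}" for i unfolding U_def by (rule perm_in(2)[OF \<sigma> that])
  have t1: "0 \<le> ereal (V v i) * - U i" if "i \<in> {1..<M}" for i
    using V0[of i] that U_le[OF that] by (intro ereal_0_le_mult) (auto simp: ereal_0_le_uminus_iff)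
  have t2: "0 \<le> ereal (v i) * I i" if "i \<in> {1..M}" for i
    using v0[OF that] I0[OF that] by (intro ereal_0_le_mult) auto
  have S0: "0 \<le> ?S1" "0 \<le> ?S2" using t1 t2 by (intro sum_nonneg; simp)+
  have pc: "?S1 + ?S2 < ereal \<beta>" using cost unfolding path_cost_eq[OF \<sigma> v] I_def U_def .
  have S1: "?S1 < \<infinity>" and S2: "?S2 < \<infinity>" using pc S0 by (cases ?S1; cases ?S2; simp)+
  \<comment> \<open>A finite total forces a finite rate only where the weight is positive; where the
    weight is 0 the rate may be infinite, and 0 times infinity removes it from the sum.\<close>
  have I_real: "I i = ereal (r i)" "0 \<le> r i" if i: "i \<in> {1..M}" and vi: "v i > 0" for i
  proof -
    have "ereal (v i) * I i \<le> ?S2" by (rule member_le_sum_ereal[OF _ i t2]) auto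
    then have "ereal (v i) * I i \<noteq> \<infinity>" using S2 by auto
    then have "I i \<noteq> \<infinity>" using vi by auto
    then show "I i = ereal (r i)" using I0[OF i] by (cases "I i") (auto simp: r_def)
    then show "0 \<le> r i" using I0[OF i] by (simp add: zero_ereal_def)
  qed
  have U_real: "U i = ereal (u i)" if i: "i \<in> {1..<M}" and Vi: "V v i > 0" for i
  proof -
    have "ereal (V v i) * - U i \<le> ?S1" by (rule member_le_sum_ereal[OF _ i t1]) auto
    then have ne: "ereal (V v i) * - U i \<noteq> \<infinity>" using S1 by auto
    show ?thesis
    proof (cases "U i")
      case MInf
      then show ?thesis using ne Vi by simp
    qed (use U_le[OF i] in \<open>auto simp: u_def\<close>)
  qed
  have S1_eq: "?S1 = ereal (\<Sum>i=1..<M. V v i * - u i)"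
  proof -
    have "ereal (V v i) * - U i = ereal (V v i * - u i)" if i: "i \<in> {1..<M}" for i
    proof (cases "V v i > 0")
      case True then show ?thesis using U_real[OF i] by simp
    next
      case False
      then have "V v i = 0" using V0[of i] i by simp
      then show ?thesis by (simp add: zero_ereal_def[symmetric])
    qed
    then have "?S1 = (\<Sum>i=1..<M. ereal (V v i * - u i))" by (intro sum.cong refl)
    also have "\<dots> = ereal (\<Sum>i=1..<M. V v i * - u i)" by (rule sum_ereal)
    finally show ?thesis .
  qed
  have S2_eq: "?S2 = ereal (\<Sum>i=1..M. v i * r i)"
  proof -
    have "ereal (v i) * I i = ereal (v i * r i)" if i: "i \<in> {1..M}" for i
    proof (cases "v i > 0")
      case True then show ?thesis using I_real[OF i] by simp
    next
      case False
      then have "v i = 0" using v0[OF i] by simp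
      then show ?thesis by (simp add: zero_ereal_def[symmetric])
    qed
    then have "?S2 = (\<Sum>i=1..M. ereal (v i * r i))" by (intro sum.cong refl)
    also have "\<dots> = ereal (\<Sum>i=1..M. v i * r i)" by (rule sum_ereal)
    finally show ?thesis .
  qed
  define y where "y i = (\<Sum>j=1..i. v j *\<^sub>R x j)" for i
  define c where "c i = (\<Sum>j=1..<i. V v j * - u j) + (\<Sum>j=1..i. v j * r j)" for i
  have stay: "lower_rate w (\<zeta> (\<sigma> i)) (t + \<kappa> * v i) (y0 + \<kappa> *\<^sub>R (v i *\<^sub>R x i)) (c0 + \<kappa> * (v i * r i))"
    if i: "i \<in> {1..M}" and lb: "lower_rate w (\<zeta> (\<sigma> i)) t y0 c0" and t: "t \<ge> 0" for i t y0 c0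
  proof (cases "v i > 0")
    case True
    have "lower_rate w (\<zeta> (\<sigma> i)) (t + \<kappa> * v i) (y0 + (\<kappa> * v i) *\<^sub>R x i) (c0 + (\<kappa> * v i) * r i)"
      by (rule lower_rate_stay[OF w G[OF i] lb t]) (use I_real[OF i True] \<kappa> True in \<open>auto simp: I_def\<close>)
    then show ?thesis by (simp add: mult.assoc)
  next
    case False
    then have "v i = 0" using v0[OF i] by simp
    then show ?thesis using lb by simp
  qed
  \<comment> \<open>Classes before the first positive \<open>v i\<close> may be joined by infinite
    costs of weight 0, so they are not travelled through. The construction really begins at the
    first class of positive time, which \<open>start\<close> reaches directly; hence the condition
    \<open>V v i > 0\<close>.\<close>
  have claim: "V v i > 0 \<longrightarrow> lower_rate w (\<zeta> (\<sigma> i)) (\<kappa> * V v i) (\<kappa> *\<^sub>R y i) (\<kappa> * c i)"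
    if "1 \<le> i" "i \<le> M" for i
    using that
  proof (induction i rule: dec_induct)
    case base
    have "1 \<in> {1..M}" using M_pos by simp
    from stay[OF this start[OF G[OF this]]] show ?case by (simp add: y_def c_def)
  next
    case (step i)
    have i: "i \<in> {1..<M}" "i \<in> {1..M}" "Suc i \<in> {1..M}" using step by auto
    have pre: "lower_rate w (\<zeta> (\<sigma> (Suc i))) (\<kappa> * V v i) (\<kappa> *\<^sub>R y i) (\<kappa> * c i - \<kappa> * V v i * u i)"
      if VS: "V v (Suc i) > 0"
    proof (cases "V v i > 0")
      case True
      have K: "\<zeta> (\<sigma> i) \<in> {1..K}" "\<zeta> (\<sigma> (Suc i)) \<in> {1..K}" using G_subset[OF G] i by auto
      have "\<sigma> i \<noteq> \<sigma> (Suc i)" using injD[OF permutes_inj[OF \<sigma>], of i "Suc i"] by auto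
      then have ne: "\<zeta> (\<sigma> i) \<noteq> \<zeta> (\<sigma> (Suc i))" using \<zeta>_inj[OF s_in[OF i(2)] s_in[OF i(3)]] by blast
      obtain l where l: "route (\<zeta> (\<sigma> i)) (\<zeta> (\<sigma> (Suc i))) l" "U0 K P C (\<zeta> (\<sigma> i)) (\<zeta> (\<sigma> (Suc i))) = route_cost l"
        by (rule U0_attained[OF K ne])
      have ne': "l \<noteq> []" using l(1) by (auto simp: route_def)
      have rc: "route_cost l = ereal (u i)" using U_real[OF i(1) True] l(2) by (simp add: U_def)
      have "lower_rate w (hd l) (\<kappa> * V v i) (\<kappa> *\<^sub>R y i) (\<kappa> * c i)"
        using step True l(1) by (simp add: route_def)
      then have "lower_rate w (last l) (\<kappa> * V v i) (\<kappa> *\<^sub>R y i) (\<kappa> * c i - \<kappa> * V v i * u i)"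
        using l(1) ne' rc \<kappa> True by (intro lower_rate_route[OF w _ cross]) (auto simp: route_def)
      then show ?thesis using l(1) by (simp add: route_def)
    next
      case False
      then have Vi: "V v i = 0" using V0[OF i(2)] by simp
      have vj: "v j = 0" if "j \<in> {1..i}" for j
      proof -
        have "v j \<le> V v i" using that v0 i by (intro member_le_sum) auto
        then show ?thesis using Vi v0[of j] that i by auto
      qed
      have Vj: "V v j = 0" if "j \<in> {1..<i}" for j using vj that by (intro sum.neutral) auto
      have "y i = 0" unfolding y_def using vj by (intro sum.neutral) auto
      moreover have "c i = 0" unfolding c_def using vj Vj by simp
      ultimately show ?thesis using start[OF G[OF i(3)]] Vi by simp
    qed
    have yS: "\<kappa> *\<^sub>R y (Suc i) = \<kappa> *\<^sub>R y i + \<kappa> *\<^sub>R (v (Suc i) *\<^sub>R x (Suc i))"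
      by (simp add: y_def scaleR_add_right)
    have cS: "\<kappa> * c (Suc i) = \<kappa> * c i - \<kappa> * V v i * u i + \<kappa> * (v (Suc i) * r (Suc i))"
      using step by (simp add: c_def algebra_simps)
    have VS: "\<kappa> * V v (Suc i) = \<kappa> * V v i + \<kappa> * v (Suc i)" by (simp add: algebra_simps)
    show ?case
    proof
      assume "V v (Suc i) > 0"
      from stay[OF i(3) pre[OF this]] V0[OF i(2)] \<kappa>
      show "lower_rate w (\<zeta> (\<sigma> (Suc i))) (\<kappa> * V v (Suc i)) (\<kappa> *\<^sub>R y (Suc i)) (\<kappa> * c (Suc i))"
        unfolding yS cS VS by simp
    qed
  qed
  have "lower_rate w (\<zeta> (\<sigma> M)) \<kappa> (\<kappa> *\<^sub>R y M) (\<kappa> * c M)"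
    using claim[of M] M_pos v1 by simp
  moreover have "\<kappa> * c M \<le> \<beta>"
  proof -
    have "ereal (c M) = ?S1 + ?S2" unfolding S1_eq S2_eq c_def by (simp only: plus_ereal.simps(1))
    then have "ereal (c M) < ereal \<beta>" "0 \<le> ereal (c M)" using pc S0 by auto
    then have "c M < \<beta>" "0 \<le> c M" by (auto simp: zero_ereal_def)
    moreover have "\<kappa> * c M \<le> 1 * c M" using \<kappa> \<open>0 \<le> c M\<close> by (intro mult_right_mono) auto
    ultimately show ?thesis by linarith
  qed
  ultimately show ?thesis unfolding y_def by (rule lower_rate_mono)
qed

text \<open>The target \<open>\<kappa> *\<^sub>R z\<close> is met at about time
  \<open>\<kappa> * n\<close>; the remaining steps are unrestricted, have total weight 1 by
  stochasticity, and change the mean by a multiple of \<open>1 - \<kappa>\<close>, which a ball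
  around \<open>z\<close> absorbs.\<close>

lemma liminf_ge_of_lower_rate:
  assumes w: "\<And>x. 0 \<le> w x" and H: "open H" "z \<in> H"
    and lb: "\<And>\<kappa>. 0 < \<kappa> \<Longrightarrow> \<kappa> < 1 \<Longrightarrow> lower_rate w i \<kappa> (\<kappa> *\<^sub>R z) \<beta>"
  shows "ereal (- \<beta>) \<le> liminf (log_rate (\<lambda>n. \<Sum>x\<in>UNIV. w x * (\<Sum>ys | length ys = n \<and> (1 / real n) *\<^sub>R sum_list (map f ys) \<in> H. pathw P 0 x ys)))"
    (is "_ \<le> liminf (log_rate ?p)")
proof -
  obtain \<delta> where \<delta>: "\<delta> > 0" "ball z \<delta> \<subseteq> H" using H by (meson open_contains_ball)
  \<comment> \<open>Displacement of the mean per unit of \<open>\<eta>\<close>: 1 from the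
    tolerance, \<open>norm z\<close> from the missing fraction of the target, \<open>2 * R\<close>
    from at most \<open>2 * \<eta> * n\<close> free steps.\<close>
  define D where "D = 1 + norm z + 2 * R"
  have D: "D > 0" using R_nonneg norm_ge_zero[of z] unfolding D_def by linarith
  define \<eta> where "\<eta> = min (1/2) (\<delta> / (2 * D))"
  have \<eta>: "0 < \<eta>" "\<eta> < 1" using \<delta> D by (auto simp: \<eta>_def)
  have "\<eta> \<le> \<delta> / (2 * D)" by (simp add: \<eta>_def)
  then have \<eta>D: "\<eta> * D \<le> \<delta> / 2" using D by (simp add: field_simps)
  have main: "ereal (- (\<beta> + \<epsilon>)) \<le> liminf (log_rate ?p)" if \<epsilon>: "\<epsilon> > 0" for \<epsilon>
  proof -
    \<comment> \<open>\<open>e \<le> \<eta>\<close> guarantees that the arrival time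
      \<open>T\<close> is at most \<open>n\<close>.\<close>
    define e where "e = min \<eta> \<epsilon>"
    have e: "e > 0" "e \<le> \<eta>" "e \<le> \<epsilon>" using \<eta> \<epsilon> by (auto simp: e_def)
    have \<kappa>: "0 < 1 - \<eta>" "1 - \<eta> < 1" using \<eta> by auto
    obtain n0 where n0: "\<forall>n\<ge>n0. \<exists>T a. 0 \<le> T \<and> a \<in> C i \<and> \<bar>real T - (1 - \<eta>) * real n\<bar> \<le> e * real n \<and>
      exp (- (real n * (\<beta> + e))) \<le> mass w T a {s. norm (s - real n *\<^sub>R ((1 - \<eta>) *\<^sub>R z)) \<le> e * real n}"
      using lower_rateD[OF lb[OF \<kappa>] e(1), of 0] by (rule exE)
    show ?thesis
    proof (rule Liminf_bounded)
      show "\<forall>\<^sub>F n in sequentially. ereal (- (\<beta> + \<epsilon>)) \<le> log_rate ?p n"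
        using eventually_ge_at_top[of "max 1 n0"]
      proof eventually_elim
        case (elim n)
        then have n: "n \<ge> 1" "n \<ge> n0" by auto
        obtain T a where Ta: "\<bar>real T - (1 - \<eta>) * real n\<bar> \<le> e * real n"
          "exp (- (real n * (\<beta> + e))) \<le> mass w T a {s. norm (s - real n *\<^sub>R ((1 - \<eta>) *\<^sub>R z)) \<le> e * real n}"
          using n0[rule_format, OF n(2)] by blast
        let ?B = "{s. norm (s - real n *\<^sub>R ((1 - \<eta>) *\<^sub>R z)) \<le> e * real n}"
        have en: "e * real n \<le> \<eta> * real n" using e by (intro mult_right_mono) auto
        have "real T \<le> real n" using Ta(1) en by (simp add: algebra_simps)
        then have Tn: "T \<le> n" by simp
        let ?A = "{zs :: 's list. length zs = n - T}"
        have "mass w T a ?B * (\<Sum>zs\<in>?A. pathw P T a zs)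
          \<le> (\<Sum>x\<in>UNIV. w x * (\<Sum>us | length us = T + (n - T) \<and> (1 / real n) *\<^sub>R sum_list (map f us) \<in> H. pathw P 0 x us))"
        proof (rule mass_extend[OF w])
          fix x ys zs assume ys: "length ys = T" "sum_list (map f ys) \<in> ?B" and zs: "zs \<in> ?A"
          let ?s = "sum_list (map f ys)" and ?s' = "sum_list (map f zs)"
          have "norm ((?s + ?s') - real n *\<^sub>R z) = norm ((?s - real n *\<^sub>R ((1 - \<eta>) *\<^sub>R z)) + (?s' - (real n * \<eta>) *\<^sub>R z))"
            by (simp add: algebra_simps)
          also have "\<dots> \<le> norm (?s - real n *\<^sub>R ((1 - \<eta>) *\<^sub>R z)) + (norm ?s' + norm ((real n * \<eta>) *\<^sub>R z))"
            by (rule norm_triangle_mono[OF order_refl norm_triangle_ineq4])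
          also have "\<dots> \<le> \<eta> * real n + (R * (2 * \<eta> * real n) + real n * \<eta> * norm z)"
          proof (intro add_mono)
            show "norm (?s - real n *\<^sub>R ((1 - \<eta>) *\<^sub>R z)) \<le> \<eta> * real n" using ys(2) en by simp
            have "real (n - T) \<le> 2 * \<eta> * real n" using Ta(1) en Tn by (simp add: of_nat_diff algebra_simps)
            then have "R * real (n - T) \<le> R * (2 * \<eta> * real n)" by (rule mult_left_mono[OF _ R_nonneg])
            then show "norm ?s' \<le> R * (2 * \<eta> * real n)" using norm_sum_list_f_le[of zs] zs by simp
            show "norm ((real n * \<eta>) *\<^sub>R z) \<le> real n * \<eta> * norm z" using \<eta> by simp
          qed
          also have "\<dots> = real n * (\<eta> * D)" by (simp add: D_def algebra_simps)
          also have "\<dots> < real n * \<delta>" using \<eta>D \<delta> n by (intro mult_strict_left_mono) auto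
          finally have lt: "norm ((?s + ?s') - real n *\<^sub>R z) < real n * \<delta>" .
          have "(1 / real n) *\<^sub>R (?s + ?s') - z = (1 / real n) *\<^sub>R ((?s + ?s') - real n *\<^sub>R z)"
            using n by (simp add: scaleR_diff_right)
          then have "norm ((1 / real n) *\<^sub>R (?s + ?s') - z) = norm ((?s + ?s') - real n *\<^sub>R z) / real n"
            by (simp add: divide_inverse mult.commute)
          also have "\<dots> < \<delta>" using lt n by (simp add: field_simps)
          finally have "(1 / real n) *\<^sub>R (?s + ?s') \<in> ball z \<delta>" by (simp add: dist_norm norm_minus_commute)
          then show "(1 / real n) *\<^sub>R sum_list (map f (ys @ zs)) \<in> H" using \<delta>(2) by auto
        qed auto
        moreover have "(\<Sum>zs\<in>?A. pathw P T a zs) = 1"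
        proof -
          have "evol P (n - T) T (\<lambda>_. 1) a = 1" by (rule evol_stochastic) (use stochastic_P in simp)
          then show ?thesis by (simp add: evol_eq_sum)
        qed
        ultimately have le: "mass w T a ?B \<le> ?p n" using Tn by simp
        have "real n * (\<beta> + e) \<le> real n * (\<beta> + \<epsilon>)" using e by (intro mult_left_mono) auto
        then have "exp (real n * (- (\<beta> + \<epsilon>))) \<le> exp (- (real n * (\<beta> + e)))"
          by (simp only: exp_le_cancel_iff mult_minus_right neg_le_iff_le)
        then have "exp (real n * (- (\<beta> + \<epsilon>))) \<le> ?p n" using Ta(2) le by linarith
        then show ?case unfolding log_rate_ge_iff[OF n(1)] .
      qed
    qed
  qed
  show ?thesis
  proof (rule ccontr)
    assume "\<not> ?thesis"
    then have "liminf (log_rate ?p) < ereal (- \<beta>)" by simp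
    then obtain c where c: "liminf (log_rate ?p) < ereal c" "ereal c < ereal (- \<beta>)" using ereal_dense2 by blast
    have "- \<beta> - c > 0" using c(2) by simp
    from main[OF this] have "ereal c \<le> liminf (log_rate ?p)" by simp
    then show False using c(1) by simp
  qed
qed

text \<open>Convergence provides an index with the property in \<open>first_positive_index\<close>,
  so that \<open>LEAST\<close> has a meaning. Steps after the time \<open>n\<close> of the condition
  end at time \<open>n + 1\<close> or later, which the bound on \<open>n\<close> places at or beyond
  that index. Positive probability of the class passes to one of its finitely many states.\<close>

lemma start_of_SIE:
  fixes \<Omega> :: "'w measure" and X :: "nat \<Rightarrow> 'w \<Rightarrow> 's"
  assumes chain: "nonhomogeneous_chain \<Omega> X \<pi> P" and SIE: "condition_SIE \<Omega> X p P C G" and i: "i \<in> G"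
  shows "lower_rate (pmf \<pi>) i 0 0 0"
proof -
  interpret prob_space \<Omega> by (rule chain_prob_space[OF chain])
  let ?good = "\<lambda>m. m \<ge> 1 \<and> (\<forall>i\<in>G. \<forall>s\<in>C i. \<forall>t\<in>C i. p s t > 0 \<longrightarrow> (\<forall>n\<ge>m. P n s t > 0))"
  have "\<forall>\<^sub>F n in sequentially. \<forall>s. \<forall>t. p s t > 0 \<longrightarrow> P n s t > 0"
  proof (intro eventually_all_finite)
    show "\<forall>\<^sub>F n in sequentially. p s t > 0 \<longrightarrow> P n s t > 0" for s t
      using order_tendstoD(1)[OF convergence, of 0 s t] by (cases "p s t > 0") auto
  qed
  then obtain k where k: "\<And>n s t. n \<ge> k \<Longrightarrow> p s t > 0 \<Longrightarrow> P n s t > 0" unfolding eventually_sequentially by blast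
  have "?good (max 1 k)" using k by simp
  then have good: "?good (first_positive_index p P C G)"
    unfolding first_positive_index_def by (rule LeastI[of ?good])
  obtain n where n: "n \<ge> first_positive_index p P C G - 1" "prob {\<omega> \<in> space \<Omega>. X n \<omega> \<in> C i} > 0"
    using SIE i unfolding condition_SIE_def by blast
  have "\<exists>a\<in>C i. prob {\<omega> \<in> space \<Omega>. X n \<omega> = a} > 0"
  proof (rule ccontr)
    assume "\<not> ?thesis"
    then have z: "prob {\<omega> \<in> space \<Omega>. X n \<omega> = a} \<le> 0" if "a \<in> C i" for a using that by (meson not_less)
    have "prob {\<omega> \<in> space \<Omega>. X n \<omega> \<in> C i} = prob (\<Union>a\<in>C i. {\<omega> \<in> space \<Omega>. X n \<omega> = a})"
      by (rule arg_cong[where f = prob]) auto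
    also have "\<dots> \<le> (\<Sum>a\<in>C i. prob {\<omega> \<in> space \<Omega>. X n \<omega> = a})"
      using chain_event_sets[OF chain] by (intro finite_measure_subadditive_finite) auto
    also have "\<dots> \<le> 0" using z by (rule sum_nonpos)
    finally show False using n(2) by simp
  qed
  then obtain a where a: "a \<in> C i" "prob {\<omega> \<in> space \<Omega>. X n \<omega> = a} > 0" by blast
  have "X n \<omega> = last (X 0 \<omega> # map (\<lambda>k. X (Suc k) \<omega>) [0..<n])" for \<omega>
    by (cases n) auto
  then have "prob {\<omega> \<in> space \<Omega>. X n \<omega> = a} = mass (pmf \<pi>) n a UNIV"
    unfolding mass_def using prob_eq_sum_paths[OF chain, of "\<lambda>x ys. last (x # ys) = a" n] by (simp del: last.simps)
  then show ?thesis
  proof (intro lower_rate_start[where ?a1.0 = a and ?n1.0 = n])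
    fix m s t assume m: "m > n" and st: "s \<in> C i" "t \<in> C i" "p s t > 0"
    have "m \<ge> first_positive_index p P C G" using n(1) m by linarith
    then show "P m s t > 0" using good i st by blast
  qed (use i a in auto)
qed

text \<open>A point \<open>z\<close> of \<open>H\<close> with \<open>J z < \<beta>\<close> comes
  with a plan \<open>(v, x, \<sigma>)\<close> of cost below \<open>\<beta>\<close>; the plan is
  realised for every \<open>\<kappa>\<close> below 1, and openness of \<open>H\<close> absorbs the
  shift from \<open>\<kappa> *\<^sub>R z\<close> to \<open>z\<close>.\<close>

lemma lower_bound:
  fixes \<Omega> :: "'w measure" and X :: "nat \<Rightarrow> 'w \<Rightarrow> 's"
  assumes chain: "nonhomogeneous_chain \<Omega> X \<pi> P" and SIE: "condition_SIE \<Omega> X p P C G"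
    and A: "assumption_A K P C" and BC: "assumption_B K P C \<or> assumption_C p P C G" and H: "open H"
  shows "- (INF z\<in>H. J z) \<le> liminf (log_rate (\<lambda>n. \<P>(\<omega> in \<Omega>. empirical_mean f X n \<omega> \<in> H)))"
    (is "_ \<le> ?L")
proof (rule ccontr)
  assume "\<not> ?thesis"
  then have "?L < - (INF z\<in>H. J z)" by (simp only: not_le)
  then have "- (- (INF z\<in>H. J z)) < - ?L" by (simp only: ereal_minus_less_minus)
  then have "(INF z\<in>H. J z) < - ?L" by (simp only: ereal_uminus_uminus)
  then obtain z where z: "z \<in> H" "J z < - ?L" unfolding INF_less_iff by (rule bexE)
  from z(2) obtain \<beta> where \<beta>: "J z < ereal \<beta>" "ereal \<beta> < - ?L" using ereal_dense2 by blast
  obtain v x \<sigma> where h: "v \<in> prob_vectors M" "\<sigma> permutes {1..M}" "(\<Sum>i=1..M. v i *\<^sub>R x i) = z"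
    "path_cost M \<zeta> (\<lambda>i. class_rate p f (C i)) (U0 K P C) v \<sigma> x < ereal \<beta>"
    by (rule J_fun_lessE[OF \<beta>(1)])
  have cross: "crossable i j u" if "i \<in> {1..K}" "j \<in> {1..K}" "i \<noteq> j" "ups i j = ereal u" for i j u
    using BC crossable_B[OF A _ that] crossable_C[OF A _ that] by blast
  have w0: "0 \<le> pmf \<pi> x" for x by simp
  have start: "lower_rate (pmf \<pi>) i 0 0 0" if "i \<in> G" for i by (rule start_of_SIE[OF chain SIE that])
  have "ereal (- \<beta>) \<le> ?L"
    unfolding prob_empirical_mean[OF chain]
  proof (rule liminf_ge_of_lower_rate[OF _ H z(1)])
    fix \<kappa> :: real assume \<kappa>: "0 < \<kappa>" "\<kappa> < 1"
    show "lower_rate (pmf \<pi>) (\<zeta> (\<sigma> M)) \<kappa> (\<kappa> *\<^sub>R z) \<beta>"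
      unfolding h(3)[symmetric]
    proof (rule lower_rate_total[OF _ _ _ h(2,1,4) \<kappa>])
      show "0 \<le> pmf \<pi> x" for x by (rule w0)
      show "lower_rate (pmf \<pi>) i 0 0 0" if "i \<in> G" for i by (rule start[OF that])
      show "crossable i j u" if "i \<in> {1..K}" "j \<in> {1..K}" "i \<noteq> j" "ups i j = ereal u" for i j u
        by (rule cross[OF that])
    qed
  qed (rule w0)
  then have "- ?L \<le> - ereal (- \<beta>)" by (simp only: ereal_minus_le_minus)
  then have "- ?L \<le> ereal \<beta>" by simp
  then show False using \<beta>(2) by simp
qed

end

theorem theorem3p3:
  fixes P :: "nat \<Rightarrow> 's::finite \<Rightarrow> 's \<Rightarrow> real"
    and p :: "'s \<Rightarrow> 's \<Rightarrow> real"
    and \<pi> :: "'s pmf"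
    and \<Omega> :: "'w measure"
    and X :: "nat \<Rightarrow> 'w \<Rightarrow> 's"
    and f :: "'s \<Rightarrow> real ^ 'd"
    and C :: "nat \<Rightarrow> 's set"
    and N M :: nat
    and \<zeta> :: "nat \<Rightarrow> nat"
  defines "G \<equiv> irreducible_indices p (N + M) C"
    and "J \<equiv> J_fun M \<zeta> (\<lambda>i. class_rate p f (C i)) (U0 (N + M) P C)"
    and "Z \<equiv> empirical_mean f X"
  assumes stochastic_P: "\<And>n. n \<ge> 1 \<Longrightarrow> stochastic (P n)"
    and stochastic_p: "stochastic p"
    and convergence: "\<And>x y. (\<lambda>n. P n x y) \<longlonglongrightarrow> p x y"
    and chain: "nonhomogeneous_chain \<Omega> X \<pi> P"
    and classes: "class_numbering p (N + M) C"
    and enumeration: "bij_betw \<zeta> {1..M} G"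
    and SIE: "condition_SIE \<Omega> X p P C G"
    and A: "assumption_A (N + M) P C"
    and B_or_C: "assumption_B (N + M) P C \<or> assumption_C p P C G"
  shows "good_rate_function J \<and>
    (\<forall>\<Gamma> \<in> sets borel.
       - (INF z\<in>interior \<Gamma>. J z)
         \<le> liminf (log_rate (\<lambda>n. \<P>(\<omega> in \<Omega>. Z n \<omega> \<in> interior \<Gamma>)))
     \<and> liminf (log_rate (\<lambda>n. \<P>(\<omega> in \<Omega>. Z n \<omega> \<in> interior \<Gamma>)))
         \<le> limsup (log_rate (\<lambda>n. \<P>(\<omega> in \<Omega>. Z n \<omega> \<in> closure \<Gamma>)))
     \<and> limsup (log_rate (\<lambda>n. \<P>(\<omega> in \<Omega>. Z n \<omega> \<in> closure \<Gamma>)))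
         \<le> - (INF z\<in>closure \<Gamma>. J z))"
proof -
  interpret ldp_setting P p C "N + M" f M \<zeta>
    using stochastic_P stochastic_p convergence classes enumeration unfolding G_def by unfold_locales
  show ?thesis
  proof (intro conjI ballI)
    show "good_rate_function J" unfolding J_def by (rule good_rate_function_J)
    fix \<Gamma> :: "(real ^ 'd) set"
    show "- (INF z\<in>interior \<Gamma>. J z) \<le> liminf (log_rate (\<lambda>n. \<P>(\<omega> in \<Omega>. Z n \<omega> \<in> interior \<Gamma>)))"
      unfolding J_def Z_def
      using lower_bound[OF chain] SIE A B_or_C unfolding G_def by blast
    show "limsup (log_rate (\<lambda>n. \<P>(\<omega> in \<Omega>. Z n \<omega> \<in> closure \<Gamma>))) \<le> - (INF z\<in>closure \<Gamma>. J z)"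
      unfolding J_def Z_def by (rule upper_bound[OF chain closed_closure])
    interpret prob_space \<Omega> by (rule chain_prob_space[OF chain])
    have "prob {\<omega> \<in> space \<Omega>. Z n \<omega> \<in> interior \<Gamma>} \<le> prob {\<omega> \<in> space \<Omega>. Z n \<omega> \<in> closure \<Gamma>}" for n
      unfolding Z_def using interior_subset[of \<Gamma>] closure_subset[of \<Gamma>]
      by (intro finite_measure_mono empirical_mean_sets[OF chain]) blast
    then have "liminf (log_rate (\<lambda>n. \<P>(\<omega> in \<Omega>. Z n \<omega> \<in> interior \<Gamma>)))
        \<le> liminf (log_rate (\<lambda>n. \<P>(\<omega> in \<Omega>. Z n \<omega> \<in> closure \<Gamma>)))"
      by (intro Liminf_mono always_eventually allI log_rate_mono)
    also have "\<dots> \<le> limsup (log_rate (\<lambda>n. \<P>(\<omega> in \<Omega>. Z n \<omega> \<in> closure \<Gamma>)))"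
      by (rule Liminf_le_Limsup) simp
    finally show "liminf (log_rate (\<lambda>n. \<P>(\<omega> in \<Omega>. Z n \<omega> \<in> interior \<Gamma>)))
         \<le> limsup (log_rate (\<lambda>n. \<P>(\<omega> in \<Omega>. Z n \<omega> \<in> closure \<Gamma>)))" .
  qed
qed

end
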